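(* Let $(\mathcal E,D(\mathcal E))$ be a regular, transient Dirichlet form on $L^2(E;m)$ satisfying the strong sector condition. For $i=1,2$ let $f^i:E\times\mathbb R\to\mathbb R$ be measurable, $\mu_i\in\mathcal M_{0,b}(E)$, and let $u_i$ be a renormalized solution of $-Lu=f^i(\cdot,u)+\mu_i$. Assume $\mu_1\le\mu_2$ and either (a) $f^1(x,u_1(x))\le f^2(x,u_1(x))$ for $m$-a.e. $x$ and $f^2$ satisfies $(f^2(x,y_1)-f^2(x,y_2))(y_1-y_2)\le0$ for all $y_1,y_2\in\mathbb R$, $x\in E$; or (b) $f^1(x,u_2(x))\le f^2(x,u_2(x))$ for $m$-a.e. $x$ and $f^1$ satisfies $(f^1(x,y_1)-f^1(x,y_2))(y_1-y_2)\le0$ for all $y_1,y_2\in\mathbb R$, $x\in E$. Then $u_1(x)\le u_2(x)$ for q.e. $x\in E$.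
   Context: $E$ is a locally compact separable metric space, $m$ an everywhere dense Radon measure. A Dirichlet form is a closed positive definite form on $L^2(E;m)$ satisfying the weak sector condition and the sub-Markov and dual sub-Markov properties; strong sector condition: $|\mathcal E(u,v)|\le K\mathcal E(u,u)^{1/2}\mathcal E(v,v)^{1/2}$. Transience: $\lim_{l\to\infty}G_{1/l}f<\infty$ $m$-a.e. for every nonnegative $f\in L^\infty(E;m)$. $D_e(\mathcal E)$ is the extended Dirichlet space (measurable a.e. finite limits $m$-a.e. of $\tilde{\mathcal E}$-Cauchy sequences in $D(\mathcal E)$), to which $\mathcal E$ extends. Quasi notions (q.e., quasi-continuity) are with respect to the capacity of $\mathcal E$; $\tilde v$ is the quasi-continuous version of $v\in D_e(\mathcal E)$. $L$ is the operator associated with $\mathcal E$ via $(-Lu,v)=\mathcal E(u,v)$. A smooth measure is a positive measure charging no exceptional set and finite on the sets of some nest of compacts; $\mathcal M_{0,b}(E)$ is the set of signed measures $\mu$ with $|\mu|$ smooth and $|\mu|(E)<\infty$. $T_ky=((-k)\vee y)\wedge k$. For measurable $f$ and $\mu\in\mathcal M_{0,b}(E)$, $u$ is a renormalized solution of $-Lu=f(\cdot,u)+\mu$ if (a) $u$ is quasi-continuous, $f(\cdot,u)\in L^1(E;m)$, $T_ku\in D_e(\mathcal E)$ for all $k>0$; (b) there are $\nu_k\in\mathcal M_{0,b}(E)$ with $\|\nu_k\|_{TV}\to0$ such that for all $k\in\mathbb N$ and bounded $v\in D_e(\mathcal E)$, $\mathcal E(T_ku,v)=\int_E\tilde v f(\cdot,u)\,dm+\int_E\tilde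 v\,d\mu+\int_E\tilde v\,d\nu_k$. *)

theory Defs
  imports "HOL-Analysis.Analysis"
begin

text \<open>Framework of Ma--Roeckner for (non-symmetric) Dirichlet forms.  Elements of
  L2(E;m) are represented by Borel functions; the form is required to respect
  m-a.e. equality.  The state space E is the whole type 'a.\<close>

definition radon_full :: "'a::{metric_space,second_countable_topology} measure \<Rightarrow> bool" where
  "radon_full m \<longleftrightarrow> sets m = sets borel \<and>
     (\<forall>K. compact K \<longrightarrow> emeasure m K < \<infinity>) \<and>
     (\<forall>U. open U \<and> U \<noteq> {} \<longrightarrow> emeasure m U > 0)"

definition L2 :: "'a measure \<Rightarrow> ('a \<Rightarrow> real) set" where
  "L2 m = {f. f \<in> borel_measurable m \<and> integrable m (\<lambda>x. (f x)\<^sup>2)}"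

definition E1 :: "'a measure \<Rightarrow> (('a\<Rightarrow>real) \<Rightarrow> ('a\<Rightarrow>real) \<Rightarrow> real) \<Rightarrow> ('a\<Rightarrow>real) \<Rightarrow> ('a\<Rightarrow>real) \<Rightarrow> real" where
  "E1 m \<E> u v = \<E> u v + (\<integral>x. u x * v x \<partial>m)"

definition form_on_L2 :: "'a measure \<Rightarrow> (('a\<Rightarrow>real) \<Rightarrow> ('a\<Rightarrow>real) \<Rightarrow> real) \<Rightarrow> ('a\<Rightarrow>real) set \<Rightarrow> bool" where
  "form_on_L2 m \<E> D \<longleftrightarrow>
     D \<subseteq> L2 m \<and> (\<lambda>x. 0) \<in> D \<and>
     (\<forall>u\<in>D. \<forall>v\<in>D. \<forall>a b::real. (\<lambda>x. a * u x + b * v x) \<in> D) \<and>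
     (\<forall>u\<in>D. \<forall>u'. u' \<in> borel_measurable m \<and> (AE x in m. u' x = u x) \<longrightarrow> u' \<in> D) \<and>
     (\<forall>u\<in>D. \<forall>u'\<in>D. \<forall>v\<in>D. \<forall>v'\<in>D.
        (AE x in m. u' x = u x) \<and> (AE x in m. v' x = v x) \<longrightarrow> \<E> u' v' = \<E> u v) \<and>
     (\<forall>f\<in>L2 m. \<forall>\<epsilon>>0. \<exists>u\<in>D. (\<integral>x. (f x - u x)\<^sup>2 \<partial>m) < \<epsilon>) \<and>
     (\<forall>u\<in>D. \<forall>w\<in>D. \<forall>v\<in>D. \<forall>a b::real.
        \<E> (\<lambda>x. a * u x + b * w x) v = a * \<E> u v + b * \<E> w v \<and>
        \<E> v (\<lambda>x. a * u x + b * w x) = a * \<E> v u + b * \<E> v w)"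

definition dirichlet_form :: "'a measure \<Rightarrow> (('a\<Rightarrow>real) \<Rightarrow> ('a\<Rightarrow>real) \<Rightarrow> real) \<Rightarrow> ('a\<Rightarrow>real) set \<Rightarrow> bool" where
  "dirichlet_form m \<E> D \<longleftrightarrow> form_on_L2 m \<E> D \<and>
     (\<forall>u\<in>D. \<E> u u \<ge> 0) \<and>
     (\<exists>K. \<forall>u\<in>D. \<forall>v\<in>D. \<bar>E1 m \<E> u v\<bar> \<le> K * sqrt (E1 m \<E> u u) * sqrt (E1 m \<E> v v)) \<and>
     (\<forall>un. (\<forall>n. un n \<in> D) \<and>
        (\<forall>\<epsilon>>0. \<exists>N. \<forall>n\<ge>N. \<forall>k\<ge>N.
            E1 m \<E> (\<lambda>x. un n x - un k x) (\<lambda>x. un n x - un k x) < \<epsilon>) \<longrightarrow>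
        (\<exists>u\<in>D. (\<lambda>n. E1 m \<E> (\<lambda>x. un n x - u x) (\<lambda>x. un n x - u x)) \<longlonglongrightarrow> 0)) \<and>
     (\<forall>u\<in>D. (\<lambda>x. min (max (u x) 0) 1) \<in> D \<and>
        \<E> (\<lambda>x. u x + min (max (u x) 0) 1) (\<lambda>x. u x - min (max (u x) 0) 1) \<ge> 0 \<and>
        \<E> (\<lambda>x. u x - min (max (u x) 0) 1) (\<lambda>x. u x + min (max (u x) 0) 1) \<ge> 0)"

definition strong_sector :: "(('a\<Rightarrow>real) \<Rightarrow> ('a\<Rightarrow>real) \<Rightarrow> real) \<Rightarrow> ('a\<Rightarrow>real) set \<Rightarrow> bool" where
  "strong_sector \<E> D \<longleftrightarrow>
     (\<exists>K. \<forall>u\<in>D. \<forall>v\<in>D. \<bar>\<E> u v\<bar> \<le> K * sqrt (\<E> u u) * sqrt (\<E> v v))"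

definition Cc :: "('a::topological_space \<Rightarrow> real) \<Rightarrow> bool" where
  "Cc f \<longleftrightarrow> continuous_on UNIV f \<and> compact (closure {x. f x \<noteq> 0})"

definition regular_form :: "'a::topological_space measure \<Rightarrow> (('a\<Rightarrow>real) \<Rightarrow> ('a\<Rightarrow>real) \<Rightarrow> real) \<Rightarrow> ('a\<Rightarrow>real) set \<Rightarrow> bool" where
  "regular_form m \<E> D \<longleftrightarrow>
     (\<forall>u\<in>D. \<forall>\<epsilon>>0. \<exists>w\<in>D. Cc w \<and> E1 m \<E> (\<lambda>x. u x - w x) (\<lambda>x. u x - w x) < \<epsilon>) \<and>
     (\<forall>g. Cc g \<longrightarrow> (\<forall>\<epsilon>>0. \<exists>w\<in>D. Cc w \<and> (\<forall>x. \<bar>g x - w x\<bar> < \<epsilon>)))"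

definition resolvent :: "'a measure \<Rightarrow> (('a\<Rightarrow>real) \<Rightarrow> ('a\<Rightarrow>real) \<Rightarrow> real) \<Rightarrow> ('a\<Rightarrow>real) set \<Rightarrow> real \<Rightarrow> ('a\<Rightarrow>real) \<Rightarrow> ('a\<Rightarrow>real) \<Rightarrow> bool" where
  "resolvent m \<E> D \<alpha> g w \<longleftrightarrow> w \<in> D \<and>
     (\<forall>v\<in>D. \<E> w v + \<alpha> * (\<integral>x. w x * v x \<partial>m) = (\<integral>x. g x * v x \<partial>m))"

text \<open>Transience: for bounded nonnegative f, G_{1/l} f (the monotone extension of the
  resolvent, i.e. the essential supremum of G_{1/l} g over 0 \<le> g \<le> f, g in L2)
  has an m-a.e. finite limit as l tends to infinity.\<close>
definition transient :: "'a measure \<Rightarrow> (('a\<Rightarrow>real) \<Rightarrow> ('a\<Rightarrow>real) \<Rightarrow> real) \<Rightarrow> ('a\<Rightarrow>real) set \<Rightarrow> bool" where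
  "transient m \<E> D \<longleftrightarrow>
     (\<forall>f. f \<in> borel_measurable m \<and> (AE x in m. 0 \<le> f x) \<and> (\<exists>C. AE x in m. f x \<le> C) \<longrightarrow>
        (\<exists>F::'a \<Rightarrow> ennreal. F \<in> borel_measurable m \<and> (AE x in m. F x < \<infinity>) \<and>
           (\<forall>l::nat. l \<ge> 1 \<longrightarrow> (\<forall>g\<in>L2 m. \<forall>w.
              (AE x in m. 0 \<le> g x \<and> g x \<le> f x) \<and> resolvent m \<E> D (1 / real l) g w \<longrightarrow>
              (AE x in m. ennreal (w x) \<le> F x)))))"

definition DF :: "'a measure \<Rightarrow> ('a\<Rightarrow>real) set \<Rightarrow> 'a set \<Rightarrow> ('a\<Rightarrow>real) set" where
  "DF m D F = {u\<in>D. AE x in m. x \<notin> F \<longrightarrow> u x = 0}"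

definition nest :: "'a::topological_space measure \<Rightarrow> (('a\<Rightarrow>real) \<Rightarrow> ('a\<Rightarrow>real) \<Rightarrow> real) \<Rightarrow> ('a\<Rightarrow>real) set \<Rightarrow> (nat \<Rightarrow> 'a set) \<Rightarrow> bool" where
  "nest m \<E> D Fs \<longleftrightarrow> incseq Fs \<and> (\<forall>k. closed (Fs k)) \<and>
     (\<forall>u\<in>D. \<forall>\<epsilon>>0. \<exists>k. \<exists>w\<in>DF m D (Fs k). E1 m \<E> (\<lambda>x. u x - w x) (\<lambda>x. u x - w x) < \<epsilon>)"

definition exceptional :: "'a::topological_space measure \<Rightarrow> (('a\<Rightarrow>real) \<Rightarrow> ('a\<Rightarrow>real) \<Rightarrow> real) \<Rightarrow> ('a\<Rightarrow>real) set \<Rightarrow> 'a set \<Rightarrow> bool" where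
  "exceptional m \<E> D N \<longleftrightarrow> (\<exists>Fs. nest m \<E> D Fs \<and> N \<subseteq> (\<Inter>k. - Fs k))"

definition qe :: "'a::topological_space measure \<Rightarrow> (('a\<Rightarrow>real) \<Rightarrow> ('a\<Rightarrow>real) \<Rightarrow> real) \<Rightarrow> ('a\<Rightarrow>real) set \<Rightarrow> ('a \<Rightarrow> bool) \<Rightarrow> bool" where
  "qe m \<E> D P \<longleftrightarrow> exceptional m \<E> D {x. \<not> P x}"

definition quasi_continuous :: "'a::topological_space measure \<Rightarrow> (('a\<Rightarrow>real) \<Rightarrow> ('a\<Rightarrow>real) \<Rightarrow> real) \<Rightarrow> ('a\<Rightarrow>real) set \<Rightarrow> ('a \<Rightarrow> real) \<Rightarrow> bool" where
  "quasi_continuous m \<E> D u \<longleftrightarrow> (\<exists>Fs. nest m \<E> D Fs \<and> (\<forall>k. continuous_on (Fs k) u))"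

definition smooth :: "'a::topological_space measure \<Rightarrow> (('a\<Rightarrow>real) \<Rightarrow> ('a\<Rightarrow>real) \<Rightarrow> real) \<Rightarrow> ('a\<Rightarrow>real) set \<Rightarrow> 'a measure \<Rightarrow> bool" where
  "smooth m \<E> D \<mu> \<longleftrightarrow> sets \<mu> = sets borel \<and>
     (\<forall>N\<in>sets borel. exceptional m \<E> D N \<longrightarrow> emeasure \<mu> N = 0) \<and>
     (\<exists>Ks. nest m \<E> D Ks \<and> (\<forall>k. compact (Ks k) \<and> emeasure \<mu> (Ks k) < \<infinity>))"

text \<open>A signed measure is represented as a pair (mu_plus, mu_minus) of finite Borel
  measures, meaning mu = mu_plus - mu_minus.\<close>
type_synonym 'a smeasure = "'a measure \<times> 'a measure"

definition M0b :: "'a::topological_space measure \<Rightarrow> (('a\<Rightarrow>real) \<Rightarrow> ('a\<Rightarrow>real) \<Rightarrow> real) \<Rightarrow> ('a\<Rightarrow>real) set \<Rightarrow> 'a smeasure \<Rightarrow> bool" where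
  "M0b m \<E> D \<mu> \<longleftrightarrow> smooth m \<E> D (fst \<mu>) \<and> smooth m \<E> D (snd \<mu>) \<and>
     finite_measure (fst \<mu>) \<and> finite_measure (snd \<mu>)"

definition sval :: "'a smeasure \<Rightarrow> 'a set \<Rightarrow> real" where
  "sval \<mu> B = measure (fst \<mu>) B - measure (snd \<mu>) B"

definition sint :: "'a smeasure \<Rightarrow> ('a \<Rightarrow> real) \<Rightarrow> real" where
  "sint \<mu> f = (\<integral>x. f x \<partial>fst \<mu>) - (\<integral>x. f x \<partial>snd \<mu>)"

definition tv_norm :: "'a::topological_space smeasure \<Rightarrow> real" where
  "tv_norm \<mu> = (SUP B\<in>sets borel. \<bar>sval \<mu> B\<bar> + \<bar>sval \<mu> (UNIV - B)\<bar>)"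

definition sle :: "'a::topological_space smeasure \<Rightarrow> 'a smeasure \<Rightarrow> bool" where
  "sle \<mu> \<nu> \<longleftrightarrow> (\<forall>B\<in>sets borel. sval \<mu> B \<le> sval \<nu> B)"

definition approx_seq :: "'a measure \<Rightarrow> (('a\<Rightarrow>real) \<Rightarrow> ('a\<Rightarrow>real) \<Rightarrow> real) \<Rightarrow> ('a\<Rightarrow>real) set \<Rightarrow> ('a\<Rightarrow>real) \<Rightarrow> (nat \<Rightarrow> 'a \<Rightarrow> real) \<Rightarrow> bool" where
  "approx_seq m \<E> D u un \<longleftrightarrow> (\<forall>n. un n \<in> D) \<and>
     (\<forall>\<epsilon>>0. \<exists>N. \<forall>n\<ge>N. \<forall>k\<ge>N. \<E> (\<lambda>x. un n x - un k x) (\<lambda>x. un n x - un k x) < \<epsilon>) \<and>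
     (AE x in m. (\<lambda>n. un n x) \<longlonglongrightarrow> u x)"

definition ext_space :: "'a measure \<Rightarrow> (('a\<Rightarrow>real) \<Rightarrow> ('a\<Rightarrow>real) \<Rightarrow> real) \<Rightarrow> ('a\<Rightarrow>real) set \<Rightarrow> ('a\<Rightarrow>real) set" where
  "ext_space m \<E> D = {u. \<exists>un. approx_seq m \<E> D u un}"

definition ext_form :: "'a measure \<Rightarrow> (('a\<Rightarrow>real) \<Rightarrow> ('a\<Rightarrow>real) \<Rightarrow> real) \<Rightarrow> ('a\<Rightarrow>real) set \<Rightarrow> ('a\<Rightarrow>real) \<Rightarrow> ('a\<Rightarrow>real) \<Rightarrow> real" where
  "ext_form m \<E> D u v =
     lim (\<lambda>n. \<E> ((SOME un. approx_seq m \<E> D u un) n) ((SOME vn. approx_seq m \<E> D v vn) n))"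

definition Tk :: "real \<Rightarrow> real \<Rightarrow> real" where
  "Tk k y = min (max (- k) y) k"

text \<open>Renormalized solution of -Lu = f(.,u) + mu.  The quasi-continuous version of v is
  taken Borel measurable (such a version always exists and any two agree q.e.).\<close>
definition renorm_sol :: "'a::topological_space measure \<Rightarrow> (('a\<Rightarrow>real) \<Rightarrow> ('a\<Rightarrow>real) \<Rightarrow> real) \<Rightarrow> ('a\<Rightarrow>real) set
     \<Rightarrow> ('a \<Rightarrow> real \<Rightarrow> real) \<Rightarrow> 'a smeasure \<Rightarrow> ('a \<Rightarrow> real) \<Rightarrow> bool" where
  "renorm_sol m \<E> D f \<mu> u \<longleftrightarrow>
     quasi_continuous m \<E> D u \<and> integrable (completion m) (\<lambda>x. f x (u x)) \<and>
     (\<forall>k::real. k > 0 \<longrightarrow> (\<lambda>x. Tk k (u x)) \<in> ext_space m \<E> D) \<and>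
     (\<exists>\<nu>::nat \<Rightarrow> 'a smeasure. (\<forall>k. M0b m \<E> D (\<nu> k)) \<and> (\<lambda>k. tv_norm (\<nu> k)) \<longlonglongrightarrow> 0 \<and>
        (\<forall>k::nat. k \<ge> 1 \<longrightarrow> (\<forall>v\<in>ext_space m \<E> D. (\<exists>C. AE x in m. \<bar>v x\<bar> \<le> C) \<longrightarrow>
           (\<forall>vt. vt \<in> borel_measurable borel \<and> quasi_continuous m \<E> D vt \<and> (AE x in m. vt x = v x) \<longrightarrow>
              ext_form m \<E> D (\<lambda>x. Tk (real k) (u x)) v =
                (\<integral>x. vt x * f x (u x) \<partial>completion m) + sint \<mu> vt + sint (\<nu> k) vt))))"

end

theory Submission
  imports Defs
begin

text \<open>Test the two equations with \<open>v\<^sub>k = ((T\<^sub>k u\<^sub>1 - T\<^sub>k u\<^sub>2)\<^sup>+) \<and> 1\<close>. Where \<open>v\<^sub>k > 0\<close> one has \<open>u\<^sub>1 > u\<^sub>2\<close>, so the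
  monotonicity of \<open>f\<^sup>1\<close> or \<open>f\<^sup>2\<close> makes the difference of the nonlinear terms nonpositive, and
  \<open>\<mu>\<^sub>1 \<le> \<mu>\<^sub>2\<close> does the same for the measures. The dual sub-Markov property then yields
  \<open>\<E>(v\<^sub>k, v\<^sub>k) \<le> \<E>(T\<^sub>k u\<^sub>1 - T\<^sub>k u\<^sub>2, v\<^sub>k) \<le> \<parallel>\<nu>\<^sub>k\<^sup>1\<parallel> + \<parallel>\<nu>\<^sub>k\<^sup>2\<parallel> \<longlonglongrightarrow> 0\<close>. By transience there is \<open>g > 0\<close> with
  \<open>\<integral> g v \<le> C \<E>(v, v)\<^sup>1\<^sup>/\<^sup>2\<close>, hence \<open>(u\<^sub>1 - u\<^sub>2)\<^sup>+ \<and> 1 = 0\<close> almost everywhere, and quasi-continuity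
  upgrades this to quasi-everywhere.

  The extended form is well defined because the form is closable for almost everywhere convergence.
  For uniformly bounded sequences \<open>v\<^sub>n\<close> that vanish almost everywhere and are bounded with respect to the form,
  \<open>\<E>(G\<^sub>\<alpha> f, v\<^sub>n) = \<integral> (f - \<alpha> G\<^sub>\<alpha> f) v\<^sub>n \<longlonglongrightarrow> 0\<close> for \<open>f \<in> L\<^sup>1 \<inter> L\<^sup>2\<close>, and such resolvents are dense;
  the general case follows by truncation.\<close>

section \<open>Nonnegative bilinear forms on spaces of functions\<close>

text \<open>The cut at height 1 is what makes the test functions work:
  \<open>T\<^sub>k u\<^sub>1 - T\<^sub>k u\<^sub>2\<close> may be as large as 2k, and k times the
  norm of \<open>\<nu>\<^sub>k\<close> need not vanish, whereas a test function with values in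
  [0, 1] costs at most the total variation. Two obstacles shape the rest. Elements of the extended
  space are reached by sequences that are Cauchy for the form but without control in L2, so
  closedness with respect to \<open>E1\<close> does not apply to them; the strong sector condition
  lets the estimates run in the seminorm of the form alone. Moreover the form is not symmetric and
  functions are not identified almost everywhere, so weak compactness in a Hilbert space is replaced
  by \<open>midhull\<close>: midpoints are the only convex combinations that the parallelogram
  identity asks for, and bounds, pointwise limits and closure properties pass to them by induction.
  The inequality for \<open>\<E>(v\<^sub>k, v\<^sub>k)\<close> is never formed in the extended
  space: it is applied to approximants in \<open>D\<close>, and only its right-hand side is
  identified in the limit.\<close>

inductive_set midhull :: "('a \<Rightarrow> real) set \<Rightarrow> ('a \<Rightarrow> real) set" for A where
  base: "u \<in> A \<Longrightarrow> u \<in> midhull A"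
| mid: "u \<in> midhull A \<Longrightarrow> v \<in> midhull A \<Longrightarrow> (\<lambda>x. (u x + v x) / 2) \<in> midhull A"

lemma midhull_mono: "u \<in> midhull A \<Longrightarrow> A \<subseteq> A' \<Longrightarrow> u \<in> midhull A'"
  by (induction rule: midhull.induct) (auto intro: midhull.intros)

lemma midhull_dist:
  assumes "u \<in> midhull A" "\<And>v. v \<in> A \<Longrightarrow> \<bar>v x - l\<bar> \<le> e"
  shows "\<bar>u x - l\<bar> \<le> (e :: real)"
  using assms(1)
proof (induction rule: midhull.induct)
  case (mid u v)
  show ?case by (rule abs_leI) (use mid.IH in \<open>auto simp: abs_le_iff field_simps\<close>)
qed (rule assms(2))

text \<open>The n-th combination uses only indices from n on, so it stays in every ball around l
  that traps the tail of \<open>y\<close>.\<close>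

lemma midhull_tendsto:
  assumes "\<And>n. c n \<in> midhull (y ` {n..})" "(\<lambda>n. y n x) \<longlonglongrightarrow> l"
  shows "(\<lambda>n. c n x) \<longlonglongrightarrow> l"
proof (rule LIMSEQ_I)
  fix r :: real assume "r > 0"
  then obtain n0 where n0: "\<And>n. n \<ge> n0 \<Longrightarrow> \<bar>y n x - l\<bar> < r / 2"
    using LIMSEQ_D[OF assms(2), of "r/2"] by auto
  have "\<bar>c n x - l\<bar> \<le> r / 2" if "n \<ge> n0" for n
  proof (rule midhull_dist[OF assms(1)])
    fix v assume "v \<in> y ` {n..}"
    then obtain k where "v = y k" "k \<ge> n" by auto
    then show "\<bar>v x - l\<bar> \<le> r / 2" using n0[of k] that by simp
  qed
  then have "norm (c n x - l) < r" if "n \<ge> n0" for n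
    using \<open>r > 0\<close> that by fastforce
  then show "\<exists>n0. \<forall>n\<ge>n0. norm (c n x - l) < r" by blast
qed

text \<open>Instantiated by the L2 product, by \<open>\<E>\<close> and by \<open>E1\<close>, and
  again by the coercive form behind the resolvent. \<open>\<E>\<close> need be neither symmetric nor
  definite, so \<open>N\<close> is only a seminorm.\<close>

locale bform =
  fixes D :: "('a \<Rightarrow> real) set" and B :: "('a \<Rightarrow> real) \<Rightarrow> ('a \<Rightarrow> real) \<Rightarrow> real"
  assumes zero_mem: "(\<lambda>x. 0) \<in> D"
    and comb_mem: "u \<in> D \<Longrightarrow> v \<in> D \<Longrightarrow> (\<lambda>x. a * u x + b * v x) \<in> D"
    and comb_left: "u \<in> D \<Longrightarrow> w \<in> D \<Longrightarrow> v \<in> D \<Longrightarrow> B (\<lambda>x. a * u x + b * w x) v = a * B u v + b * B w v"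
    and comb_right: "u \<in> D \<Longrightarrow> w \<in> D \<Longrightarrow> v \<in> D \<Longrightarrow> B v (\<lambda>x. a * u x + b * w x) = a * B v u + b * B v w"
    and nonneg: "u \<in> D \<Longrightarrow> 0 \<le> B u u"
begin

definition N :: "('a \<Rightarrow> real) \<Rightarrow> real" where "N u = sqrt (B u u)"

lemma add_mem: "u \<in> D \<Longrightarrow> v \<in> D \<Longrightarrow> (\<lambda>x. u x + v x) \<in> D"
  using comb_mem[of u v 1 1] by simp

lemma diff_mem: "u \<in> D \<Longrightarrow> v \<in> D \<Longrightarrow> (\<lambda>x. u x - v x) \<in> D"
  using comb_mem[of u v 1 "-1"] by simp

lemma scale_mem: "u \<in> D \<Longrightarrow> (\<lambda>x. a * u x) \<in> D"
  using comb_mem[of u u a 0] by simp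

lemma uminus_mem: "u \<in> D \<Longrightarrow> (\<lambda>x. - u x) \<in> D"
  using scale_mem[of u "-1"] by simp

lemma mid_mem: "u \<in> D \<Longrightarrow> v \<in> D \<Longrightarrow> (\<lambda>x. (u x + v x) / 2) \<in> D"
  using comb_mem[of u v "1/2" "1/2"] by (simp add: field_simps)

lemmas mem = zero_mem add_mem diff_mem scale_mem uminus_mem mid_mem

lemma midhull_mem: "c \<in> midhull A \<Longrightarrow> A \<subseteq> D \<Longrightarrow> c \<in> D"
  by (induction rule: midhull.induct) (auto intro: mid_mem)

lemma add_left: "u \<in> D \<Longrightarrow> w \<in> D \<Longrightarrow> v \<in> D \<Longrightarrow> B (\<lambda>x. u x + w x) v = B u v + B w v"
  using comb_left[of u w v 1 1] by simp

lemma add_right: "u \<in> D \<Longrightarrow> w \<in> D \<Longrightarrow> v \<in> D \<Longrightarrow> B v (\<lambda>x. u x + w x) = B v u + B v w"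
  using comb_right[of u w v 1 1] by simp

lemma diff_left: "u \<in> D \<Longrightarrow> w \<in> D \<Longrightarrow> v \<in> D \<Longrightarrow> B (\<lambda>x. u x - w x) v = B u v - B w v"
  using comb_left[of u w v 1 "-1"] by simp

lemma diff_right: "u \<in> D \<Longrightarrow> w \<in> D \<Longrightarrow> v \<in> D \<Longrightarrow> B v (\<lambda>x. u x - w x) = B v u - B v w"
  using comb_right[of u w v 1 "-1"] by simp

lemma scale_left: "u \<in> D \<Longrightarrow> v \<in> D \<Longrightarrow> B (\<lambda>x. a * u x) v = a * B u v"
  using comb_left[of u u v a 0] by simp

lemma scale_right: "u \<in> D \<Longrightarrow> v \<in> D \<Longrightarrow> B v (\<lambda>x. a * u x) = a * B v u"
  using comb_right[of u u v a 0] by simp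

lemma mid_left: "u \<in> D \<Longrightarrow> w \<in> D \<Longrightarrow> v \<in> D \<Longrightarrow> B (\<lambda>x. (u x + w x) / 2) v = (B u v + B w v) / 2"
  using comb_left[of u w v "1/2" "1/2"] by (simp add: field_simps)

lemma mid_right: "u \<in> D \<Longrightarrow> w \<in> D \<Longrightarrow> v \<in> D \<Longrightarrow> B v (\<lambda>x. (u x + w x) / 2) = (B v u + B v w) / 2"
  using comb_right[of u w v "1/2" "1/2"] by (simp add: field_simps)

lemmas lin = add_left add_right diff_left diff_right scale_left scale_right mid_left mid_right

lemma zero_right: "v \<in> D \<Longrightarrow> B v (\<lambda>x. 0) = 0"
  using scale_right[of v v 0] by simp

lemma N_nonneg: "0 \<le> N u" if "u \<in> D"
  using nonneg that by (simp add: N_def)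

lemma N_sq: "u \<in> D \<Longrightarrow> (N u)\<^sup>2 = B u u"
  by (simp add: N_def nonneg)

lemma N_le: "u \<in> D \<Longrightarrow> B u u \<le> c\<^sup>2 \<Longrightarrow> 0 \<le> c \<Longrightarrow> N u \<le> c"
  by (simp add: N_def real_le_lsqrt nonneg)

lemma N_scale: "u \<in> D \<Longrightarrow> N (\<lambda>x. a * u x) = \<bar>a\<bar> * N u"
  by (simp add: N_def lin mem real_sqrt_mult flip: mult.assoc)

lemma N_minus_commute: "u \<in> D \<Longrightarrow> v \<in> D \<Longrightarrow> N (\<lambda>x. u x - v x) = N (\<lambda>x. v x - u x)"
  by (simp add: N_def lin mem)

lemma parallelogram:
  "u \<in> D \<Longrightarrow> v \<in> D \<Longrightarrow> B (\<lambda>x. u x - v x) (\<lambda>x. u x - v x)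
     = 2 * B u u + 2 * B v v - 4 * B (\<lambda>x. (u x + v x) / 2) (\<lambda>x. (u x + v x) / 2)"
  by (simp add: lin mem field_simps)

text \<open>The discriminant of the nonnegative quadratic obtained from \<open>u + t v\<close>. It
  sees only the symmetric part of \<open>B\<close>, hence the sum \<open>B u v + B v u\<close>;
  bounding a single \<open>B u v\<close> takes a sector condition.\<close>

lemma Cauchy_Schwarz:
  assumes "u \<in> D" "v \<in> D"
  shows "\<bar>B u v + B v u\<bar> \<le> 2 * N u * N v"
proof -
  have *: "0 \<le> B u u + t * (B u v + B v u) + t\<^sup>2 * B v v" for t
    using nonneg[of "\<lambda>x. u x + t * v x"] assms
    by (simp add: lin mem algebra_simps power2_eq_square)
  let ?b = "B u v + B v u"
  have "?b\<^sup>2 \<le> 4 * B u u * B v v"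
  proof (cases "B v v = 0")
    case True
    \<comment> \<open>With \<open>B v v = 0\<close> the quadratic is affine in t, and a nonzero
      slope would let it take the value -1.\<close>
    have "?b = 0"
    proof (rule ccontr)
      assume "?b \<noteq> 0"
      then have "(- (B u u + 1) / ?b) * ?b = - (B u u + 1)" by (rule nonzero_eq_divide_eq[THEN iffD1, OF _ refl])
      then show False using *[of "- (B u u + 1) / ?b"] True by simp
    qed
    then show ?thesis using True by simp
  next
    case False
    then have "B v v > 0" using nonneg[OF assms(2)] by simp
    then have "B u u + (- ?b / (2 * B v v)) * ?b + (- ?b / (2 * B v v))\<^sup>2 * B v v = B u u - ?b\<^sup>2 / (4 * B v v)"
      by (simp add: power2_eq_square divide_simps) (simp add: algebra_simps)
    with *[of "- ?b / (2 * B v v)"] have "?b\<^sup>2 / (4 * B v v) \<le> B u u" by linarith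
    then show ?thesis using \<open>B v v > 0\<close> by (simp add: pos_divide_le_eq mult.commute mult.left_commute)
  qed
  also have "\<dots> = (2 * N u * N v)\<^sup>2"
    using assms by (simp add: power_mult_distrib N_sq)
  finally show ?thesis
    using N_nonneg assms by (simp add: abs_le_square_iff[symmetric] abs_mult)
qed

lemma N_triangle: "u \<in> D \<Longrightarrow> v \<in> D \<Longrightarrow> N (\<lambda>x. u x + v x) \<le> N u + N v"
  apply (rule N_le)
  using Cauchy_Schwarz[of u v] N_sq[of u] N_sq[of v] N_nonneg
  by (auto simp: lin mem power2_sum abs_le_iff)

lemma N_triangle_diff: "u \<in> D \<Longrightarrow> v \<in> D \<Longrightarrow> N (\<lambda>x. u x - v x) \<le> N u + N v"
  using N_triangle[of u "\<lambda>x. (-1) * v x"] N_scale[of v "-1"] by (simp add: mem)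

lemma N_triangle_sub:
  assumes "u \<in> D" "v \<in> D"
  shows "N u \<le> N (\<lambda>x. u x - v x) + N v"
  using N_triangle[of "\<lambda>x. u x - v x" v] assms by (simp add: mem)

lemma N_triangle_3: "u \<in> D \<Longrightarrow> v \<in> D \<Longrightarrow> w \<in> D \<Longrightarrow>
    N (\<lambda>x. u x - w x) \<le> N (\<lambda>x. u x - v x) + N (\<lambda>x. v x - w x)"
  using N_triangle[of "\<lambda>x. u x - v x" "\<lambda>x. v x - w x"] by (simp add: mem)

lemma midhull_N_le:
  assumes "c \<in> midhull A" "A \<subseteq> D" "\<And>u. u \<in> A \<Longrightarrow> N u \<le> M"
  shows "N c \<le> M"
  using assms
proof (induction rule: midhull.induct)
  case (mid u v)
  then have "u \<in> D" "v \<in> D" "N u \<le> M" "N v \<le> M" by (auto intro: midhull_mem)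
  then show ?case
    using N_triangle[of u v] N_scale[of "\<lambda>x. u x + v x" "1/2"] by (simp add: mem)
qed auto

lemma midhull_N_dist:
  assumes "c \<in> midhull A" "A \<subseteq> D" "w \<in> D" "\<And>u. u \<in> A \<Longrightarrow> N (\<lambda>x. u x - w x) \<le> M"
  shows "N (\<lambda>x. c x - w x) \<le> M"
  using assms
proof (induction rule: midhull.induct)
  case (mid u v)
  then have uv: "u \<in> D" "v \<in> D" "N (\<lambda>x. u x - w x) \<le> M" "N (\<lambda>x. v x - w x) \<le> M"
    by (auto intro: midhull_mem)
  have "(\<lambda>x. (u x + v x) / 2 - w x) = (\<lambda>x. 1/2 * ((u x - w x) + (v x - w x)))"
    by (auto simp: field_simps)
  then show ?case
    using N_triangle[of "\<lambda>x. u x - w x" "\<lambda>x. v x - w x"] uv \<open>w \<in> D\<close>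
      N_scale[of "\<lambda>x. u x - w x + (v x - w x)" "1/2"] by (simp add: mem)
qed auto

text \<open>Phrased with \<open>B\<close> instead of \<open>N\<close> so that it coincides literally
  with the Cauchy conditions in \<open>dirichlet_form\<close> and \<open>approx_seq\<close>.\<close>

definition Cauchy_in :: "(nat \<Rightarrow> 'a \<Rightarrow> real) \<Rightarrow> bool" where
  "Cauchy_in y \<longleftrightarrow> (\<forall>e>0. \<exists>n0. \<forall>n\<ge>n0. \<forall>k\<ge>n0.
     B (\<lambda>x. y n x - y k x) (\<lambda>x. y n x - y k x) < e)"

lemma Cauchy_in_N:
  assumes "Cauchy_in y" "e > 0" shows "\<exists>n0. \<forall>n\<ge>n0. \<forall>k\<ge>n0. N (\<lambda>x. y n x - y k x) < e"
proof -
  have "e\<^sup>2 > 0" using assms by simp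
  then obtain n0 where "\<And>n k. n \<ge> n0 \<Longrightarrow> k \<ge> n0 \<Longrightarrow> B (\<lambda>x. y n x - y k x) (\<lambda>x. y n x - y k x) < e\<^sup>2"
    using assms(1) unfolding Cauchy_in_def by meson
  then show ?thesis using assms(2)
    by (intro exI[of _ n0]) (auto simp: N_def intro!: real_less_lsqrt)
qed

lemma Cauchy_inI:
  assumes "\<And>n. y n \<in> D" "\<And>e. e > 0 \<Longrightarrow> \<exists>n0. \<forall>n\<ge>n0. \<forall>k\<ge>n. N (\<lambda>x. y n x - y k x) < e"
  shows "Cauchy_in y"
  unfolding Cauchy_in_def
proof (intro allI impI)
  fix e :: real assume "e > 0"
  then obtain n0 where n0: "\<And>n k. n \<ge> n0 \<Longrightarrow> k \<ge> n \<Longrightarrow> N (\<lambda>x. y n x - y k x) < sqrt e"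
    using assms(2)[of "sqrt e"] by auto
  show "\<exists>n0. \<forall>n\<ge>n0. \<forall>k\<ge>n0. B (\<lambda>x. y n x - y k x) (\<lambda>x. y n x - y k x) < e"
  proof (intro exI[of _ n0] allI impI)
    fix n k assume "n \<ge> n0" "k \<ge> n0"
    then have "N (\<lambda>x. y n x - y k x) < sqrt e"
      using n0[of n k] n0[of k n] N_minus_commute[OF assms(1) assms(1), of n k] by (cases "n \<le> k") auto
    then show "B (\<lambda>x. y n x - y k x) (\<lambda>x. y n x - y k x) < e" by (simp add: N_def)
  qed
qed

lemma Cauchy_in_bounded:
  assumes "\<And>n. y n \<in> D" "Cauchy_in y" shows "\<exists>M\<ge>0. \<forall>n. N (y n) \<le> M"
proof -
  obtain n0 where n0: "\<And>n. n \<ge> n0 \<Longrightarrow> N (\<lambda>x. y n x - y n0 x) < 1"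
    using Cauchy_in_N[OF assms(2), of 1] by auto
  define M where "M = Max ((\<lambda>n. N (y n)) ` {..n0}) + 1"
  have le: "N (y n) \<le> M - 1" if "n \<le> n0" for n using that by (simp add: M_def)
  have "N (y n) \<le> M" for n
  proof (cases "n \<le> n0")
    case False
    then show ?thesis using N_triangle_sub[of "y n" "y n0"] assms(1) n0[of n] le[of n0] by force
  qed (use le in force)
  moreover have "M \<ge> 0" using le[of 0] N_nonneg[OF assms(1), of 0] by simp
  ultimately show ?thesis by auto
qed

lemma Cauchy_in_diff:
  assumes "\<And>n. a n \<in> D" "\<And>n. b n \<in> D" "Cauchy_in a" "Cauchy_in b"
  shows "Cauchy_in (\<lambda>n x. a n x - b n x)"
proof (rule Cauchy_inI)
  show "(\<lambda>x. a n x - b n x) \<in> D" for n by (intro diff_mem assms)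
  fix e :: real assume "e > 0"
  then have e2: "e / 2 > 0" by simp
  obtain n1 where n1: "\<And>n k. n \<ge> n1 \<Longrightarrow> k \<ge> n1 \<Longrightarrow> N (\<lambda>x. a n x - a k x) < e / 2"
    using Cauchy_in_N[OF assms(3) e2] by blast
  obtain n2 where n2: "\<And>n k. n \<ge> n2 \<Longrightarrow> k \<ge> n2 \<Longrightarrow> N (\<lambda>x. b n x - b k x) < e / 2"
    using Cauchy_in_N[OF assms(4) e2] by blast
  show "\<exists>n0. \<forall>n\<ge>n0. \<forall>k\<ge>n. N (\<lambda>x. a n x - b n x - (a k x - b k x)) < e"
  proof (intro exI[of _ "max n1 n2"] allI impI)
    fix n k assume nk: "n \<ge> max n1 n2" "k \<ge> n"
    have "(\<lambda>x. a n x - b n x - (a k x - b k x)) = (\<lambda>x. (a n x - a k x) - (b n x - b k x))" by auto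
    then have "N (\<lambda>x. a n x - b n x - (a k x - b k x)) \<le> N (\<lambda>x. a n x - a k x) + N (\<lambda>x. b n x - b k x)"
      using N_triangle_diff[OF diff_mem[OF assms(1) assms(1)] diff_mem[OF assms(2) assms(2)]] by simp
    then show "N (\<lambda>x. a n x - b n x - (a k x - b k x)) < e"
      using n1[of n k] n2[of n k] nk by simp
  qed
qed

text \<open>A weak form of Mazur's lemma that needs no completeness: almost minimal elements of the
  tail hulls form a Cauchy sequence, by the parallelogram identity.\<close>

lemma midhull_Cauchy:
  assumes y: "\<And>n. y n \<in> D" and M: "\<And>n. N (y n) \<le> M"
  shows "\<exists>c. (\<forall>n. c n \<in> midhull (y ` {n..})) \<and> Cauchy_in c"
proof -
  define H where "H n = midhull (y ` {n..})" for n
  define S where "S n = (\<lambda>c. B c c) ` H n" for n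
  define d where "d n = Inf (S n)" for n
  define i where "i n = 1 / (real n + 1)" for n
  have i_mono: "i k \<le> i n" if "n \<le> k" for n k using that by (simp add: i_def frac_le)
  have yH: "y k \<in> H n" if "n \<le> k" for n k using that by (auto simp: H_def intro: midhull.base)
  have HD: "c \<in> D" if "c \<in> H n" for c n
    using midhull_mem[of c "y ` {n..}"] that y by (auto simp: H_def)
  have bdd: "bdd_below (S n)" for n
    by (rule bdd_belowI[of _ 0]) (auto simp: S_def intro!: nonneg HD)
  have ne: "S n \<noteq> {}" for n using yH[of n n] by (auto simp: S_def)
  have dle: "d n \<le> B c c" if "c \<in> H n" for c n
    unfolding d_def using that by (intro cInf_lower bdd) (auto simp: S_def)
  have HM: "H k \<subseteq> H n" if "n \<le> k" for n k
    using that by (auto simp: H_def intro: midhull_mono[of _ "y ` {k..}"])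
  have "S k \<subseteq> S n" if "n \<le> k" for n k using HM[OF that] by (auto simp: S_def)
  then have "incseq d"
    unfolding incseq_def d_def by (intro allI impI cInf_superset_mono ne bdd)
  moreover have "d n \<le> M\<^sup>2" for n
    using dle[OF yH[of n n]] N_sq[OF y] power_mono[OF M N_nonneg[OF y], of n 2] by simp
  ultimately have "convergent d"
    by (metis incseq_convergent convergentI)
  then have "Cauchy d" by (rule convergent_Cauchy)
  have "\<exists>c\<in>H n. B c c < d n + i n" for n
  proof -
    have "\<exists>s\<in>S n. s < d n + i n"
      unfolding d_def by (intro cInf_lessD ne) (simp add: i_def)
    then show ?thesis by (auto simp: S_def)
  qed
  then obtain c where c: "\<And>n. c n \<in> H n" "\<And>n. B (c n) (c n) < d n + i n" by metis
  \<comment> \<open>Both functions and their midpoint lie in \<open>H n\<close>. The midpoint has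
    energy at least \<open>d n\<close>, while near-minimality bounds the other two terms of the
    parallelogram identity.\<close>
  have est: "B (\<lambda>x. c n x - c k x) (\<lambda>x. c n x - c k x) \<le> 2 * d k - 2 * d n + 4 * i n"
    if "n \<le> k" for n k
  proof -
    have "c k \<in> H n" using c HM that by blast
    then have "(\<lambda>x. (c n x + c k x) / 2) \<in> H n" using c unfolding H_def by (intro midhull.mid)
    note dle[OF this]
    moreover have "i k \<le> i n" using that by (rule i_mono)
    ultimately show ?thesis
      using parallelogram[OF HD[OF c(1)] HD[OF c(1)], of n k] c(2)[of n] c(2)[of k]
      by linarith
  qed
  have "Cauchy_in c"
  proof (rule Cauchy_inI)
    show "c n \<in> D" for n using c HD by blast
    fix e :: real assume "e > 0"
    define s where "s = e\<^sup>2 / 8"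
    have e2: "s > 0" "e\<^sup>2 = 8 * s" using \<open>e > 0\<close> by (simp_all add: s_def)
    obtain n1 where n1: "\<And>n k. n \<ge> n1 \<Longrightarrow> k \<ge> n1 \<Longrightarrow> dist (d n) (d k) < s"
      using metric_CauchyD[OF \<open>Cauchy d\<close> e2(1)] by blast
    obtain n2 where n2: "i n2 < s"
      using reals_Archimedean[OF e2(1)] by (auto simp: i_def inverse_eq_divide add.commute)
    show "\<exists>n0. \<forall>n\<ge>n0. \<forall>k\<ge>n. N (\<lambda>x. c n x - c k x) < e"
    proof (intro exI[of _ "max n1 n2"] allI impI)
      fix n k assume nk: "n \<ge> max n1 n2" "k \<ge> n"
      then have "i n \<le> i n2" by (intro i_mono) simp
      moreover have "d k - d n < s"
        using le_less_trans[OF abs_ge_self n1[of k n, unfolded dist_real_def]] nk by linarith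
      ultimately have "B (\<lambda>x. c n x - c k x) (\<lambda>x. c n x - c k x) < e\<^sup>2"
        using est[OF nk(2)] nk n2 e2 by linarith
      then show "N (\<lambda>x. c n x - c k x) < e"
        using \<open>e > 0\<close> by (auto simp: N_def intro!: real_less_lsqrt)
    qed
  qed
  then show ?thesis using c(1) by (auto simp: H_def)
qed

end

section \<open>Riesz representation and the Lax-Milgram theorem\<close>

locale complete_bform = bform +
  assumes complete: "(\<And>n. y n \<in> D) \<Longrightarrow> Cauchy_in y \<Longrightarrow>
    \<exists>u\<in>D. (\<lambda>n. B (\<lambda>x. y n x - u x) (\<lambda>x. y n x - u x)) \<longlonglongrightarrow> 0"
begin

lemma complete_N:
  assumes "\<And>n. y n \<in> D" "Cauchy_in y"
  obtains u where "u \<in> D" "(\<lambda>n. N (\<lambda>x. y n x - u x)) \<longlonglongrightarrow> 0"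
  using complete[OF assms] tendsto_real_sqrt by (fastforce simp: N_def)

text \<open>Minimise \<open>B w w - 2 L w\<close>: near-minimisers are Cauchy by the parallelogram
  identity, and the first variation at the limit vanishes. Only the symmetric part of
  \<open>B\<close> enters the variation, which explains the form of the conclusion.\<close>

lemma Riesz:
  assumes lin_L: "\<And>u v a b. u \<in> D \<Longrightarrow> v \<in> D \<Longrightarrow> L (\<lambda>x. a * u x + b * v x) = a * L u + b * L v"
    and bd: "\<And>v. v \<in> D \<Longrightarrow> \<bar>L v\<bar> \<le> C * N v"
  obtains r where "r \<in> D" "\<And>v. v \<in> D \<Longrightarrow> B r v + B v r = 2 * L v"
proof -
  define J where "J w = B w w - 2 * L w" for w
  have L_add: "L (\<lambda>x. u x + t * v x) = L u + t * L v" if "u \<in> D" "v \<in> D" for u v t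
    using lin_L[OF that, of 1 t] by simp
  have L_diff: "L (\<lambda>x. u x - v x) = L u - L v" if "u \<in> D" "v \<in> D" for u v
    using lin_L[OF that, of 1 "-1"] by simp
  have L_mid: "L (\<lambda>x. (u x + v x) / 2) = (L u + L v) / 2" if "u \<in> D" "v \<in> D" for u v
    using lin_L[OF that, of "1/2" "1/2"] by (simp add: field_simps)
  have lower: "- C\<^sup>2 \<le> J w" if "w \<in> D" for w
  proof -
    have "0 \<le> (N w - C)\<^sup>2" by simp
    then show ?thesis using bd[OF that] N_sq[OF that]
      by (simp add: J_def power2_eq_square algebra_simps)
  qed
  define j where "j = Inf (J ` D)"
  have bdd: "bdd_below (J ` D)" using lower by (auto intro!: bdd_belowI[of _ "-C\<^sup>2"])
  have j_le: "j \<le> J w" if "w \<in> D" for w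
    unfolding j_def using that by (intro cInf_lower bdd) auto
  have "\<exists>w\<in>D. J w < j + 1 / (real n + 1)" for n
    using cInf_lessD[of "J ` D" "j + 1 / (real n + 1)"] zero_mem by (auto simp: j_def)
  then obtain w where w: "\<And>n. w n \<in> D" "\<And>n. J (w n) < j + 1 / (real n + 1)" by metis
  have est: "B (\<lambda>x. w n x - w k x) (\<lambda>x. w n x - w k x) \<le> 4 / (real n + 1)" if "n \<le> k" for n k
  proof -
    have "1 / (real k + 1) \<le> 1 / (real n + 1)" using that by (simp add: frac_le)
    moreover have "j \<le> J (\<lambda>x. (w n x + w k x) / 2)" by (intro j_le mem w)
    moreover have "B (\<lambda>x. w n x - w k x) (\<lambda>x. w n x - w k x)
        = 2 * J (w n) + 2 * J (w k) - 4 * J (\<lambda>x. (w n x + w k x) / 2)"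
      using parallelogram[OF w(1) w(1), of n k] by (simp add: J_def L_mid w field_simps)
    ultimately show ?thesis using w(2)[of n] w(2)[of k] by simp
  qed
  have "Cauchy_in w"
  proof (rule Cauchy_inI[OF w(1)])
    fix e :: real assume "e > 0"
    then obtain n0 where n0: "1 / (real n0 + 1) < e\<^sup>2 / 4"
      using reals_Archimedean[of "e\<^sup>2 / 4"] by (auto simp: inverse_eq_divide add.commute)
    show "\<exists>n0. \<forall>n\<ge>n0. \<forall>k\<ge>n. N (\<lambda>x. w n x - w k x) < e"
    proof (intro exI[of _ n0] allI impI)
      fix n k assume nk: "n \<ge> n0" "k \<ge> n"
      then have "1 / (real n + 1) \<le> 1 / (real n0 + 1)" by (simp add: frac_le)
      then have "B (\<lambda>x. w n x - w k x) (\<lambda>x. w n x - w k x) < e\<^sup>2"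
        using est[OF nk(2)] n0 by simp
      then show "N (\<lambda>x. w n x - w k x) < e"
        using \<open>e > 0\<close> by (auto simp: N_def intro!: real_less_lsqrt)
    qed
  qed
  then obtain r where r: "r \<in> D" "(\<lambda>n. N (\<lambda>x. w n x - r x)) \<longlonglongrightarrow> 0"
    using complete_N w(1) by blast
  have Jr: "J r \<le> J (w n) + N (\<lambda>x. w n x - r x) * (2 * N r + 2 * \<bar>C\<bar>)" for n
  proof -
    let ?h = "\<lambda>x. w n x - r x"
    have h: "?h \<in> D" by (intro mem w r)
    have "B (w n) (w n) = B r r + (B ?h r + B r ?h) + B ?h ?h"
      using w(1)[of n] r(1) by (simp add: lin mem)
    moreover have "L (w n) = L r + L ?h" using L_diff[OF w(1) r(1), of n] by simp
    ultimately have "J (w n) = J r + (B ?h r + B r ?h) + B ?h ?h - 2 * L ?h"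
      by (simp add: J_def)
    moreover have "\<bar>L ?h\<bar> \<le> \<bar>C\<bar> * N ?h"
      using bd[OF h] N_nonneg[OF h] by (smt (verit) mult_right_mono)
    ultimately show ?thesis
      using Cauchy_Schwarz[OF h r(1)] nonneg[OF h] by (simp add: algebra_simps)
  qed
  have "J r \<le> j"
  proof (rule LIMSEQ_le_const)
    have "(\<lambda>n. 1 / (real n + 1)) \<longlonglongrightarrow> 0"
      using LIMSEQ_inverse_real_of_nat by (simp add: inverse_eq_divide add.commute)
    then have "(\<lambda>n. (j + 1 / (real n + 1)) + N (\<lambda>x. w n x - r x) * (2 * N r + 2 * \<bar>C\<bar>))
        \<longlonglongrightarrow> (j + 0) + 0 * (2 * N r + 2 * \<bar>C\<bar>)"
      by (intro tendsto_intros r)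
    then show "(\<lambda>n. (j + 1 / (real n + 1)) + N (\<lambda>x. w n x - r x) * (2 * N r + 2 * \<bar>C\<bar>)) \<longlonglongrightarrow> j"
      by simp
    show "\<exists>n0. \<forall>n\<ge>n0. J r \<le> (j + 1 / (real n + 1)) + N (\<lambda>x. w n x - r x) * (2 * N r + 2 * \<bar>C\<bar>)"
      using Jr w(2) by (intro exI[of _ 0]) (smt (verit))
  qed
  have "B r v + B v r = 2 * L v" if v: "v \<in> D" for v
  proof -
    define b where "b = B r v + B v r - 2 * L v"
    have *: "0 \<le> t * b + t\<^sup>2 * B v v" for t
    proof -
      have "J (\<lambda>x. r x + t * v x) = J r + t * b + t\<^sup>2 * B v v"
        using r(1) v by (simp add: J_def L_add lin mem b_def algebra_simps power2_eq_square)
      moreover have "j \<le> J (\<lambda>x. r x + t * v x)" by (intro j_le mem r v)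
      ultimately show ?thesis using \<open>J r \<le> j\<close> by simp
    qed
    \<comment> \<open>Dividing by \<open>B v v + 1\<close> avoids a case distinction on
      \<open>B v v = 0\<close> and reduces the variation to \<open>- t\<^sup>2\<close>.\<close>
    have p: "B v v + 1 > 0" using nonneg[OF v] by simp
    define t where "t = - b / (B v v + 1)"
    have tp: "t * (B v v + 1) = - b" unfolding t_def using p by simp
    have "t * b + t\<^sup>2 * B v v = t * b + t * (t * (B v v + 1)) - t\<^sup>2"
      by (simp add: algebra_simps power2_eq_square)
    also have "\<dots> = - t\<^sup>2" unfolding tp by simp
    finally have "t = 0" using *[of t] by simp
    then have "b = 0" using tp by simp
    then show ?thesis by (simp add: b_def)
  qed
  then show ?thesis using that r(1) by blast
qed

text \<open>As \<open>A\<close> need not be symmetric, no minimisation is available. The solution is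
  the fixed point of \<open>w + \<rho> r w\<close>, where \<open>r w\<close> represents the residual
  \<open>L - A w\<close> through \<open>Riesz\<close>; for small \<open>\<rho>\<close> coercivity
  makes this map a contraction.\<close>

lemma Lax_Milgram:
  assumes A: "bform D A"
    and A_bd: "\<And>u v. u \<in> D \<Longrightarrow> v \<in> D \<Longrightarrow> \<bar>A u v\<bar> \<le> K * N u * N v"
    and A_coercive: "\<And>u. u \<in> D \<Longrightarrow> \<kappa> * (N u)\<^sup>2 \<le> A u u" and "\<kappa> > 0"
    and lin_L: "\<And>u v a b. u \<in> D \<Longrightarrow> v \<in> D \<Longrightarrow> L (\<lambda>x. a * u x + b * v x) = a * L u + b * L v"
    and L_bd: "\<And>v. v \<in> D \<Longrightarrow> \<bar>L v\<bar> \<le> C * N v"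
  obtains w where "w \<in> D" "\<And>v. v \<in> D \<Longrightarrow> A w v = L v"
proof -
  interpret A: bform D A by fact
  \<comment> \<open>Adding \<open>\<kappa>\<close> ensures \<open>\<kappa> \<le> M\<close>, so that
    \<open>1 - \<kappa>\<^sup>2 / M\<^sup>2\<close> below is nonnegative.\<close>
  define M where "M = \<bar>K\<bar> + \<kappa>"
  have M: "M > 0" "\<kappa> \<le> M" using \<open>\<kappa> > 0\<close> by (auto simp: M_def)
  have A_M: "\<bar>A u v\<bar> \<le> M * N u * N v" if "u \<in> D" "v \<in> D" for u v
  proof -
    have "K * (N u * N v) \<le> M * (N u * N v)"
      using \<open>\<kappa> > 0\<close> N_nonneg that by (intro mult_right_mono) (auto simp: M_def)
    then show ?thesis using A_bd[OF that] by (simp add: mult.assoc)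
  qed
  have "\<exists>r\<in>D. \<forall>v\<in>D. B r v + B v r = 2 * (L v - A w v)" if w: "w \<in> D" for w
  proof (rule Riesz[of "\<lambda>v. L v - A w v" "C + M * N w"])
    show "\<bar>L v - A w v\<bar> \<le> (C + M * N w) * N v" if "v \<in> D" for v
      using L_bd[OF that] A_M[OF w that] by (simp add: algebra_simps)
  qed (use w in \<open>auto simp: lin_L A.comb_right algebra_simps\<close>)
  then obtain r where r: "\<And>w. w \<in> D \<Longrightarrow> r w \<in> D"
    "\<And>w v. w \<in> D \<Longrightarrow> v \<in> D \<Longrightarrow> B (r w) v + B v (r w) = 2 * (L v - A w v)" by metis
  \<comment> \<open>The minimiser of
    \<open>1 - 2 \<rho> \<kappa> + \<rho>\<^sup>2 M\<^sup>2\<close>, which bounds the squared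
    Lipschitz constant of \<open>T\<close>; the minimum is \<open>q\<^sup>2\<close>.\<close>
  define \<rho> where "\<rho> = \<kappa> / M\<^sup>2"
  define q where "q = sqrt (1 - \<kappa>\<^sup>2 / M\<^sup>2)"
  have \<rho>: "\<rho> > 0" using M \<open>\<kappa> > 0\<close> by (simp add: \<rho>_def)
  have kM: "\<kappa>\<^sup>2 / M\<^sup>2 \<le> 1" "\<kappa>\<^sup>2 / M\<^sup>2 > 0" using M \<open>\<kappa> > 0\<close> power_mono[of \<kappa> M 2] by auto
  then have q: "0 \<le> q" "q < 1" "q\<^sup>2 = 1 - \<kappa>\<^sup>2 / M\<^sup>2" by (auto simp: q_def real_less_lsqrt)
  define T where "T w = (\<lambda>x. w x + \<rho> * r w x)" for w
  have T: "T w \<in> D" if "w \<in> D" for w unfolding T_def using that by (intro mem r)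
  have contr: "N (\<lambda>x. T u x - T w x) \<le> q * N (\<lambda>x. u x - w x)" if u: "u \<in> D" and w: "w \<in> D" for u w
  proof -
    let ?d = "\<lambda>x. u x - w x" and ?e = "\<lambda>x. r u x - r w x"
    have d: "?d \<in> D" and e: "?e \<in> D" using r u w by (auto intro: mem)
    \<comment> \<open>The representers of two residuals differ by that of \<open>- A ?d\<close>.
      Taking \<open>v = ?e\<close> bounds \<open>?e\<close> by \<open>?d\<close>; taking
      \<open>v = ?d\<close> brings in coercivity.\<close>
    have key: "B ?e v + B v ?e = - 2 * A ?d v" if "v \<in> D" for v
      using r(2)[OF u that] r(2)[OF w that] r(1) u w that by (simp add: lin mem A.lin)
    have "2 * (N ?e)\<^sup>2 \<le> 2 * (M * N ?d * N ?e)"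
      using key[OF e] A_M[OF d e] N_sq[OF e] by simp
    then have "N ?e \<le> M * N ?d"
      using N_nonneg[OF e] N_nonneg[OF d] M by (cases "N ?e = 0") (auto simp: power2_eq_square)
    then have e2: "(N ?e)\<^sup>2 \<le> M\<^sup>2 * (N ?d)\<^sup>2"
      using power_mono[of "N ?e" "M * N ?d" 2] N_nonneg[OF e] by (simp add: power_mult_distrib)
    have eq: "(\<lambda>x. T u x - T w x) = (\<lambda>x. ?d x + \<rho> * ?e x)" by (auto simp: T_def algebra_simps)
    have "B (\<lambda>x. ?d x + \<rho> * ?e x) (\<lambda>x. ?d x + \<rho> * ?e x)
        = B ?d ?d + \<rho> * (B ?e ?d + B ?d ?e) + \<rho>\<^sup>2 * B ?e ?e"
      using comb_left[OF d e comb_mem[OF d e], of 1 \<rho> 1 \<rho>] comb_right[OF d e d, of 1 \<rho>]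
        comb_right[OF d e e, of 1 \<rho>] by (simp add: algebra_simps power2_eq_square)
    also have "\<dots> = (N ?d)\<^sup>2 - 2 * \<rho> * A ?d ?d + \<rho>\<^sup>2 * (N ?e)\<^sup>2"
      using key[OF d] N_sq[OF e] N_sq[OF d] by simp
    also have "\<dots> \<le> (N ?d)\<^sup>2 - 2 * \<rho> * (\<kappa> * (N ?d)\<^sup>2) + \<rho>\<^sup>2 * (M\<^sup>2 * (N ?d)\<^sup>2)"
      using A_coercive[OF d] e2 \<rho> by (intro add_mono diff_mono mult_left_mono) auto
    also have "\<dots> = (q * N ?d)\<^sup>2"
    proof -
      have *: "\<rho>\<^sup>2 * M\<^sup>2 = \<kappa>\<^sup>2 / M\<^sup>2" "\<rho> * \<kappa> = \<kappa>\<^sup>2 / M\<^sup>2"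
        using M by (simp_all add: \<rho>_def power2_eq_square)
      have "(N ?d)\<^sup>2 - 2 * \<rho> * (\<kappa> * (N ?d)\<^sup>2) + \<rho>\<^sup>2 * (M\<^sup>2 * (N ?d)\<^sup>2)
          = (1 - 2 * (\<rho> * \<kappa>) + \<rho>\<^sup>2 * M\<^sup>2) * (N ?d)\<^sup>2" by (simp add: algebra_simps)
      then show ?thesis unfolding * by (simp add: q(3) power_mult_distrib)
    qed
    finally have "B (\<lambda>x. ?d x + \<rho> * ?e x) (\<lambda>x. ?d x + \<rho> * ?e x) \<le> (q * N ?d)\<^sup>2" .
    then show ?thesis unfolding eq
      using q(1) N_nonneg[OF d] comb_mem[OF d e, of 1 \<rho>] by (intro N_le) auto
  qed
  define w where "w n = (T ^^ n) (\<lambda>x. 0)" for n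
  have w: "w n \<in> D" for n by (induction n) (auto simp: w_def zero_mem T)
  have wS: "w (Suc n) = T (w n)" for n by (simp add: w_def)
  define c where "c = N (\<lambda>x. w 1 x - w 0 x)"
  have step: "N (\<lambda>x. w (Suc n) x - w n x) \<le> q ^ n * c" for n
  proof (induction n)
    case (Suc n)
    have "N (\<lambda>x. w (Suc (Suc n)) x - w (Suc n) x) \<le> q * N (\<lambda>x. w (Suc n) x - w n x)"
      unfolding wS[of "Suc n"] wS[of n] by (rule contr) (simp_all add: w T)
    also have "\<dots> \<le> q * (q ^ n * c)" using Suc q by (intro mult_left_mono) auto
    finally show ?case by (simp add: mult.assoc)
  qed (simp add: c_def)
  have c0: "c \<ge> 0" unfolding c_def by (intro N_nonneg mem w)
  have sums: "N (\<lambda>x. w n x - w (n + k) x) \<le> q ^ n * c * (1 - q ^ k) / (1 - q)" for n k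
  proof (induction k)
    case 0
    then show ?case by (simp add: N_def zero_right zero_mem)
  next
    case (Suc k)
    have "N (\<lambda>x. w n x - w (n + Suc k) x) \<le> N (\<lambda>x. w n x - w (n + k) x) + N (\<lambda>x. w (n + k) x - w (n + Suc k) x)"
      by (intro N_triangle_3 w)
    also have "N (\<lambda>x. w (n + k) x - w (n + Suc k) x) \<le> q ^ (n + k) * c"
      using step[of "n + k"] N_minus_commute[OF w w, of "Suc (n + k)" "n + k"] by simp
    also have "N (\<lambda>x. w n x - w (n + k) x) + q ^ (n + k) * c
        \<le> q ^ n * c * (1 - q ^ k) / (1 - q) + q ^ (n + k) * c" using Suc by simp
    also have "\<dots> = q ^ n * c * (1 - q ^ Suc k) / (1 - q)"
      using q by (simp add: field_simps power_add)
    finally show ?case by simp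
  qed
  have qn: "(\<lambda>n. q ^ n * c) \<longlonglongrightarrow> 0"
    using tendsto_mult_left_zero[OF LIMSEQ_power_zero[of q], of c] q by simp
  have "Cauchy_in w"
  proof (rule Cauchy_inI[OF w])
    fix e :: real assume e: "e > 0"
    have "(\<lambda>n. q ^ n * c / (1 - q)) \<longlonglongrightarrow> 0" using tendsto_divide[OF qn tendsto_const, of "1 - q"] q by simp
    then have "\<forall>\<^sub>F n in sequentially. q ^ n * c / (1 - q) < e"
      using e by (rule order_tendstoD)
    then obtain n0 where n0: "\<And>n. n \<ge> n0 \<Longrightarrow> q ^ n * c / (1 - q) < e"
      unfolding eventually_sequentially by blast
    show "\<exists>n0. \<forall>n\<ge>n0. \<forall>k\<ge>n. N (\<lambda>x. w n x - w k x) < e"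
    proof (intro exI[of _ n0] allI impI)
      fix n k assume nk: "n \<ge> n0" "k \<ge> n"
      have "q ^ n * c * (1 - q ^ (k - n)) / (1 - q) \<le> q ^ n * c * 1 / (1 - q)"
        using q c0 by (intro divide_right_mono mult_left_mono) auto
      then show "N (\<lambda>x. w n x - w k x) < e"
        using sums[of n "k - n"] n0[OF nk(1)] nk(2) by simp
    qed
  qed
  then obtain z where z: "z \<in> D" "(\<lambda>n. N (\<lambda>x. w n x - z x)) \<longlonglongrightarrow> 0"
    using complete_N w by blast
  have "A z v = L v" if v: "v \<in> D" for v
  proof -
    have est: "\<bar>L v - A z v\<bar> \<le> M * N (\<lambda>x. w n x - z x) * N v + q ^ n * c * N v / \<rho>" for n
    proof -
      \<comment> \<open>The representer of the residual is the step of the iteration divided by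
        \<open>\<rho>\<close>, so the geometric decay of the steps forces the residual at the limit
        to vanish.\<close>
      have r': "N (r (w n)) = N (\<lambda>x. w (Suc n) x - w n x) / \<rho>"
        unfolding wS T_def using \<rho> N_scale[OF r(1)[OF w], of \<rho> n] by simp
      have "\<bar>L v - A (w n) v\<bar> \<le> N (r (w n)) * N v"
        using r(2)[OF w v, of n] Cauchy_Schwarz[OF r(1)[OF w] v, of n] by simp
      also have "\<dots> \<le> (q ^ n * c / \<rho>) * N v"
        unfolding r' using step[of n] \<rho> N_nonneg[OF v] by (intro mult_right_mono divide_right_mono) auto
      finally have "\<bar>L v - A (w n) v\<bar> \<le> q ^ n * c * N v / \<rho>" by simp
      moreover have "\<bar>A (w n) v - A z v\<bar> \<le> M * N (\<lambda>x. w n x - z x) * N v"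
        using A_M[of "\<lambda>x. w n x - z x" v] w z v by (simp add: A.lin mem)
      ultimately show ?thesis by linarith
    qed
    have "\<bar>L v - A z v\<bar> \<le> 0"
    proof (rule LIMSEQ_le_const)
      have "(\<lambda>n. M * N (\<lambda>x. w n x - z x) * N v + q ^ n * c * N v / \<rho>) \<longlonglongrightarrow> M * 0 * N v + 0 * N v / \<rho>"
        using \<rho> by (intro tendsto_intros z qn) auto
      then show "(\<lambda>n. M * N (\<lambda>x. w n x - z x) * N v + q ^ n * c * N v / \<rho>) \<longlonglongrightarrow> 0" by simp
    qed (use est in auto)
    then show ?thesis by simp
  qed
  then show ?thesis using that z(1) by blast
qed

end

section \<open>Dirichlet forms with the strong sector condition\<close>

lemma L2_mult_integrable:
  assumes "u \<in> L2 m" "v \<in> L2 m" shows "integrable m (\<lambda>x. u x * v x)"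
proof (rule Bochner_Integration.integrable_bound)
  show "integrable m (\<lambda>x. (u x)\<^sup>2 + (v x)\<^sup>2)" using assms by (auto simp: L2_def)
  have "\<bar>a * b\<bar> \<le> \<bar>a\<^sup>2 + b\<^sup>2\<bar>" for a b :: real
  proof -
    have "2 * \<bar>a * b\<bar> \<le> a\<^sup>2 + b\<^sup>2"
      using sum_squares_bound[of "\<bar>a\<bar>" "\<bar>b\<bar>"] by (simp add: abs_mult mult.assoc)
    then show ?thesis using abs_ge_zero[of "a * b"] by linarith
  qed
  then show "AE x in m. norm (u x * v x) \<le> norm ((u x)\<^sup>2 + (v x)\<^sup>2)" by simp
qed (use assms in \<open>auto simp: L2_def\<close>)

lemma L2_bform: "bform (L2 m) (\<lambda>u v. \<integral>x. u x * v x \<partial>m)"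
proof
  fix u v :: "'a \<Rightarrow> real" and a b :: real assume uv: "u \<in> L2 m" "v \<in> L2 m"
  have "integrable m (\<lambda>x. a\<^sup>2 * (u x)\<^sup>2 + 2 * a * b * (u x * v x) + b\<^sup>2 * (v x)\<^sup>2)"
    using uv L2_mult_integrable[OF uv] by (auto simp: L2_def)
  then have "integrable m (\<lambda>x. (a * u x + b * v x)\<^sup>2)"
    by (rule Bochner_Integration.integrable_cong[THEN iffD1, rotated 2])
       (auto simp: power2_eq_square algebra_simps)
  then show "(\<lambda>x. a * u x + b * v x) \<in> L2 m" using uv by (auto simp: L2_def)
next
  fix u w v :: "'a \<Rightarrow> real" and a b :: real assume *: "u \<in> L2 m" "w \<in> L2 m" "v \<in> L2 m"
  show "(\<integral>x. (a * u x + b * w x) * v x \<partial>m) = a * (\<integral>x. u x * v x \<partial>m) + b * (\<integral>x. w x * v x \<partial>m)"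
    using * by (simp add: L2_mult_integrable distrib_right mult.assoc)
  show "(\<integral>x. v x * (a * u x + b * w x) \<partial>m) = a * (\<integral>x. v x * u x \<partial>m) + b * (\<integral>x. v x * w x \<partial>m)"
    using * by (simp add: L2_mult_integrable distrib_left mult.left_commute)
qed (auto simp: L2_def)

lemma integrable_Fatou:
  fixes f :: "nat \<Rightarrow> 'a \<Rightarrow> real"
  assumes f: "\<And>n. integrable m (f n)" "\<And>n. AE x in m. 0 \<le> f n x" "\<And>n. (\<integral>x. f n x \<partial>m) \<le> C"
    and lim: "AE x in m. (\<lambda>n. f n x) \<longlonglongrightarrow> u x" and u: "u \<in> borel_measurable m"
  shows "integrable m u"
proof -
  have "AE x in m. \<forall>n. 0 \<le> f n x" using f(2) by (simp add: AE_all_countable)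
  with lim have pos: "AE x in m. 0 \<le> u x \<and> ennreal (u x) = liminf (\<lambda>n. ennreal (f n x))"
  proof eventually_elim
    case (elim x)
    have "(\<lambda>n. ennreal (f n x)) \<longlonglongrightarrow> ennreal (u x)" using elim(1) by (rule tendsto_ennrealI)
    then show ?case using elim by (auto intro: LIMSEQ_le_const lim_imp_Liminf[symmetric])
  qed
  have "(\<integral>\<^sup>+x. ennreal (u x) \<partial>m) = (\<integral>\<^sup>+x. liminf (\<lambda>n. ennreal (f n x)) \<partial>m)"
    using pos by (intro nn_integral_cong_AE) auto
  also have "\<dots> \<le> liminf (\<lambda>n. \<integral>\<^sup>+x. ennreal (f n x) \<partial>m)"
    using f(1) by (intro nn_integral_liminf) auto
  also have "\<dots> \<le> ennreal C"
    using f by (intro Liminf_le) (auto simp: nn_integral_eq_integral intro!: always_eventually ennreal_leI)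
  finally have "(\<integral>\<^sup>+x. ennreal (u x) \<partial>m) < \<infinity>" by (simp add: le_less_trans)
  then show ?thesis using u pos by (intro integrableI_nonneg) auto
qed

section \<open>The unit contraction of the real line\<close>

definition clip :: "real \<Rightarrow> real" where "clip t = min (max t 0) 1"

lemma clip_bounds [simp]: "0 \<le> clip t" "clip t \<le> 1" by (auto simp: clip_def)

lemma clip_continuous: "continuous_on S f \<Longrightarrow> continuous_on S (\<lambda>x. clip (f x))"
  unfolding clip_def by (intro continuous_intros)

lemma clip_tendsto: "(f \<longlongrightarrow> l) F \<Longrightarrow> ((\<lambda>x. clip (f x)) \<longlongrightarrow> clip l) F"
  unfolding clip_def by (intro tendsto_intros)

lemma clip_scale: "a > 0 \<Longrightarrow> a * clip (t / a) = min (max t 0) a"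
  by (simp add: clip_def min_mult_distrib_left max_mult_distrib_left)

text \<open>A Dirichlet form is given with the unit contraction only; two-sided truncation is
  assembled from rescaled copies for t and -t, at the price of a factor 2 in
  \<open>Tk_contraction\<close>.\<close>

lemma Tk_clip: "a > 0 \<Longrightarrow> Tk a t = a * clip (t / a) - a * clip (- t / a)"
  unfolding clip_scale by (auto simp: Tk_def)

text \<open>\<open>clip\<close> is the nearest-point projection onto [0, 1], and all points of the
  open ray from \<open>clip s\<close> through s project to the same point.\<close>

lemma clip_line: "t > 0 \<Longrightarrow> clip (clip s + t * (s - clip s)) = clip s"
proof -
  assume t: "t > 0"
  consider "s \<le> 0" | "0 \<le> s" "s \<le> 1" | "s \<ge> 1" by linarith
  then show ?thesis
  proof cases
    case 1
    then show ?thesis using t by (simp add: clip_def mult_nonneg_nonpos)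
  next
    case 3
    then have "0 \<le> t * (s - 1)" using t by simp
    with 3 show ?thesis unfolding clip_def by simp
  qed (simp add: clip_def)
qed

section \<open>The seminorms of L2, of the form and of their sum, and weak limits\<close>

locale strong_dirichlet =
  fixes m :: "'a::{metric_space,second_countable_topology} measure"
    and \<E> :: "('a \<Rightarrow> real) \<Rightarrow> ('a \<Rightarrow> real) \<Rightarrow> real" and D :: "('a \<Rightarrow> real) set"
  assumes dirichlet: "dirichlet_form m \<E> D" and sector: "strong_sector \<E> D"
begin

lemma form: "form_on_L2 m \<E> D" using dirichlet by (simp add: dirichlet_form_def)

lemma D_L2: "u \<in> D \<Longrightarrow> u \<in> L2 m" using form by (auto simp: form_on_L2_def)

lemma D_meas: "u \<in> D \<Longrightarrow> u \<in> borel_measurable m" using D_L2 by (auto simp: L2_def)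

lemma D_AE: "u \<in> D \<Longrightarrow> u' \<in> borel_measurable m \<Longrightarrow> AE x in m. u' x = u x \<Longrightarrow> u' \<in> D"
  using form unfolding form_on_L2_def by blast

lemma \<E>_AE: "u \<in> D \<Longrightarrow> u' \<in> D \<Longrightarrow> v \<in> D \<Longrightarrow> v' \<in> D \<Longrightarrow> AE x in m. u' x = u x \<Longrightarrow>
    AE x in m. v' x = v x \<Longrightarrow> \<E> u' v' = \<E> u v"
  using form unfolding form_on_L2_def by blast

sublocale L: bform "L2 m" "\<lambda>u v. \<integral>x. u x * v x \<partial>m"
  by (rule L2_bform)

sublocale F: bform D \<E>
proof
  note form = form[unfolded form_on_L2_def]
  show "(\<lambda>x. 0) \<in> D" using form by (elim conjE)
  show "(\<lambda>x. a * u x + b * v x) \<in> D" if "u \<in> D" "v \<in> D" for u v a b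
    using form that by (elim conjE) blast
  have lin: "\<forall>u\<in>D. \<forall>w\<in>D. \<forall>v\<in>D. \<forall>a b::real.
        \<E> (\<lambda>x. a * u x + b * w x) v = a * \<E> u v + b * \<E> w v \<and>
        \<E> v (\<lambda>x. a * u x + b * w x) = a * \<E> v u + b * \<E> v w"
    using form by (elim conjE)
  fix u w v a b assume uwv: "u \<in> D" "w \<in> D" "v \<in> D"
  show "\<E> (\<lambda>x. a * u x + b * w x) v = a * \<E> u v + b * \<E> w v"
    "\<E> v (\<lambda>x. a * u x + b * w x) = a * \<E> v u + b * \<E> v w"
    using lin[rule_format, OF uwv] by blast+
next
  show "0 \<le> \<E> u u" if "u \<in> D" for u
    using dirichlet that unfolding dirichlet_form_def by blast
qed

sublocale H: complete_bform D "E1 m \<E>"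
proof -
  interpret bform D "E1 m \<E>"
  proof
    fix u assume "u \<in> D"
    then show "0 \<le> E1 m \<E> u u"
      using F.nonneg[of u] L.nonneg[OF D_L2, of u] by (simp add: E1_def)
  next
    fix u w v a b assume *: "u \<in> D" "w \<in> D" "v \<in> D"
    show "E1 m \<E> (\<lambda>x. a * u x + b * w x) v = a * E1 m \<E> u v + b * E1 m \<E> w v"
      unfolding E1_def F.comb_left[OF *] L.comb_left[OF *[THEN D_L2]] by (simp add: algebra_simps)
    show "E1 m \<E> v (\<lambda>x. a * u x + b * w x) = a * E1 m \<E> v u + b * E1 m \<E> v w"
      unfolding E1_def F.comb_right[OF *] L.comb_right[OF *[THEN D_L2]] by (simp add: algebra_simps)
  qed (rule F.zero_mem F.comb_mem; assumption)+
  show "complete_bform D (E1 m \<E>)"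
  proof
    fix y assume "\<And>n. y n \<in> D" "Cauchy_in y"
    then show "\<exists>u\<in>D. (\<lambda>n. E1 m \<E> (\<lambda>x. y n x - u x) (\<lambda>x. y n x - u x)) \<longlonglongrightarrow> 0"
      using dirichlet unfolding dirichlet_form_def Cauchy_in_def by blast
  qed
qed

lemma HN_sq: "u \<in> D \<Longrightarrow> (H.N u)\<^sup>2 = (F.N u)\<^sup>2 + (L.N u)\<^sup>2"
  by (simp add: H.N_sq F.N_sq L.N_sq D_L2 E1_def)

lemma FN_le_HN: "u \<in> D \<Longrightarrow> F.N u \<le> H.N u"
  using HN_sq[of u] H.N_nonneg by (auto intro: power2_le_imp_le)

lemma LN_le_HN: "u \<in> D \<Longrightarrow> L.N u \<le> H.N u"
  using HN_sq[of u] H.N_nonneg by (auto intro: power2_le_imp_le)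

lemma HN_le:
  assumes u: "u \<in> D" shows "H.N u \<le> F.N u + L.N u"
proof (rule power2_le_imp_le)
  have "0 \<le> 2 * F.N u * L.N u" using F.N_nonneg[OF u] L.N_nonneg[OF D_L2[OF u]] by simp
  then show "(H.N u)\<^sup>2 \<le> (F.N u + L.N u)\<^sup>2" unfolding HN_sq[OF u] power2_sum by linarith
  show "0 \<le> F.N u + L.N u" using F.N_nonneg[OF u] L.N_nonneg[OF D_L2[OF u]] by linarith
qed

lemma HN_AE: "u \<in> D \<Longrightarrow> v \<in> D \<Longrightarrow> AE x in m. u x = v x \<Longrightarrow> H.N u = H.N v"
proof -
  assume *: "u \<in> D" "v \<in> D" "AE x in m. u x = v x"
  have "(\<integral>x. u x * u x \<partial>m) = (\<integral>x. v x * v x \<partial>m)"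
    using * D_meas by (intro integral_cong_AE) auto
  then show ?thesis using \<E>_AE[of v u v u] * by (simp add: H.N_def E1_def)
qed

lemma L_Cauchy_Schwarz:
  "u \<in> L2 m \<Longrightarrow> v \<in> L2 m \<Longrightarrow> \<bar>\<integral>x. u x * v x \<partial>m\<bar> \<le> L.N u * L.N v"
  using L.Cauchy_Schwarz[of u v] by (simp add: mult.commute[of "v _"] abs_mult)

lemma LN_zero_AE: "u \<in> L2 m \<Longrightarrow> L.N u = 0 \<Longrightarrow> AE x in m. u x = 0"
  using integral_nonneg_eq_0_iff_AE[of m "\<lambda>x. u x * u x"]
  by (auto simp: L.N_def L2_mult_integrable)

lemma L2_bound: "g \<in> L2 m \<Longrightarrow> u \<in> borel_measurable m \<Longrightarrow> AE x in m. \<bar>u x\<bar> \<le> \<bar>g x\<bar> \<Longrightarrow> u \<in> L2 m"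
proof -
  assume *: "g \<in> L2 m" "u \<in> borel_measurable m" "AE x in m. \<bar>u x\<bar> \<le> \<bar>g x\<bar>"
  have "integrable m (\<lambda>x. (u x)\<^sup>2)"
  proof (rule Bochner_Integration.integrable_bound)
    show "AE x in m. norm ((u x)\<^sup>2) \<le> norm ((g x)\<^sup>2)"
      using *(3) by eventually_elim (simp add: abs_le_square_iff)
  qed (use * in \<open>auto simp: L2_def\<close>)
  then show ?thesis using * by (simp add: L2_def)
qed

lemma LN_mono: "g \<in> L2 m \<Longrightarrow> u \<in> borel_measurable m \<Longrightarrow> AE x in m. \<bar>u x\<bar> \<le> \<bar>g x\<bar> \<Longrightarrow> L.N u \<le> L.N g"
proof -
  assume *: "g \<in> L2 m" "u \<in> borel_measurable m" "AE x in m. \<bar>u x\<bar> \<le> \<bar>g x\<bar>"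
  have "u \<in> L2 m" by (rule L2_bound[OF *])
  have "AE x in m. u x * u x \<le> g x * g x"
    using *(3) by eventually_elim (metis abs_le_square_iff power2_eq_square)
  then show ?thesis unfolding L.N_def real_sqrt_le_iff
    by (intro integral_mono_AE L2_mult_integrable * \<open>u \<in> L2 m\<close>)
qed

lemma L2_dominated:
  assumes g: "g \<in> L2 m" and y: "\<And>n. y n \<in> borel_measurable m" and u: "u \<in> borel_measurable m"
    and bd: "\<And>n. AE x in m. \<bar>y n x\<bar> \<le> \<bar>g x\<bar>" and lim: "AE x in m. (\<lambda>n. y n x) \<longlonglongrightarrow> u x"
  shows "u \<in> L2 m" "(\<lambda>n. L.N (\<lambda>x. y n x - u x)) \<longlonglongrightarrow> 0"
proof -
  have bd': "AE x in m. \<forall>n. \<bar>y n x\<bar> \<le> \<bar>g x\<bar>" using bd by (simp add: AE_all_countable)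
  with lim have ug: "AE x in m. \<bar>u x\<bar> \<le> \<bar>g x\<bar>"
  proof eventually_elim
    case (elim x)
    have "(\<lambda>n. \<bar>y n x\<bar>) \<longlonglongrightarrow> \<bar>u x\<bar>" using elim(1) by (rule tendsto_rabs)
    then show ?case using elim(2) by (intro LIMSEQ_le_const2) auto
  qed
  then show "u \<in> L2 m" by (rule L2_bound[OF g u])
  have "(\<lambda>n. \<integral>x. (y n x - u x) * (y n x - u x) \<partial>m) \<longlonglongrightarrow> (\<integral>x. 0 \<partial>m)"
  proof (rule integral_dominated_convergence[where w="\<lambda>x. 4 * (g x)\<^sup>2"])
    show "integrable m (\<lambda>x. 4 * (g x)\<^sup>2)" using g by (simp add: L2_def)
    show "AE x in m. (\<lambda>n. (y n x - u x) * (y n x - u x)) \<longlonglongrightarrow> 0"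
      using lim
    proof eventually_elim
      case (elim x)
      then have "(\<lambda>n. (y n x - u x) * (y n x - u x)) \<longlonglongrightarrow> (u x - u x) * (u x - u x)"
        by (intro tendsto_intros)
      then show ?case by simp
    qed
    show "AE x in m. norm ((y n x - u x) * (y n x - u x)) \<le> 4 * (g x)\<^sup>2" for n
      using bd'  ug
    proof eventually_elim
      case (elim x)
      then have "\<bar>y n x - u x\<bar> \<le> 2 * \<bar>g x\<bar>" using spec[OF elim(1), of n] by linarith
      then have "\<bar>y n x - u x\<bar>\<^sup>2 \<le> (2 * \<bar>g x\<bar>)\<^sup>2" by (intro power_mono) auto
      then show ?case by (simp add: power_mult_distrib power2_eq_square abs_mult)
    qed
  qed (use y u in measurable)
  then show "(\<lambda>n. L.N (\<lambda>x. y n x - u x)) \<longlonglongrightarrow> 0"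
    using tendsto_real_sqrt by (fastforce simp: L.N_def)
qed

lemma sector_bound: "\<exists>K\<ge>0. \<forall>u\<in>D. \<forall>v\<in>D. \<bar>\<E> u v\<bar> \<le> K * F.N u * F.N v"
proof -
  obtain K where K: "\<And>u v. u \<in> D \<Longrightarrow> v \<in> D \<Longrightarrow> \<bar>\<E> u v\<bar> \<le> K * F.N u * F.N v"
    using sector unfolding strong_sector_def F.N_def by blast
  have "\<bar>\<E> u v\<bar> \<le> \<bar>K\<bar> * F.N u * F.N v" if "u \<in> D" "v \<in> D" for u v
  proof -
    have "K * (F.N u * F.N v) \<le> \<bar>K\<bar> * (F.N u * F.N v)"
      using F.N_nonneg that by (intro mult_right_mono) auto
    then show ?thesis using K[OF that] by (simp add: mult.assoc)
  qed
  then show ?thesis by (intro exI[of _ "\<bar>K\<bar>"]) simp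
qed

text \<open>Midpoint combinations of the tails are Cauchy in the complete norm \<open>H.N\<close>
  and so have a limit in \<open>D\<close>. Averaging the tails does not disturb the L2 limit, so
  both limits agree almost everywhere. This stands in for weak compactness followed by Mazur's
  lemma.\<close>

lemma weak_limit:
  assumes y: "\<And>n. y n \<in> D" and M: "\<And>n. H.N (y n) \<le> M"
    and u: "u \<in> L2 m" and lim: "(\<lambda>n. L.N (\<lambda>x. y n x - u x)) \<longlonglongrightarrow> 0"
  shows "\<exists>c. (\<forall>n. c n \<in> midhull (y ` {n..})) \<and> u \<in> D \<and> (\<lambda>n. H.N (\<lambda>x. c n x - u x)) \<longlonglongrightarrow> 0"
proof -
  obtain c where c: "\<And>n. c n \<in> midhull (y ` {n..})" "H.Cauchy_in c"
    using H.midhull_Cauchy[of y, OF y M] by auto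
  have cD: "c n \<in> D" for n by (rule H.midhull_mem[OF c(1)]) (use y in blast)
  obtain w where w: "w \<in> D" "(\<lambda>n. H.N (\<lambda>x. c n x - w x)) \<longlonglongrightarrow> 0"
    by (rule H.complete_N[of c, OF cD c(2)])
  have wu: "(\<lambda>x. w x - u x) \<in> L2 m" by (intro L.diff_mem D_L2 w u)
  have "L.N (\<lambda>x. w x - u x) \<le> 0"
  proof (rule field_le_epsilon)
    fix e :: real assume e: "e > 0"
    have "\<forall>\<^sub>F n in sequentially. L.N (\<lambda>x. y n x - u x) < e / 2"
      using lim e by (intro order_tendstoD) auto
    then obtain n0 where n0: "\<And>n. n \<ge> n0 \<Longrightarrow> L.N (\<lambda>x. y n x - u x) < e / 2"
      unfolding eventually_sequentially by blast
    have "\<forall>\<^sub>F n in sequentially. H.N (\<lambda>x. c n x - w x) < e / 2"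
      using w(2) e by (intro order_tendstoD) auto
    then obtain n1 where n1: "\<And>n. n \<ge> n1 \<Longrightarrow> H.N (\<lambda>x. c n x - w x) < e / 2"
      unfolding eventually_sequentially by blast
    define n where "n = max n0 n1"
    have "L.N (\<lambda>x. c n x - u x) \<le> e / 2"
    proof (rule L.midhull_N_dist[OF c(1) _ u])
      show "y ` {n..} \<subseteq> L2 m" using y D_L2 by blast
      fix v assume "v \<in> y ` {n..}"
      then obtain k where "v = y k" "k \<ge> n0" by (auto simp: n_def)
      then show "L.N (\<lambda>x. v x - u x) \<le> e / 2" using n0[of k] by simp
    qed
    moreover have "L.N (\<lambda>x. c n x - w x) \<le> e / 2"
      using order_trans[OF LN_le_HN[OF F.diff_mem[OF cD w(1)]] less_imp_le[OF n1]] by (simp add: n_def)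
    moreover have "L.N (\<lambda>x. w x - u x) \<le> L.N (\<lambda>x. w x - c n x) + L.N (\<lambda>x. c n x - u x)"
      by (intro L.N_triangle_3 D_L2 w cD u)
    ultimately show "L.N (\<lambda>x. w x - u x) \<le> 0 + e"
      using L.N_minus_commute[OF D_L2 D_L2, OF w(1) cD, of n] by simp
  qed
  then have "L.N (\<lambda>x. w x - u x) = 0" using L.N_nonneg[OF wu] by simp
  from LN_zero_AE[OF wu this] have wu: "AE x in m. u x = w x" by eventually_elim simp
  have uD: "u \<in> D" by (rule D_AE[OF w(1) _ wu]) (use u in \<open>simp add: L2_def\<close>)
  have "H.N (\<lambda>x. c n x - u x) = H.N (\<lambda>x. c n x - w x)" for n
  proof (rule HN_AE)
    show "AE x in m. c n x - u x = c n x - w x" using wu by eventually_elim simp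
  qed (intro F.diff_mem cD uD w)+
  then have "(\<lambda>n. H.N (\<lambda>x. c n x - u x)) \<longlonglongrightarrow> 0" using w(2) by simp
  then show ?thesis using c(1) uD by blast
qed

text \<open>Lower semicontinuity of the form seminorm: midpoint combinations inherit the bound C,
  and they converge strongly.\<close>

lemma weak_limit_F_le:
  assumes y: "\<And>n. y n \<in> D" "\<And>n. H.N (y n) \<le> M"
    and u: "u \<in> L2 m" "(\<lambda>n. L.N (\<lambda>x. y n x - u x)) \<longlonglongrightarrow> 0"
    and C: "\<And>n. F.N (y n) \<le> C"
  shows "u \<in> D" "F.N u \<le> C"
proof -
  obtain c where c: "\<And>n. c n \<in> midhull (y ` {n..})" "u \<in> D" "(\<lambda>n. H.N (\<lambda>x. c n x - u x)) \<longlonglongrightarrow> 0"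
    using weak_limit[of y, OF y u] by auto
  have cD: "c n \<in> D" for n by (rule H.midhull_mem[OF c(1)]) (use y in blast)
  show "u \<in> D" by fact
  have "F.N u \<le> H.N (\<lambda>x. c n x - u x) + C" for n
  proof -
    have "F.N u \<le> F.N (\<lambda>x. u x - c n x) + F.N (c n)" by (intro F.N_triangle_sub cD c)
    moreover have "F.N (c n) \<le> C" by (rule F.midhull_N_le[OF c(1)]) (use y C in auto)
    moreover have "F.N (\<lambda>x. u x - c n x) \<le> H.N (\<lambda>x. c n x - u x)"
      unfolding F.N_minus_commute[OF c(2) cD] by (intro FN_le_HN F.mem cD c)
    ultimately show ?thesis by simp
  qed
  moreover have "(\<lambda>n. H.N (\<lambda>x. c n x - u x) + C) \<longlonglongrightarrow> 0 + C" by (intro tendsto_intros c)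
  ultimately show "F.N u \<le> C" by (intro LIMSEQ_le_const[of _ C]) auto
qed

text \<open>A strongly closed, midpoint convex set is weakly closed, because the approximating
  combinations of \<open>weak_limit\<close> stay inside it.\<close>

lemma weak_limit_closed:
  assumes P: "P \<subseteq> D" "\<And>u v. u \<in> P \<Longrightarrow> v \<in> P \<Longrightarrow> (\<lambda>x. (u x + v x) / 2) \<in> P"
    and cl: "\<And>c u. (\<And>n. c n \<in> P) \<Longrightarrow> u \<in> D \<Longrightarrow> (\<lambda>n. H.N (\<lambda>x. c n x - u x)) \<longlonglongrightarrow> 0 \<Longrightarrow> u \<in> P"
    and y: "\<And>n. y n \<in> P" "\<And>n. H.N (y n) \<le> M"
    and u: "u \<in> L2 m" "(\<lambda>n. L.N (\<lambda>x. y n x - u x)) \<longlonglongrightarrow> 0"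
  shows "u \<in> P"
proof -
  have yD: "y n \<in> D" for n using y P by blast
  obtain c where c: "\<And>n. c n \<in> midhull (y ` {n..})" "u \<in> D" "(\<lambda>n. H.N (\<lambda>x. c n x - u x)) \<longlonglongrightarrow> 0"
    using weak_limit[of y, OF yD y(2) u] by auto
  have "v \<in> P" if "v \<in> midhull (y ` {n..})" for v n
    using that by (induction rule: midhull.induct) (use y P in auto)
  then show ?thesis using cl c by blast
qed

section \<open>Contractions and lattice operations from the two Markov inequalities\<close>

lemma clip_mem: "u \<in> D \<Longrightarrow> (\<lambda>x. clip (u x)) \<in> D"
  using dirichlet by (simp add: dirichlet_form_def clip_def)

lemma clip_dual: "u \<in> D \<Longrightarrow> 0 \<le> \<E> (\<lambda>x. u x - clip (u x)) (\<lambda>x. u x + clip (u x))"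
  using dirichlet by (simp add: dirichlet_form_def clip_def)

lemma clip_primal: "u \<in> D \<Longrightarrow> 0 \<le> \<E> (\<lambda>x. u x + clip (u x)) (\<lambda>x. u x - clip (u x))"
  using dirichlet by (simp add: dirichlet_form_def clip_def)

text \<open>Adding the sub-Markov and the dual sub-Markov inequality cancels the mixed terms, which
  need not agree without symmetry.\<close>

lemma clip_contraction: "u \<in> D \<Longrightarrow> F.N (\<lambda>x. clip (u x)) \<le> F.N u"
  using clip_dual[of u] clip_primal[of u] by (simp add: F.N_def F.lin F.mem clip_mem)

text \<open>All functions \<open>u\<^sup># + t (u - u\<^sup>#)\<close> with \<open>t > 0\<close> have the same unit contraction \<open>u\<^sup>#\<close>;
  divide the dual sub-Markov inequality for them by \<open>t\<close> and let \<open>t\<close> tend to 0.\<close>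

lemma clip_\<E>_le:
  assumes u: "u \<in> D"
  shows "\<E> (\<lambda>x. clip (u x)) (\<lambda>x. clip (u x)) \<le> \<E> u (\<lambda>x. clip (u x))"
proof -
  define z where "z = (\<lambda>x. clip (u x))"
  define d where "d = (\<lambda>x. u x - z x)"
  have zd: "z \<in> D" "d \<in> D" using u by (auto simp: z_def d_def intro: clip_mem F.mem)
  have *: "0 \<le> 2 * \<E> d z + t * \<E> d d" if t: "t > 0" for t
  proof -
    define w where "w = (\<lambda>x. z x + t * d x)"
    have w: "w \<in> D" unfolding w_def by (intro F.mem zd)
    have "clip (w x) = z x" for x using clip_line[OF t] by (simp add: w_def z_def d_def)
    then have "0 \<le> \<E> (\<lambda>x. w x - z x) (\<lambda>x. w x + z x)" using clip_dual[OF w] by simp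
    also have "(\<lambda>x. w x - z x) = (\<lambda>x. t * d x)" by (simp add: w_def)
    also have "\<E> (\<lambda>x. t * d x) (\<lambda>x. w x + z x) = t * (2 * \<E> d z + t * \<E> d d)"
      using zd w by (simp add: F.lin F.mem) (simp add: w_def F.lin F.mem zd algebra_simps)
    finally show ?thesis using t by (simp add: zero_le_mult_iff)
  qed
  have "0 \<le> \<E> d z"
  proof (rule ccontr)
    assume "\<not> 0 \<le> \<E> d z"
    then have p: "- \<E> d z > 0" by simp
    have q: "\<E> d d \<ge> 0" using F.nonneg zd by blast
    \<comment> \<open>This t makes \<open>t * \<E> d d\<close> at most \<open>- \<E> d z\<close>, so
      that \<open>2 * \<E> d z + t * \<E> d d\<close> would be negative.\<close>
    have "(- \<E> d z / (\<E> d d + 1)) * \<E> d d \<le> - \<E> d z"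
      using p q by (simp add: field_simps mult_nonpos_nonneg)
    moreover have "- \<E> d z / (\<E> d d + 1) > 0" using p q by (intro divide_pos_pos) auto
    ultimately show False using *[of "- \<E> d z / (\<E> d d + 1)"] p by linarith
  qed
  then show ?thesis using zd u unfolding d_def by (simp add: F.lin z_def[symmetric])
qed

lemma clip_scale_mem: "u \<in> D \<Longrightarrow> (\<lambda>x. a * clip (u x / a)) \<in> D"
  using F.scale_mem[OF clip_mem[OF F.scale_mem[of u "1/a"]]] by simp

lemma clip_scale_contraction:
  assumes u: "u \<in> D" and a: "a > 0" shows "F.N (\<lambda>x. a * clip (u x / a)) \<le> F.N u"
proof -
  have "F.N (\<lambda>x. clip (1 / a * u x)) \<le> 1 / a * F.N u"
    using clip_contraction[OF F.scale_mem[OF u, of "1 / a"]] a F.N_scale[OF u, of "1 / a"] by simp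
  then have "a * F.N (\<lambda>x. clip (1 / a * u x)) \<le> F.N u" using a by (simp add: field_simps)
  then show ?thesis
    using F.N_scale[OF clip_mem[OF F.scale_mem[OF u, of "1 / a"]], of a] a by simp
qed

lemma Tk_mem: "u \<in> D \<Longrightarrow> a > 0 \<Longrightarrow> (\<lambda>x. Tk a (u x)) \<in> D"
  using F.diff_mem[OF clip_scale_mem[of u a] clip_scale_mem[OF F.uminus_mem, of u a]]
  by (simp add: Tk_clip)

lemma Tk_contraction:
  assumes u: "u \<in> D" and a: "a > 0" shows "F.N (\<lambda>x. Tk a (u x)) \<le> 2 * F.N u"
proof -
  have "F.N (\<lambda>x. Tk a (u x)) \<le> F.N (\<lambda>x. a * clip (u x / a)) + F.N (\<lambda>x. a * clip (- u x / a))"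
    unfolding Tk_clip[OF a] by (intro F.N_triangle_diff clip_scale_mem F.uminus_mem u)
  also have "F.N (\<lambda>x. a * clip (- u x / a)) \<le> F.N (\<lambda>x. - u x)"
    using a u by (intro clip_scale_contraction F.mem)
  also have "F.N (\<lambda>x. - u x) = F.N u" using F.N_scale[OF u, of "-1"] by simp
  finally show ?thesis using clip_scale_contraction[OF u a] by simp
qed

text \<open>The positive part is not a rescaled unit contraction, but the increasing limit of such;
  they converge in L2 with bounded energy, so lower semicontinuity applies.\<close>

lemma pos_part:
  assumes u: "u \<in> D" shows "(\<lambda>x. max (u x) 0) \<in> D" "F.N (\<lambda>x. max (u x) 0) \<le> F.N u"
proof -
  define y where "y n = (\<lambda>x. real (Suc n) * clip (u x / real (Suc n)))" for n
  have y: "y n \<in> D" "F.N (y n) \<le> F.N u" for n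
    unfolding y_def by (intro clip_scale_mem clip_scale_contraction u, simp)+
  have y_eq: "y n x = min (max (u x) 0) (real (Suc n))" for n x
    unfolding y_def by (rule clip_scale) simp
  have yu: "\<bar>y n x\<bar> \<le> \<bar>u x\<bar>" for n x unfolding y_eq by auto
  have lim: "(\<lambda>n. y n x) \<longlonglongrightarrow> max (u x) 0" for x
  proof (rule tendsto_eventually)
    obtain n0 where "max (u x) 0 \<le> real n0" using real_arch_simple by blast
    then show "\<forall>\<^sub>F n in sequentially. y n x = max (u x) 0"
      unfolding eventually_sequentially y_eq by (intro exI[of _ n0]) auto
  qed
  have L: "(\<lambda>x. max (u x) 0) \<in> L2 m" "(\<lambda>n. L.N (\<lambda>x. y n x - max (u x) 0)) \<longlonglongrightarrow> 0"
    using D_meas[OF u] D_meas[OF y(1)]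
    by (intro L2_dominated[OF D_L2[OF u], of y]; simp add: yu lim)+
  have HM: "H.N (y n) \<le> F.N u + L.N u" for n
    using HN_le[OF y(1), of n] y(2)[of n] LN_mono[OF D_L2[OF u] D_meas[OF y(1)], of n] yu by force
  show "(\<lambda>x. max (u x) 0) \<in> D" "F.N (\<lambda>x. max (u x) 0) \<le> F.N u"
    using weak_limit_F_le[OF y(1) HM L y(2)] by auto
qed

lemma pos_part_HN: "u \<in> D \<Longrightarrow> H.N (\<lambda>x. max (u x) 0) \<le> H.N u"
proof -
  assume u: "u \<in> D"
  have "L.N (\<lambda>x. max (u x) 0) \<le> L.N u"
    using D_meas[OF u] by (intro LN_mono D_L2 u) auto
  then have "(H.N (\<lambda>x. max (u x) 0))\<^sup>2 \<le> (H.N u)\<^sup>2"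
    unfolding HN_sq[OF u] HN_sq[OF pos_part(1)[OF u]]
    using pos_part[OF u] F.N_nonneg L.N_nonneg D_L2 by (intro add_mono power_mono) auto
  then show ?thesis using H.N_nonneg[OF u] by (rule power2_le_imp_le)
qed

lemma min_mem:
  assumes "u \<in> D" "v \<in> D"
  shows "(\<lambda>x. min (u x) (v x)) \<in> D" "H.N (\<lambda>x. min (u x) (v x)) \<le> 2 * H.N u + H.N v"
proof -
  let ?d = "\<lambda>x. u x - v x"
  have d: "?d \<in> D" using assms by (intro F.mem)
  have eq: "(\<lambda>x. min (u x) (v x)) = (\<lambda>x. u x - max (?d x) 0)" by (auto simp: min_def max_def)
  show "(\<lambda>x. min (u x) (v x)) \<in> D" unfolding eq by (intro F.mem pos_part d assms)
  have "H.N (\<lambda>x. min (u x) (v x)) \<le> H.N u + H.N (\<lambda>x. max (?d x) 0)"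
    unfolding eq by (intro H.N_triangle_diff pos_part d assms)
  also have "\<dots> \<le> H.N u + (H.N u + H.N v)"
    using order_trans[OF pos_part_HN[OF d] H.N_triangle_diff[OF assms]] by simp
  finally show "H.N (\<lambda>x. min (u x) (v x)) \<le> 2 * H.N u + H.N v" by simp
qed

end

section \<open>Resolvents\<close>

context strong_dirichlet begin

text \<open>Against \<open>E1\<close>, the form \<open>\<E> + \<alpha> (.,.)\<close> has bound
  \<open>K + \<alpha>\<close> and coercivity constant \<open>min 1 \<alpha>\<close>, so
  \<open>Lax_Milgram\<close> applies.\<close>

lemma resolvent_exists:
  assumes \<alpha>: "\<alpha> > 0" and g: "g \<in> L2 m"
  shows "\<exists>w. resolvent m \<E> D \<alpha> g w"
proof -
  obtain K where K: "K \<ge> 0" "\<And>u v. u \<in> D \<Longrightarrow> v \<in> D \<Longrightarrow> \<bar>\<E> u v\<bar> \<le> K * F.N u * F.N v"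
    using sector_bound by blast
  define A where "A u v = \<E> u v + \<alpha> * (\<integral>x. u x * v x \<partial>m)" for u v
  have "\<exists>w\<in>D. \<forall>v\<in>D. A w v = (\<integral>x. g x * v x \<partial>m)"
  proof (rule H.Lax_Milgram[of A "K + \<alpha>" "min 1 \<alpha>" "\<lambda>v. \<integral>x. g x * v x \<partial>m" "L.N g"])
    show "bform D A"
    proof
      fix u w v a b assume *: "u \<in> D" "w \<in> D" "v \<in> D"
      show "A (\<lambda>x. a * u x + b * w x) v = a * A u v + b * A w v"
        unfolding A_def F.comb_left[OF *] L.comb_left[OF *[THEN D_L2]] by (simp add: algebra_simps)
      show "A v (\<lambda>x. a * u x + b * w x) = a * A v u + b * A v w"
        unfolding A_def F.comb_right[OF *] L.comb_right[OF *[THEN D_L2]] by (simp add: algebra_simps)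
    next
      fix u assume "u \<in> D"
      then show "0 \<le> A u u"
        using F.nonneg[of u] L.nonneg[OF D_L2, of u] \<alpha> by (simp add: A_def)
    qed (rule F.zero_mem F.comb_mem; assumption)+
  next
    fix u v assume uv: "u \<in> D" "v \<in> D"
    note nn = F.N_nonneg[OF uv(1)] F.N_nonneg[OF uv(2)] L.N_nonneg[OF D_L2[OF uv(1)]]
      L.N_nonneg[OF D_L2[OF uv(2)]] H.N_nonneg[OF uv(1)]
    have 1: "F.N u * F.N v \<le> H.N u * H.N v"
      by (intro mult_mono FN_le_HN uv nn)
    have 2: "L.N u * L.N v \<le> H.N u * H.N v"
      by (intro mult_mono LN_le_HN uv nn)
    have "\<bar>A u v\<bar> \<le> \<bar>\<E> u v\<bar> + \<alpha> * \<bar>\<integral>x. u x * v x \<partial>m\<bar>"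
      unfolding A_def using \<alpha> by (simp add: abs_triangle_ineq[THEN order_trans] abs_mult)
    also have "\<dots> \<le> K * (H.N u * H.N v) + \<alpha> * (H.N u * H.N v)"
    proof (intro add_mono mult_left_mono)
      show "\<bar>\<E> u v\<bar> \<le> K * (H.N u * H.N v)"
        using K(2)[OF uv] mult_left_mono[OF 1 K(1)] by (simp add: mult.assoc)
      show "\<bar>\<integral>x. u x * v x \<partial>m\<bar> \<le> H.N u * H.N v"
        using L_Cauchy_Schwarz[OF D_L2 D_L2, OF uv] 2 by simp
    qed (use \<alpha> in simp)
    finally show "\<bar>A u v\<bar> \<le> (K + \<alpha>) * H.N u * H.N v" by (simp add: algebra_simps)
  next
    fix u assume u: "u \<in> D"
    have "min 1 \<alpha> * (F.N u)\<^sup>2 \<le> 1 * (F.N u)\<^sup>2" by (intro mult_right_mono) auto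
    moreover have "min 1 \<alpha> * (L.N u)\<^sup>2 \<le> \<alpha> * (L.N u)\<^sup>2" by (intro mult_right_mono) auto
    ultimately show "min 1 \<alpha> * (H.N u)\<^sup>2 \<le> A u u"
      unfolding HN_sq[OF u] A_def distrib_left using F.N_sq[OF u] L.N_sq[OF D_L2[OF u]] by simp
  next
    fix v assume "v \<in> D"
    then show "\<bar>\<integral>x. g x * v x \<partial>m\<bar> \<le> L.N g * H.N v"
      using L_Cauchy_Schwarz[OF g D_L2] LN_le_HN L.N_nonneg[OF g]
      by (meson mult_left_mono order_trans)
  next
    fix w assume "w \<in> D" "\<And>v. v \<in> D \<Longrightarrow> A w v = (\<integral>x. g x * v x \<partial>m)"
    then show "\<exists>w\<in>D. \<forall>v\<in>D. A w v = (\<integral>x. g x * v x \<partial>m)" by blast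
  qed (use \<alpha> L.comb_right[OF D_L2 D_L2 g] in auto)
  then show ?thesis by (auto simp: resolvent_def A_def)
qed

lemma resolvent_uminus:
  assumes "resolvent m \<E> D \<alpha> f w"
  shows "resolvent m \<E> D \<alpha> (\<lambda>x. - f x) (\<lambda>x. - w x)"
proof -
  have w: "w \<in> D" and res: "\<And>v. v \<in> D \<Longrightarrow> \<E> w v + \<alpha> * (\<integral>x. w x * v x \<partial>m) = (\<integral>x. f x * v x \<partial>m)"
    using assms by (auto simp: resolvent_def)
  have "\<E> (\<lambda>x. - w x) v + \<alpha> * (\<integral>x. - w x * v x \<partial>m) = (\<integral>x. - f x * v x \<partial>m)" if "v \<in> D" for v
    using F.scale_left[OF w that, of "-1"] res[OF that] by simp
  then show ?thesis unfolding resolvent_def using F.uminus_mem[OF w] by blast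
qed

text \<open>Testing with \<open>(n w)\<^sup>#\<close> and letting \<open>n\<close> tend to infinity gives the \<open>L\<^sup>1\<close> bound on \<open>w\<^sup>+\<close>;
  this is where the dual sub-Markov property enters.\<close>

lemma resolvent_pos_integrable:
  assumes \<alpha>: "\<alpha> > 0" and f: "f \<in> L2 m" "integrable m f" and w: "resolvent m \<E> D \<alpha> f w"
  shows "integrable m (\<lambda>x. max (w x) 0)"
proof (rule integrable_Fatou)
  have wD: "w \<in> D" and res: "\<And>v. v \<in> D \<Longrightarrow> \<E> w v + \<alpha> * (\<integral>x. w x * v x \<partial>m) = (\<integral>x. f x * v x \<partial>m)"
    using w by (auto simp: resolvent_def)
  define c where "c n x = clip (real (Suc n) * w x)" for n x
  have cD: "c n \<in> D" for n unfolding c_def by (intro clip_mem F.mem wD)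
  have wc: "w x * c n x \<ge> 0" for n x
  proof (cases "w x \<ge> 0")
    case False
    then have "c n x = 0" unfolding c_def clip_def by (simp add: mult_nonneg_nonpos del: of_nat_Suc)
    then show ?thesis by simp
  qed (simp add: c_def)
  show "integrable m (\<lambda>x. w x * c n x)" for n by (intro L2_mult_integrable D_L2 wD cD)
  show "AE x in m. 0 \<le> w x * c n x" for n using wc by simp
  show "(\<integral>x. w x * c n x \<partial>m) \<le> (\<integral>x. \<bar>f x\<bar> \<partial>m) / \<alpha>" for n
  proof -
    have "0 \<le> \<E> (c n) (c n)" by (intro F.nonneg cD)
    also have "\<dots> \<le> \<E> (\<lambda>x. real (Suc n) * w x) (c n)"
      using clip_\<E>_le[OF F.scale_mem[OF wD, of "real (Suc n)"]] by (simp add: c_def[abs_def])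
    also have "\<dots> = real (Suc n) * \<E> w (c n)" by (rule F.scale_left[OF wD cD])
    finally have "0 \<le> \<E> w (c n)" by (simp add: zero_le_mult_iff)
    moreover have "(\<integral>x. f x * c n x \<partial>m) \<le> (\<integral>x. \<bar>f x\<bar> \<partial>m)"
    proof (rule integral_mono)
      show "f x * c n x \<le> \<bar>f x\<bar>" for x
      proof -
        have "\<bar>f x * c n x\<bar> \<le> \<bar>f x\<bar> * 1" unfolding abs_mult by (intro mult_left_mono) (auto simp: c_def)
        then show ?thesis by simp
      qed
    qed (use f L2_mult_integrable[OF f(1) D_L2[OF cD]] in auto)
    ultimately show ?thesis using res[OF cD, of n] \<alpha> by (simp add: field_simps)
  qed
  show "AE x in m. (\<lambda>n. w x * c n x) \<longlonglongrightarrow> max (w x) 0"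
  proof (rule AE_I2)
    fix x
    show "(\<lambda>n. w x * c n x) \<longlonglongrightarrow> max (w x) 0"
    proof (cases "w x > 0")
      case pos: True
      then obtain n0 where "real n0 * w x > 1" using reals_Archimedean3[of "w x"] by blast
      then have "1 \<le> real (Suc n) * w x" if "n \<ge> n0" for n
      proof -
        have "real n0 * w x \<le> real (Suc n) * w x" using that pos by (intro mult_right_mono) auto
        then show ?thesis using \<open>real n0 * w x > 1\<close> by linarith
      qed
      then have "\<forall>\<^sub>F n in sequentially. w x * c n x = max (w x) 0"
        unfolding eventually_sequentially c_def clip_def using pos by (intro exI[of _ n0]) auto
      then show "(\<lambda>n. w x * c n x) \<longlonglongrightarrow> max (w x) 0" by (rule tendsto_eventually)
    next
      case False
      then have "c n x = 0" for n
        unfolding c_def clip_def by (simp add: mult_nonneg_nonpos del: of_nat_Suc)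
      then show "(\<lambda>n. w x * c n x) \<longlonglongrightarrow> max (w x) 0" using False by simp
    qed
  qed
  show "(\<lambda>x. max (w x) 0) \<in> borel_measurable m" using D_meas[OF wD] by measurable
qed

lemma resolvent_integrable:
  assumes \<alpha>: "\<alpha> > 0" and f: "f \<in> L2 m" "integrable m f" and w: "resolvent m \<E> D \<alpha> f w"
  shows "integrable m w"
proof -
  have "integrable m (\<lambda>x. max (w x) 0 - max (- w x) 0)"
    using resolvent_pos_integrable[OF \<alpha> f w] f
      resolvent_pos_integrable[OF \<alpha> L.uminus_mem[OF f(1)] _ resolvent_uminus[OF w]] by simp
  moreover have "(\<lambda>x. max (w x) 0 - max (- w x) 0) = w" by auto
  ultimately show ?thesis by simp
qed

text \<open>The resolvent equation turns the form into an integral against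
  \<open>f - \<alpha> w\<close>. The test functions are dominated by a mere constant, which is why
  integrability of \<open>w\<close> is required.\<close>

lemma bounded_vanishing_resolvent:
  assumes \<alpha>: "\<alpha> > 0" and f: "f \<in> L2 m" "integrable m f" and w: "resolvent m \<E> D \<alpha> f w"
    and v: "\<And>k. v k \<in> D" "\<And>k. AE x in m. \<bar>v k x\<bar> \<le> C" and lim: "AE x in m. (\<lambda>k. v k x) \<longlonglongrightarrow> 0"
  shows "(\<lambda>k. \<E> w (v k)) \<longlonglongrightarrow> 0"
proof -
  have wD: "w \<in> D" and res: "\<And>v. v \<in> D \<Longrightarrow> \<E> w v + \<alpha> * (\<integral>x. w x * v x \<partial>m) = (\<integral>x. f x * v x \<partial>m)"
    using w by (auto simp: resolvent_def)
  have int: "integrable m (\<lambda>x. f x - \<alpha> * w x)" using f resolvent_integrable[OF assms(1-4)] by simp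
  have eq: "\<E> w (v k) = (\<integral>x. (f x - \<alpha> * w x) * v k x \<partial>m)" for k
  proof -
    have "(\<integral>x. (f x - \<alpha> * w x) * v k x \<partial>m) = (\<integral>x. f x * v k x \<partial>m) - \<alpha> * (\<integral>x. w x * v k x \<partial>m)"
      using L.diff_left[OF f(1) L.scale_mem[OF D_L2[OF wD], of \<alpha>] D_L2[OF v(1)]]
        L.scale_left[OF D_L2[OF wD] D_L2[OF v(1)], of \<alpha>] by simp
    then show ?thesis using res[OF v(1), of k] by simp
  qed
  have "(\<lambda>k. \<integral>x. (f x - \<alpha> * w x) * v k x \<partial>m) \<longlonglongrightarrow> (\<integral>x. 0 \<partial>m)"
  proof (rule integral_dominated_convergence[where w = "\<lambda>x. C * \<bar>f x - \<alpha> * w x\<bar>"])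
    show "integrable m (\<lambda>x. C * \<bar>f x - \<alpha> * w x\<bar>)" using int by simp
    show "AE x in m. (\<lambda>k. (f x - \<alpha> * w x) * v k x) \<longlonglongrightarrow> 0"
      using lim by eventually_elim (rule tendsto_mult_right_zero)
    show "AE x in m. norm ((f x - \<alpha> * w x) * v k x) \<le> C * \<bar>f x - \<alpha> * w x\<bar>" for k
      using v(2)[of k]
    proof eventually_elim
      case (elim x)
      then show ?case using mult_left_mono[OF elim abs_ge_zero[of "f x - \<alpha> * w x"]]
        by (simp add: abs_mult mult.commute)
    qed
    show "(\<lambda>x. (f x - \<alpha> * w x) * v k x) \<in> borel_measurable m" for k
      using D_meas[OF v(1)] D_meas[OF wD] f by measurable
  qed simp
  then show ?thesis by (simp add: eq)
qed

text \<open>Testing the equation with \<open>w n - y\<close> gives \<open>E\<close> below, with the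
  level \<open>Suc n\<close> as a weight on the L2 distance. It bounds the energy of
  \<open>w n\<close> by that of \<open>y\<close>, and then the squared distance by a constant over
  \<open>Suc n\<close>.\<close>

lemma resolvent_approximation:
  assumes y: "y \<in> D" and w: "\<And>n. resolvent m \<E> D (real (Suc n)) (\<lambda>x. real (Suc n) * y x) (w n)"
  shows "(\<lambda>n. L.N (\<lambda>x. w n x - y x)) \<longlonglongrightarrow> 0" "\<exists>M. \<forall>n. H.N (w n) \<le> M"
proof -
  obtain K where K: "K \<ge> 0" "\<And>u v. u \<in> D \<Longrightarrow> v \<in> D \<Longrightarrow> \<bar>\<E> u v\<bar> \<le> K * F.N u * F.N v"
    using sector_bound by blast
  have wD: "w n \<in> D" for n using w[of n] by (auto simp: resolvent_def)
  have L2: "w n \<in> L2 m" "y \<in> L2 m" "(\<lambda>x. w n x - y x) \<in> L2 m" for n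
    using wD y by (intro L.mem D_L2; blast)+
  have res: "\<E> (w n) (\<lambda>x. w n x - y x) = - (real (Suc n) * (L.N (\<lambda>x. w n x - y x))\<^sup>2)" for n
  proof -
    have "\<E> (w n) (\<lambda>x. w n x - y x) = (\<integral>x. (real (Suc n) * y x) * (w n x - y x) \<partial>m)
        - real (Suc n) * (\<integral>x. w n x * (w n x - y x) \<partial>m)"
      using w[of n] F.diff_mem[OF wD[of n] y] unfolding resolvent_def eq_diff_eq by blast
    also have "\<dots> = - real (Suc n) * (\<integral>x. (w n x - y x) * (w n x - y x) \<partial>m)"
      unfolding L.scale_left[OF L2(2,3)] L.diff_left[OF L2(1,2,3)] by (simp only: algebra_simps)
    finally show ?thesis by (simp only: L.N_sq[OF L2(3)] mult_minus_left)
  qed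
  have E: "(F.N (w n))\<^sup>2 + real (Suc n) * (L.N (\<lambda>x. w n x - y x))\<^sup>2 \<le> K * F.N (w n) * F.N y" for n
    using res[of n] F.diff_right[OF wD y wD, of n n] F.N_sq[OF wD, of n] K(2)[OF wD y, of n] by linarith
  have Fw: "F.N (w n) \<le> K * F.N y" for n
  proof -
    have "0 \<le> real (Suc n) * (L.N (\<lambda>x. w n x - y x))\<^sup>2" by simp
    with E[of n] have "F.N (w n) * F.N (w n) \<le> F.N (w n) * (K * F.N y)"
      unfolding power2_eq_square by (simp only: mult_ac)
    then show ?thesis using F.N_nonneg[OF wD, of n] F.N_nonneg[OF y] K(1)
      by (cases "F.N (w n) = 0") (auto simp: mult_le_cancel_left)
  qed
  define c where "c = K * (K * F.N y) * F.N y"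
  have Lw: "(L.N (\<lambda>x. w n x - y x))\<^sup>2 \<le> c / real (Suc n)" for n
  proof -
    have "K * F.N (w n) * F.N y \<le> c"
      unfolding c_def using Fw[of n] K F.N_nonneg[OF y] by (intro mult_right_mono mult_left_mono) auto
    then have "real (Suc n) * (L.N (\<lambda>x. w n x - y x))\<^sup>2 \<le> c"
      using E[of n] zero_le_power2[of "F.N (w n)"] by linarith
    then show ?thesis by (simp add: field_simps)
  qed
  have "(\<lambda>n. c / real (Suc n)) \<longlonglongrightarrow> 0"
    using LIMSEQ_Suc[OF lim_const_over_n[of c]] by simp
  then have "(\<lambda>n. (L.N (\<lambda>x. w n x - y x))\<^sup>2) \<longlonglongrightarrow> 0"
    by (rule tendsto_sandwich[OF _ _ tendsto_const, rotated 2]) (use Lw in auto)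
  then show lim: "(\<lambda>n. L.N (\<lambda>x. w n x - y x)) \<longlonglongrightarrow> 0"
    by (simp add: tendsto_null_power)
  obtain M where M: "\<And>n. L.N (\<lambda>x. w n x - y x) \<le> M"
    using convergent_imp_bounded[OF lim] unfolding bounded_iff
    by (auto intro: order_trans[OF abs_ge_self])
  have "H.N (w n) \<le> K * F.N y + (M + L.N y)" for n
    using HN_le[OF wD, of n] Fw[of n] L.N_triangle_sub[OF L2(1,2), of n] M[of n] by linarith
  then show "\<exists>M. \<forall>n. H.N (w n) \<le> M" by blast
qed

end

section \<open>Closability and the extended form\<close>

text \<open>Regularity approximates elements of \<open>D\<close> by functions in \<open>Cc\<close>;
  this puts the approximants into \<open>L\<^sup>1\<close>, where the resolvent bound is
  available.\<close>

lemma radon_Cc_integrable: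
  fixes m :: "'a::{metric_space,second_countable_topology} measure"
  assumes m: "radon_full m" and f: "Cc f" shows "integrable m f"
proof -
  define S where "S = closure {x. f x \<noteq> 0}"
  have sets: "sets m = sets borel" using m by (simp add: radon_full_def)
  have S: "compact S" "continuous_on UNIV f" using f by (auto simp: Cc_def S_def)
  have "compact (f ` S)" using S by (intro compact_continuous_image) (auto intro: continuous_on_subset)
  then obtain B where B: "\<And>x. x \<in> S \<Longrightarrow> \<bar>f x\<bar> \<le> B" using compact_imp_bounded by (fastforce simp: bounded_iff)
  have meas: "f \<in> borel_measurable m"
    using borel_measurable_continuous_onI[OF S(2)] sets by (simp cong: measurable_cong_sets)
  have Sm: "S \<in> sets m" unfolding sets S_def by simp
  have z: "f x = 0" if "x \<notin> S" for x using that closure_subset[of "{x. f x \<noteq> 0}"] by (auto simp: S_def)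
  have "integrable m (\<lambda>x. indicat_real S x *\<^sub>R B)"
    using m S Sm by (intro integrable_scaleR_left integrable_real_indicator) (auto simp: radon_full_def)
  then show ?thesis
  proof (rule Bochner_Integration.integrable_bound[OF _ meas], intro AE_I2)
    fix x
    show "norm (f x) \<le> norm (indicat_real S x *\<^sub>R B)"
      using B[of x] z[of x] by (cases "x \<in> S") auto
  qed
qed

locale regular_strong_dirichlet = strong_dirichlet +
  assumes radon: "radon_full m" and regular: "regular_form m \<E> D"
begin

text \<open>The set \<open>P\<close> of admissible \<open>y\<close> is midpoint convex and closed
  for \<open>H.N\<close>, hence weakly closed. It contains resolvents of integrable functions in L2,
  so by \<open>resolvent_approximation\<close> also every integrable element of \<open>D\<close>,
  and these are dense by regularity.\<close>

lemma bounded_vanishing: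
  assumes v: "\<And>k. v k \<in> D" "\<And>k. F.N (v k) \<le> M" "\<And>k. AE x in m. \<bar>v k x\<bar> \<le> C"
    and lim: "AE x in m. (\<lambda>k. v k x) \<longlonglongrightarrow> 0" and y: "y \<in> D"
  shows "(\<lambda>k. \<E> y (v k)) \<longlonglongrightarrow> 0"
proof -
  obtain K where K: "K \<ge> 0" "\<And>u v. u \<in> D \<Longrightarrow> v \<in> D \<Longrightarrow> \<bar>\<E> u v\<bar> \<le> K * F.N u * F.N v"
    using sector_bound by blast
  have M: "M \<ge> 0" using v(2)[of 0] F.N_nonneg[OF v(1), of 0] by simp
  define P where "P = {y \<in> D. (\<lambda>k. \<E> y (v k)) \<longlonglongrightarrow> 0}"
  have mid: "(\<lambda>x. (a x + b x) / 2) \<in> P" if "a \<in> P" "b \<in> P" for a b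
  proof -
    have "(\<lambda>k. (\<E> a (v k) + \<E> b (v k)) / 2) \<longlonglongrightarrow> (0 + 0) / 2"
      using that by (intro tendsto_intros) (auto simp: P_def)
    then show ?thesis using that v(1) by (simp add: P_def F.mid_mem F.mid_left)
  qed
  have closed: "u \<in> P" if u: "u \<in> D" and ap: "\<And>e. e > 0 \<Longrightarrow> \<exists>c\<in>P. H.N (\<lambda>x. u x - c x) < e" for u
  proof -
    have "(\<lambda>k. \<E> u (v k)) \<longlonglongrightarrow> 0"
    proof (rule LIMSEQ_I)
      fix r :: real assume r: "r > 0"
      have p: "K * M + 1 > 0" using K M by (simp add: add_nonneg_pos)
      then obtain c where c: "c \<in> P" "H.N (\<lambda>x. u x - c x) < r / 2 / (K * M + 1)"
        using ap[of "r / 2 / (K * M + 1)"] r by auto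
      have cD: "c \<in> D" using c by (simp add: P_def)
      have "(\<lambda>k. \<bar>\<E> c (v k)\<bar>) \<longlonglongrightarrow> 0"
        using c(1) unfolding P_def by (intro tendsto_rabs_zero) simp
      then have "\<forall>\<^sub>F k in sequentially. \<bar>\<E> c (v k)\<bar> < r / 2"
        by (rule order_tendstoD) (use r in simp)
      then obtain k0 where k0: "\<And>k. k \<ge> k0 \<Longrightarrow> \<bar>\<E> c (v k)\<bar> < r / 2"
        unfolding eventually_sequentially by blast
      have "\<bar>\<E> (\<lambda>x. u x - c x) (v k)\<bar> \<le> r / 2" for k
      proof -
        let ?d = "H.N (\<lambda>x. u x - c x)"
        have d: "(\<lambda>x. u x - c x) \<in> D" by (intro F.diff_mem u cD)
        have "\<bar>\<E> (\<lambda>x. u x - c x) (v k)\<bar> \<le> K * ?d * M"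
          by (rule order_trans[OF K(2)[OF d v(1)]])
            (intro mult_mono mult_left_mono FN_le_HN d v K mult_nonneg_nonneg F.N_nonneg H.N_nonneg order_refl)
        also have "\<dots> \<le> (K * M + 1) * ?d"
          using H.N_nonneg[OF d] by (simp add: algebra_simps)
        also have "\<dots> \<le> (K * M + 1) * (r / 2 / (K * M + 1))"
          using c(2) p by (intro mult_left_mono) auto
        also have "\<dots> = r / 2" using p by (simp add: field_simps)
        finally show ?thesis .
      qed
      moreover have "\<bar>\<E> u (v k)\<bar> \<le> \<bar>\<E> (\<lambda>x. u x - c x) (v k)\<bar> + \<bar>\<E> c (v k)\<bar>" for k
        using F.diff_left[OF u cD v(1), of k] by linarith
      ultimately have "\<bar>\<E> u (v k)\<bar> < r / 2 + r / 2" if "k \<ge> k0" for k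
        using k0[OF that] by (meson add_le_less_mono le_less_trans)
      then have "norm (\<E> u (v k) - 0) < r" if "k \<ge> k0" for k using that by simp
      then show "\<exists>k0. \<forall>k\<ge>k0. norm (\<E> u (v k) - 0) < r" by blast
    qed
    then show ?thesis using u by (simp add: P_def)
  qed
  have closed': "u \<in> P" if "\<And>n. c n \<in> P" "u \<in> D" "(\<lambda>n. H.N (\<lambda>x. c n x - u x)) \<longlonglongrightarrow> 0" for c u
  proof (rule closed[OF that(2)])
    fix e :: real assume "e > 0"
    with that(3) have "\<forall>\<^sub>F n in sequentially. H.N (\<lambda>x. c n x - u x) < e" by (rule order_tendstoD)
    then obtain n where "H.N (\<lambda>x. c n x - u x) < e" unfolding eventually_sequentially by blast
    then show "\<exists>c\<in>P. H.N (\<lambda>x. u x - c x) < e"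
      using that(1)[of n] H.N_minus_commute[of "c n" u] that(2) by (intro bexI[of _ "c n"]) (auto simp: P_def)
  qed
  have int: "w \<in> P" if w: "w \<in> D" "integrable m w" for w
  proof -
    have scaled: "(\<lambda>x. real (Suc n) * w x) \<in> L2 m" "integrable m (\<lambda>x. real (Suc n) * w x)" for n
      using L.scale_mem[OF D_L2[OF w(1)], of "real (Suc n)"] w(2) by (simp_all del: of_nat_Suc)
    have "\<exists>z. resolvent m \<E> D (real (Suc n)) (\<lambda>x. real (Suc n) * w x) z" for n
      by (intro resolvent_exists scaled) simp
    then obtain z where z: "\<And>n. resolvent m \<E> D (real (Suc n)) (\<lambda>x. real (Suc n) * w x) (z n)" by metis
    have zP: "z n \<in> P" for n
    proof -
      have "(\<lambda>k. \<E> (z n) (v k)) \<longlonglongrightarrow> 0"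
        by (rule bounded_vanishing_resolvent[OF _ scaled z v(1,3) lim]) simp
      then show ?thesis using z[of n] by (simp add: P_def resolvent_def)
    qed
    obtain B where B: "\<And>n. H.N (z n) \<le> B" using resolvent_approximation(2)[of w z, OF w(1) z] by blast
    show ?thesis
    proof (rule weak_limit_closed[of P z B w])
      show "P \<subseteq> D" by (auto simp: P_def)
      show "(\<lambda>n. L.N (\<lambda>x. z n x - w x)) \<longlonglongrightarrow> 0" by (rule resolvent_approximation(1)[of w z, OF w(1) z])
      show "w \<in> L2 m" by (rule D_L2[OF w(1)])
    qed (fact mid closed' zP B)+
  qed
  have "y \<in> P"
  proof (rule closed[OF y])
    fix e :: real assume e: "e > 0"
    then have "e\<^sup>2 > 0" by simp
    then obtain w where w: "w \<in> D" "Cc w" "E1 m \<E> (\<lambda>x. y x - w x) (\<lambda>x. y x - w x) < e\<^sup>2"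
      using regular y unfolding regular_form_def by blast
    have "H.N (\<lambda>x. y x - w x) < e" using w(3) e unfolding H.N_def by (intro real_less_lsqrt) auto
    moreover have "w \<in> P" by (intro int w radon_Cc_integrable[OF radon])
    ultimately show "\<exists>c\<in>P. H.N (\<lambda>x. y x - c x) < e" by blast
  qed
  then show ?thesis by (simp add: P_def)
qed

text \<open>Truncation at a level \<open>a\<close> reduces the claim to uniformly bounded functions.\<close>

lemma F_Fatou:
  "\<exists>K\<ge>0. \<forall>y w c. y \<in> D \<and> (\<forall>k. w k \<in> D \<and> F.N (w k) \<le> c) \<and> (AE x in m. (\<lambda>k. w k x) \<longlonglongrightarrow> y x)
     \<longrightarrow> F.N y \<le> K * c"
proof -
  obtain K where K: "K \<ge> 0" "\<And>u v. u \<in> D \<Longrightarrow> v \<in> D \<Longrightarrow> \<bar>\<E> u v\<bar> \<le> K * F.N u * F.N v"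
    using sector_bound by blast
  have main: "F.N y \<le> (2 * K) * c" if y: "y \<in> D" and w: "\<And>k. w k \<in> D" "\<And>k. F.N (w k) \<le> c"
    and lim: "AE x in m. (\<lambda>k. w k x) \<longlonglongrightarrow> y x" for y w c
  proof -
    have c0: "c \<ge> 0" using w(2)[of 0] F.N_nonneg[OF w(1), of 0] by simp
    have trunc: "F.N (\<lambda>x. Tk a (y x)) \<le> (2 * K) * c" if a: "a > 0" for a
    proof -
      define T where "T u = (\<lambda>x. Tk a (u x))" for u :: "'a \<Rightarrow> real"
      have T: "T u \<in> D" if "u \<in> D" for u using Tk_mem[OF that a] by (simp add: T_def)
      define v where "v k = (\<lambda>x. T (w k) x - T y x)" for k
      have v: "v k \<in> D" for k unfolding v_def by (intro F.diff_mem T w y)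
      have lim0: "(\<lambda>k. \<E> (T y) (v k)) \<longlonglongrightarrow> 0"
      proof (rule bounded_vanishing[OF v _ _ _ T[OF y]])
        show "F.N (v k) \<le> 2 * c + F.N (T y)" for k
          using F.N_triangle_diff[OF T[OF w(1)] T[OF y], of k] Tk_contraction[OF w(1) a, of k] w(2)[of k]
          unfolding v_def T_def by linarith
        show "AE x in m. \<bar>v k x\<bar> \<le> 2 * a" for k
          using a by (intro AE_I2) (auto simp: v_def T_def Tk_def)
        show "AE x in m. (\<lambda>k. v k x) \<longlonglongrightarrow> 0"
          using lim
        proof eventually_elim
          case (elim x)
          have "(\<lambda>k. v k x) \<longlonglongrightarrow> Tk a (y x) - Tk a (y x)"
            unfolding v_def T_def Tk_def by (intro tendsto_intros elim)
          then show ?case by simp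
        qed
      qed
      \<comment> \<open>\<open>K\<close> is the sector constant and 2 comes from
        \<open>Tk_contraction\<close>. The remainder \<open>\<E> (T y) (v k)\<close> vanishes as k
        grows, and one factor \<open>F.N (T y)\<close> can then be cancelled.\<close>
      have est: "F.N (T y) * F.N (T y) \<le> (2 * K) * c * F.N (T y) + \<bar>\<E> (T y) (v k)\<bar>" for k
      proof -
        have "F.N (T y) * F.N (T y) = \<E> (T y) (T (w k)) - \<E> (T y) (v k)"
          unfolding v_def F.diff_right[OF T[OF w(1)] T[OF y] T[OF y]]
          using F.N_sq[OF T[OF y]] by (simp add: power2_eq_square)
        moreover have "\<E> (T y) (T (w k)) \<le> K * F.N (T y) * (2 * c)"
        proof -
          have "F.N (T (w k)) \<le> 2 * c" using Tk_contraction[OF w(1) a, of k] w(2)[of k] by (simp add: T_def)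
          then have "K * F.N (T y) * F.N (T (w k)) \<le> K * F.N (T y) * (2 * c)"
            using K(1) F.N_nonneg[OF T[OF y]] by (intro mult_left_mono) auto
          then show ?thesis using K(2)[OF T[OF y] T[OF w(1)], of k] by linarith
        qed
        ultimately show ?thesis by (simp add: mult_ac)
      qed
      have "F.N (T y) * F.N (T y) \<le> (2 * K) * c * F.N (T y) + 0"
      proof (rule LIMSEQ_le_const)
        show "(\<lambda>k. (2 * K) * c * F.N (T y) + \<bar>\<E> (T y) (v k)\<bar>) \<longlonglongrightarrow> (2 * K) * c * F.N (T y) + 0"
          by (intro tendsto_intros tendsto_rabs_zero lim0)
      qed (use est in blast)
      then show ?thesis using F.N_nonneg[OF T[OF y]] K(1) c0
        unfolding T_def[symmetric] by (cases "F.N (T y) = 0") auto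
    qed
    \<comment> \<open>The bound for truncations does not depend on the level; as the levels grow,
      \<open>t n\<close> tends to \<open>y\<close> in L2 and lower semicontinuity carries the bound
      over.\<close>
    define t where "t n = (\<lambda>x. Tk (real (Suc n)) (y x))" for n
    have tD: "t n \<in> D" for n unfolding t_def by (rule Tk_mem[OF y]) simp
    have ty: "\<bar>t n x\<bar> \<le> \<bar>y x\<bar>" for n x by (auto simp: t_def Tk_def)
    have lim: "(\<lambda>n. t n x) \<longlonglongrightarrow> y x" for x
    proof (rule tendsto_eventually)
      obtain n0 where "\<bar>y x\<bar> \<le> real n0" using real_arch_simple by blast
      then show "\<forall>\<^sub>F n in sequentially. t n x = y x"
        unfolding eventually_sequentially t_def Tk_def by (intro exI[of _ n0]) auto
    qed
    have L: "(\<lambda>n. L.N (\<lambda>x. t n x - y x)) \<longlonglongrightarrow> 0"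
      using D_meas[OF y] D_meas[OF tD]
      by (intro L2_dominated(2)[OF D_L2[OF y], of t]; simp add: ty lim)
    have HM: "H.N (t n) \<le> (2 * K) * c + L.N y" for n
      using HN_le[OF tD, of n] LN_mono[OF D_L2[OF y] D_meas[OF tD], of n] ty trunc[of "real (Suc n)"]
      unfolding t_def by fastforce
    show "F.N y \<le> (2 * K) * c"
      by (rule weak_limit_F_le(2)[OF tD HM D_L2[OF y] L]) (simp add: t_def trunc del: of_nat_Suc)
  qed
  show ?thesis
  proof (intro exI[of _ "2 * K"] conjI allI impI)
    fix y w c
    assume *: "y \<in> D \<and> (\<forall>k. w k \<in> D \<and> F.N (w k) \<le> c) \<and> (AE x in m. (\<lambda>k. w k x) \<longlonglongrightarrow> y x)"
    show "F.N y \<le> (2 * K) * c" by (rule main[of y w]) (use * in auto)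
  qed (use K(1) in simp)
qed

text \<open>For fixed n, the differences of \<open>z n\<close> and later members tend to
  \<open>z n\<close> almost everywhere and are small in the form, so \<open>F_Fatou\<close> makes
  \<open>z n\<close> itself small. A Fatou estimate up to the constant K suffices for this.\<close>

lemma closability:
  assumes z: "\<And>n. z n \<in> D" "F.Cauchy_in z" and lim: "AE x in m. (\<lambda>n. z n x) \<longlonglongrightarrow> 0"
  shows "(\<lambda>n. F.N (z n)) \<longlonglongrightarrow> 0"
proof (rule LIMSEQ_I)
  fix r :: real assume r: "r > 0"
  obtain K where K: "K \<ge> 0" "\<And>y w c. y \<in> D \<Longrightarrow> (\<forall>k. w k \<in> D \<and> F.N (w k) \<le> c) \<Longrightarrow>
      (AE x in m. (\<lambda>k. w k x) \<longlonglongrightarrow> y x) \<Longrightarrow> F.N y \<le> K * c"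
    using F_Fatou by blast
  define e where "e = r / (K + 1)"
  have e: "e > 0" "K * e < r" using r K(1) by (auto simp: e_def field_simps)
  obtain n0 where n0: "\<And>n k. n \<ge> n0 \<Longrightarrow> k \<ge> n0 \<Longrightarrow> F.N (\<lambda>x. z n x - z k x) < e"
    using F.Cauchy_in_N[OF z(2) e(1)] by blast
  have "norm (F.N (z n) - 0) < r" if n: "n \<ge> n0" for n
  proof -
    have "F.N (z n) \<le> K * e"
    proof (rule K(2)[OF z(1), of "\<lambda>k x. z n x - z (k + n0) x"])
      show "\<forall>k. (\<lambda>x. z n x - z (k + n0) x) \<in> D \<and> F.N (\<lambda>x. z n x - z (k + n0) x) \<le> e"
        using n0[OF n] F.diff_mem[OF z(1) z(1)] by (simp add: less_imp_le)
      show "AE x in m. (\<lambda>k. z n x - z (k + n0) x) \<longlonglongrightarrow> z n x"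
        using lim
      proof eventually_elim
        case (elim x)
        have "(\<lambda>k. z n x - z (k + n0) x) \<longlonglongrightarrow> z n x - 0"
          by (intro tendsto_diff tendsto_const LIMSEQ_ignore_initial_segment elim)
        then show ?case by simp
      qed
    qed
    then show ?thesis using e(2) F.N_nonneg[OF z(1), of n] by simp
  qed
  then show "\<exists>n0. \<forall>n\<ge>n0. norm (F.N (z n) - 0) < r" by blast
qed

end

section \<open>Transience as a weighted integral bound\<close>

context strong_dirichlet begin

text \<open>Transience with right-hand side 1 gives one finite function above every
  \<open>G\<^sub>\<alpha> g\<close>, \<open>\<alpha> = 1 / l\<close>,
  \<open>0 \<le> g \<le> 1\<close>. Choosing \<open>g\<close> small where it is large keeps
  \<open>\<integral> g G\<^sub>\<alpha> g\<close> bounded in l. This bounds the energy of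
  \<open>G\<^sub>\<alpha> g\<close>, and the sector condition bounds the pairing with
  \<open>v\<close>.\<close>

lemma transient_bound:
  assumes sf: "sigma_finite_measure m" and tr: "transient m \<E> D"
  shows "\<exists>g C. g \<in> borel_measurable m \<and> (\<forall>x\<in>space m. 0 < g x) \<and> integrable m g \<and>
    (\<forall>v\<in>D. integrable m (\<lambda>x. g x * v x) \<and> (\<integral>x. g x * v x \<partial>m) \<le> C * F.N v)"
proof -
  obtain K where K: "K \<ge> 0" "\<And>u v. u \<in> D \<Longrightarrow> v \<in> D \<Longrightarrow> \<bar>\<E> u v\<bar> \<le> K * F.N u * F.N v"
    using sector_bound by blast
  obtain h :: "'a \<Rightarrow> real" where h: "h \<in> borel_measurable m" "\<And>x. 0 < h x" "\<And>x. h x \<le> 1" "integrable m h"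
    using sigma_finite_measure.obtain_positive_integrable_function[OF sf] by metis
  have one: "(\<lambda>x::'a. 1::real) \<in> borel_measurable m \<and> (AE x in m. 0 \<le> (1::real)) \<and> (\<exists>C::real. AE x in m. 1 \<le> C)"
    by auto
  obtain F :: "'a \<Rightarrow> ennreal" where F: "F \<in> borel_measurable m" "AE x in m. F x < \<infinity>"
    "\<And>l g w. l \<ge> 1 \<Longrightarrow> g \<in> L2 m \<Longrightarrow> AE x in m. 0 \<le> g x \<and> g x \<le> 1 \<Longrightarrow>
       resolvent m \<E> D (1 / real l) g w \<Longrightarrow> AE x in m. ennreal (w x) \<le> F x"
    using tr[unfolded transient_def, rule_format, OF one] by blast
  define G where "G x = enn2real (F x)" for x
  have G: "G \<in> borel_measurable m" "\<And>x. 0 \<le> G x" using F(1) unfolding G_def[abs_def] by simp_all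
  \<comment> \<open>The denominator secures \<open>g x * G x \<le> h x\<close>, while
    \<open>g x \<le> h x \<le> 1\<close> keeps \<open>g\<close> among the right-hand sides that
    \<open>F\<close> controls.\<close>
  define g where "g x = h x / (1 + G x)" for x
  have g: "g \<in> borel_measurable m" using h(1) G(1) unfolding g_def by measurable
  have g_pos: "0 < g x" and g_h: "g x \<le> h x" and gG: "g x * G x \<le> h x" for x
    using h(2)[of x] G(2)[of x] by (auto simp: g_def field_simps add_pos_nonneg)
  have g1: "g x \<le> 1" for x using g_h h(3) order_trans by blast
  have gi: "integrable m g"
    by (rule Bochner_Integration.integrable_bound[OF h(4) g], rule AE_I2)
       (simp add: abs_of_pos g_pos h(2) g_h)
  have g2: "g \<in> L2 m"
  proof -
    have "integrable m (\<lambda>x. (g x)\<^sup>2)"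
    proof (rule Bochner_Integration.integrable_bound[OF gi], use g in measurable, intro AE_I2)
      fix x show "norm ((g x)\<^sup>2) \<le> norm (g x)"
        using g_pos[of x] g1[of x] by (simp add: power2_eq_square mult_left_le)
    qed
    then show ?thesis using g by (simp add: L2_def)
  qed
  define I where "I = (\<integral>x. h x \<partial>m)"
  have I: "I \<ge> 0" unfolding I_def using h(2) by (intro integral_nonneg_AE) (auto simp: less_imp_le)
  have bound: "(\<integral>x. g x * v x \<partial>m) \<le> K * sqrt I * F.N v + sqrt (I / real (Suc n)) * L.N v"
    if v: "v \<in> D" for v n
  proof -
    define \<alpha> where "\<alpha> = 1 / real (Suc n)"
    have \<alpha>: "\<alpha> > 0" by (simp add: \<alpha>_def)
    obtain w where w: "resolvent m \<E> D \<alpha> g w" using resolvent_exists[OF \<alpha> g2] by blast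
    have wD: "w \<in> D" and res: "\<And>v. v \<in> D \<Longrightarrow> \<E> w v + \<alpha> * (\<integral>x. w x * v x \<partial>m) = (\<integral>x. g x * v x \<partial>m)"
      using w by (auto simp: resolvent_def)
    have "AE x in m. ennreal (w x) \<le> F x"
      using g_pos g1 w unfolding \<alpha>_def by (intro F(3)[of "Suc n" g] g2) (auto simp: less_imp_le)
    with F(2) have "AE x in m. g x * w x \<le> h x"
    proof eventually_elim
      case (elim x)
      have "F x = ennreal (G x)" unfolding G_def using elim by simp
      then have "w x \<le> G x" using elim G(2)[of x] by simp
      then have "g x * w x \<le> g x * G x" using g_pos[of x] by simp
      then show ?case using gG[of x] by linarith
    qed
    then have "(\<integral>x. g x * w x \<partial>m) \<le> I"
      unfolding I_def by (intro integral_mono_AE L2_mult_integrable g2 D_L2 wD h)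
    then have E: "(F.N w)\<^sup>2 + \<alpha> * (L.N w)\<^sup>2 \<le> I"
      using res[OF wD] by (simp add: F.N_sq[OF wD] L.N_sq[OF D_L2[OF wD]])
    have nn: "0 \<le> \<alpha> * (L.N w)\<^sup>2" using \<alpha> by simp
    have Fw: "F.N w \<le> sqrt I" using E nn by (intro real_le_rsqrt) linarith
    have "\<alpha> * L.N w \<le> sqrt (I * \<alpha>)"
    proof (rule real_le_rsqrt)
      have "\<alpha> * (L.N w)\<^sup>2 \<le> I" using E zero_le_power2[of "F.N w"] by linarith
      then show "(\<alpha> * L.N w)\<^sup>2 \<le> I * \<alpha>" using \<alpha> by (simp add: power2_eq_square mult_ac)
    qed
    then have Lw: "\<alpha> * L.N w \<le> sqrt (I / real (Suc n))" by (simp add: \<alpha>_def)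
    have "(\<integral>x. g x * v x \<partial>m) \<le> K * F.N w * F.N v + \<alpha> * (L.N w * L.N v)"
      using res[OF v] K(2)[OF wD v] mult_left_mono[OF L_Cauchy_Schwarz[OF D_L2 D_L2, OF wD v], of \<alpha>] \<alpha>
        mult_left_mono[OF abs_ge_self[of "\<integral>x. w x * v x \<partial>m"], of \<alpha>] by linarith
    also have "\<dots> \<le> K * sqrt I * F.N v + sqrt (I / real (Suc n)) * L.N v"
      unfolding mult.assoc[symmetric]
      using Fw Lw K(1) F.N_nonneg[OF v] L.N_nonneg[OF D_L2[OF v]]
      by (intro add_mono mult_right_mono mult_left_mono) auto
    finally show ?thesis .
  qed
  \<comment> \<open>The L2 term must be eliminated, since the L2 norm is not controlled along
    sequences that are Cauchy only for the form.\<close>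
  have "(\<integral>x. g x * v x \<partial>m) \<le> K * sqrt I * F.N v" if v: "v \<in> D" for v
  proof (rule LIMSEQ_le_const)
    have "(\<lambda>n. I / real (Suc n)) \<longlonglongrightarrow> 0" using LIMSEQ_Suc[OF lim_const_over_n[of I]] by simp
    from tendsto_real_sqrt[OF this] have "(\<lambda>n. sqrt (I / real (Suc n))) \<longlonglongrightarrow> 0" by simp
    then have "(\<lambda>n. K * sqrt I * F.N v + sqrt (I / real (Suc n)) * L.N v) \<longlonglongrightarrow> K * sqrt I * F.N v + 0 * L.N v"
      by (intro tendsto_intros)
    then show "(\<lambda>n. K * sqrt I * F.N v + sqrt (I / real (Suc n)) * L.N v) \<longlonglongrightarrow> K * sqrt I * F.N v"
      by simp
  qed (use bound[OF v] in blast)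
  moreover have "integrable m (\<lambda>x. g x * v x)" if "v \<in> D" for v
    by (intro L2_mult_integrable g2 D_L2 that)
  ultimately show ?thesis using g g_pos gi by blast
qed

end

section \<open>The extended Dirichlet space\<close>

context regular_strong_dirichlet begin

lemma Cauchy_bounded_vanishing:
  assumes w: "\<And>n. w n \<in> D" "F.Cauchy_in w"
    and v: "\<And>k. v k \<in> D" "\<And>k. F.N (v k) \<le> M" "\<And>k. AE x in m. \<bar>v k x\<bar> \<le> C"
    and lim: "AE x in m. (\<lambda>k. v k x) \<longlonglongrightarrow> 0"
  shows "(\<lambda>n. \<E> (w n) (v n)) \<longlonglongrightarrow> 0"
proof (rule LIMSEQ_I)
  fix r :: real assume r: "r > 0"
  obtain K where K: "K \<ge> 0" "\<And>u v. u \<in> D \<Longrightarrow> v \<in> D \<Longrightarrow> \<bar>\<E> u v\<bar> \<le> K * F.N u * F.N v"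
    using sector_bound by blast
  have M: "M \<ge> 0" using v(2)[of 0] F.N_nonneg[OF v(1), of 0] by simp
  have p: "K * M + 1 > 0" using K M by (simp add: add_nonneg_pos)
  define s where "s = r / 2"
  define e where "e = s / (K * M + 1)"
  have e: "e > 0" "e * (K * M + 1) = r / 2" using p r by (simp_all add: e_def s_def[symmetric]) (simp add: s_def)
  obtain n0 where n0: "\<And>n. n \<ge> n0 \<Longrightarrow> F.N (\<lambda>x. w n x - w n0 x) < e"
    using F.Cauchy_in_N[OF w(2) e(1)] by blast
  have "(\<lambda>k. \<bar>\<E> (w n0) (v k)\<bar>) \<longlonglongrightarrow> 0"
    by (intro tendsto_rabs_zero bounded_vanishing[OF v lim w(1)])
  then have "\<forall>\<^sub>F k in sequentially. \<bar>\<E> (w n0) (v k)\<bar> < r / 2"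
    by (rule order_tendstoD) (use r in simp)
  then obtain k0 where k0: "\<And>k. k \<ge> k0 \<Longrightarrow> \<bar>\<E> (w n0) (v k)\<bar> < r / 2"
    unfolding eventually_sequentially by blast
  have "norm (\<E> (w n) (v n) - 0) < r" if n: "n \<ge> max n0 k0" for n
  proof -
    let ?d = "\<lambda>x. w n x - w n0 x"
    have d: "?d \<in> D" by (intro F.diff_mem w)
    have "K * F.N ?d * F.N (v n) \<le> K * e * M"
      using n0[of n] n e(1) K(1)
      by (intro mult_mono mult_left_mono v mult_nonneg_nonneg F.N_nonneg d) auto
    also have "\<dots> \<le> r / 2" using e by (simp add: algebra_simps)
    finally have "\<bar>\<E> ?d (v n)\<bar> \<le> r / 2" using K(2)[OF d v(1), of n] by linarith
    moreover have "\<E> (w n) (v n) = \<E> ?d (v n) + \<E> (w n0) (v n)"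
      using F.diff_left[OF w(1) w(1) v(1)] by simp
    moreover have "\<bar>\<E> (w n0) (v n)\<bar> < r / 2" using k0 n by simp
    ultimately show ?thesis unfolding real_norm_def diff_0_right by linarith
  qed
  then show "\<exists>n0. \<forall>n\<ge>n0. norm (\<E> (w n) (v n) - 0) < r" by blast
qed

lemma \<E>_Cauchy_convergent:
  assumes a: "\<And>n. a n \<in> D" "F.Cauchy_in a" and b: "\<And>n. b n \<in> D" "F.Cauchy_in b"
  shows "convergent (\<lambda>n. \<E> (a n) (b n))"
proof (rule Cauchy_convergent, rule metric_CauchyI)
  fix r :: real assume r: "r > 0"
  obtain K where K: "K \<ge> 0" "\<And>u v. u \<in> D \<Longrightarrow> v \<in> D \<Longrightarrow> \<bar>\<E> u v\<bar> \<le> K * F.N u * F.N v"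
    using sector_bound by blast
  obtain A where A: "A \<ge> 0" "\<And>n. F.N (a n) \<le> A" using F.Cauchy_in_bounded[of a, OF a] by blast
  obtain B where B: "B \<ge> 0" "\<And>n. F.N (b n) \<le> B" using F.Cauchy_in_bounded[of b, OF b] by blast
  define e where "e = r / (K * (A + B) + 1)"
  have p: "K * (A + B) + 1 > 0" using K A B by (simp add: add_nonneg_pos)
  have e: "e > 0" "e * (K * (A + B) + 1) = r" using p r by (simp_all add: e_def)
  obtain n1 where n1: "\<And>n k. n \<ge> n1 \<Longrightarrow> k \<ge> n1 \<Longrightarrow> F.N (\<lambda>x. a n x - a k x) < e"
    using F.Cauchy_in_N[OF a(2) e(1)] by blast
  obtain n2 where n2: "\<And>n k. n \<ge> n2 \<Longrightarrow> k \<ge> n2 \<Longrightarrow> F.N (\<lambda>x. b n x - b k x) < e"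
    using F.Cauchy_in_N[OF b(2) e(1)] by blast
  have "dist (\<E> (a n) (b n)) (\<E> (a k) (b k)) < r" if nk: "n \<ge> max n1 n2" "k \<ge> max n1 n2" for n k
  proof -
    let ?a = "\<lambda>x. a n x - a k x" and ?b = "\<lambda>x. b n x - b k x"
    have D: "?a \<in> D" "?b \<in> D" by (intro F.diff_mem a b)+
    have "K * F.N ?a * F.N (b n) \<le> K * e * B"
      using n1[of n k] nk e(1) K(1)
      by (intro mult_mono mult_left_mono B mult_nonneg_nonneg F.N_nonneg b) auto
    then have 1: "\<bar>\<E> ?a (b n)\<bar> \<le> K * e * B" using K(2)[OF D(1) b(1), of n] by linarith
    have "K * F.N (a k) * F.N ?b \<le> K * A * e"
      using n2[of n k] nk e(1) K(1) A(1)
      by (intro mult_mono mult_left_mono A mult_nonneg_nonneg F.N_nonneg D) auto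
    then have 2: "\<bar>\<E> (a k) ?b\<bar> \<le> K * A * e" using K(2)[OF a(1) D(2), of k] by linarith
    have "\<E> (a n) (b n) - \<E> (a k) (b k) = \<E> ?a (b n) + \<E> (a k) ?b"
      by (simp add: F.lin a b)
    moreover have "K * e * B + K * A * e < r" using e by (simp add: algebra_simps)
    ultimately show ?thesis using 1 2 unfolding dist_real_def by linarith
  qed
  then show "\<exists>n0. \<forall>n\<ge>n0. \<forall>k\<ge>n0. dist (\<E> (a n) (b n)) (\<E> (a k) (b k)) < r" by blast
qed

lemma approx_seqD:
  assumes "approx_seq m \<E> D u a"
  shows "a n \<in> D" "F.Cauchy_in a" "AE x in m. (\<lambda>n. a n x) \<longlonglongrightarrow> u x"
  using assms unfolding approx_seq_def F.Cauchy_in_def by blast+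

lemma ext_spaceE:
  "u \<in> ext_space m \<E> D \<Longrightarrow> approx_seq m \<E> D u (SOME a. approx_seq m \<E> D u a)"
  using someI_ex[of "approx_seq m \<E> D u"] by (simp add: ext_space_def)

text \<open>\<open>ext_form\<close> is a \<open>lim\<close> along chosen sequences and says
  something only once these are known to converge. Independence of the choice is recovered from
  \<open>closability\<close> where another sequence has to be used.\<close>

lemma ext_form_tendsto:
  assumes "u \<in> ext_space m \<E> D" "v \<in> ext_space m \<E> D"
  shows "(\<lambda>n. \<E> ((SOME a. approx_seq m \<E> D u a) n) ((SOME b. approx_seq m \<E> D v b) n))
    \<longlonglongrightarrow> ext_form m \<E> D u v"
proof -
  note a = approx_seqD[OF ext_spaceE[OF assms(1)]] and b = approx_seqD[OF ext_spaceE[OF assms(2)]]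
  show ?thesis unfolding ext_form_def convergent_LIMSEQ_iff[symmetric]
    by (rule \<E>_Cauchy_convergent[OF a(1,2) b(1,2)])
qed

text \<open>The unit contractions of an approximating sequence of \<open>U\<^sub>1 - U\<^sub>2\<close> are not known to be Cauchy
  with respect to the form. Midpoint combinations of them are, and the difference, being bounded
  and vanishing almost everywhere, disappears in the limit.\<close>

lemma ext_clip:
  assumes U: "U1 \<in> ext_space m \<E> D" "U2 \<in> ext_space m \<E> D"
  defines "v \<equiv> \<lambda>x. clip (U1 x - U2 x)"
  shows "v \<in> ext_space m \<E> D"
    and "\<exists>z e. (\<forall>n. z n \<in> D) \<and> (\<forall>n x. 0 \<le> z n x \<and> z n x \<le> 1) \<and> (AE x in m. (\<lambda>n. z n x) \<longlonglongrightarrow> v x) \<and>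
      e \<longlonglongrightarrow> ext_form m \<E> D U1 v - ext_form m \<E> D U2 v \<and> (\<forall>n. (F.N (z n))\<^sup>2 \<le> e n)"
proof -
  define a1 where "a1 = (SOME a. approx_seq m \<E> D U1 a)"
  define a2 where "a2 = (SOME a. approx_seq m \<E> D U2 a)"
  have a1: "approx_seq m \<E> D U1 a1" and a2: "approx_seq m \<E> D U2 a2"
    unfolding a1_def a2_def by (intro ext_spaceE U)+
  note aD = approx_seqD[OF a1] approx_seqD[OF a2]
  define w where "w n = (\<lambda>x. a1 n x - a2 n x)" for n
  have w: "w n \<in> D" for n unfolding w_def by (intro F.diff_mem aD)
  have wC: "F.Cauchy_in w" unfolding w_def by (intro F.Cauchy_in_diff aD)
  obtain M where M: "M \<ge> 0" "\<And>n. F.N (w n) \<le> M" using F.Cauchy_in_bounded[of w, OF w wC] by blast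
  define z where "z n = (\<lambda>x. clip (w n x))" for n
  have z: "z n \<in> D" for n unfolding z_def by (intro clip_mem w)
  have zM: "F.N (z n) \<le> M" for n using clip_contraction[OF w, of n] M(2)[of n] by (simp add: z_def)
  have z01: "0 \<le> z n x" "z n x \<le> 1" for n x by (simp_all add: z_def)
  have zv: "AE x in m. (\<lambda>n. z n x) \<longlonglongrightarrow> v x"
    using aD(3,6)
  proof eventually_elim
    case (elim x)
    then show ?case unfolding z_def v_def w_def by (intro clip_tendsto tendsto_diff)
  qed
  obtain c where c: "\<And>n. c n \<in> midhull (z ` {n..})" "F.Cauchy_in c"
    using F.midhull_Cauchy[of z, OF z zM] by auto
  have cD: "c n \<in> D" for n by (rule F.midhull_mem[OF c(1)]) (use z in blast)
  have cM: "F.N (c n) \<le> M" for n by (rule F.midhull_N_le[OF c(1)]) (use z zM in auto)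
  have c1: "\<bar>c n x - 0\<bar> \<le> 1" for n x by (rule midhull_dist[OF c(1)]) (use z01 in auto)
  have cv: "AE x in m. (\<lambda>n. c n x) \<longlonglongrightarrow> v x"
    using zv by eventually_elim (rule midhull_tendsto[OF c(1)])
  have "approx_seq m \<E> D v c"
    using cD c(2) cv unfolding approx_seq_def F.Cauchy_in_def by blast
  then show v: "v \<in> ext_space m \<E> D" unfolding ext_space_def by blast
  define b where "b = (SOME b. approx_seq m \<E> D v b)"
  have b: "approx_seq m \<E> D v b" unfolding b_def by (intro ext_spaceE v)
  note bD = approx_seqD[OF b]
  define L where "L = ext_form m \<E> D U1 v - ext_form m \<E> D U2 v"
  have "(\<lambda>n. \<E> (a1 n) (b n) - \<E> (a2 n) (b n)) \<longlonglongrightarrow> L"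
    unfolding L_def a1_def a2_def b_def by (intro tendsto_diff ext_form_tendsto U v)
  then have 1: "(\<lambda>n. \<E> (w n) (b n)) \<longlonglongrightarrow> L"
    unfolding w_def using F.diff_left[OF aD(1) aD(4) bD(1)] by simp
  define d where "d n = (\<lambda>x. b n x - c n x)" for n
  have d: "d n \<in> D" for n unfolding d_def by (intro F.diff_mem bD cD)
  \<comment> \<open>\<open>b\<close> is the sequence that \<open>ext_form\<close> happens to choose
    for \<open>v\<close>, and \<open>c\<close> the one built from the unit contractions. Both tend
    to \<open>v\<close> almost everywhere, so \<open>closability\<close> lets \<open>c\<close>
    replace \<open>b\<close>.\<close>
  have "(\<lambda>n. F.N (d n)) \<longlonglongrightarrow> 0"
  proof (rule closability[OF d])
    show "F.Cauchy_in d" unfolding d_def by (intro F.Cauchy_in_diff bD cD c)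
    show "AE x in m. (\<lambda>n. d n x) \<longlonglongrightarrow> 0"
      using bD(3) cv
    proof eventually_elim
      case (elim x)
      from tendsto_diff[OF elim] show ?case by (simp add: d_def)
    qed
  qed
  obtain K where K: "K \<ge> 0" "\<And>u v. u \<in> D \<Longrightarrow> v \<in> D \<Longrightarrow> \<bar>\<E> u v\<bar> \<le> K * F.N u * F.N v"
    using sector_bound by blast
  have 2: "(\<lambda>n. \<E> (w n) (d n)) \<longlonglongrightarrow> 0"
  proof (rule tendsto_rabs_zero_cancel, rule tendsto_sandwich[OF _ _ tendsto_const])
    show "(\<lambda>n. K * M * F.N (d n)) \<longlonglongrightarrow> 0"
      by (intro tendsto_mult_right_zero \<open>(\<lambda>n. F.N (d n)) \<longlonglongrightarrow> 0\<close>)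
    have "\<bar>\<E> (w n) (d n)\<bar> \<le> K * M * F.N (d n)" for n
      by (rule order_trans[OF K(2)[OF w d]])
         (intro mult_right_mono mult_left_mono M K F.N_nonneg d)
    then show "\<forall>\<^sub>F n in sequentially. \<bar>\<E> (w n) (d n)\<bar> \<le> K * M * F.N (d n)" by simp
  qed simp
  have 3: "(\<lambda>n. \<E> (w n) (\<lambda>x. z n x - c n x)) \<longlonglongrightarrow> 0"
  proof (rule Cauchy_bounded_vanishing[OF w wC])
    show "(\<lambda>x. z n x - c n x) \<in> D" for n by (intro F.diff_mem z cD)
    show "F.N (\<lambda>x. z n x - c n x) \<le> 2 * M" for n
      using F.N_triangle_diff[OF z cD, of n n] zM[of n] cM[of n] by simp
    show "AE x in m. \<bar>z n x - c n x\<bar> \<le> 2" for n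
    proof (rule AE_I2)
      fix x show "\<bar>z n x - c n x\<bar> \<le> 2" using z01[where n=n and x=x] c1[of n x] by linarith
    qed
    show "AE x in m. (\<lambda>n. z n x - c n x) \<longlonglongrightarrow> 0"
      using zv cv
    proof eventually_elim
      case (elim x)
      from tendsto_diff[OF elim] show ?case by simp
    qed
  qed
  \<comment> \<open>As \<open>b n - d n + (z n - c n)\<close> equals \<open>z n\<close>, this moves
    the limit from the chosen sequence to the unit contractions themselves, where
    \<open>clip_\<E>_le\<close> is available.\<close>
  have "(\<lambda>n. \<E> (w n) (b n) - \<E> (w n) (d n) + \<E> (w n) (\<lambda>x. z n x - c n x)) \<longlonglongrightarrow> L - 0 + 0"
    by (intro tendsto_intros 1 2 3)
  moreover have "\<E> (w n) (b n) - \<E> (w n) (d n) + \<E> (w n) (\<lambda>x. z n x - c n x) = \<E> (w n) (z n)" for n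
    unfolding d_def F.diff_right[OF bD(1) cD w] F.diff_right[OF z cD w] by simp
  ultimately have "(\<lambda>n. \<E> (w n) (z n)) \<longlonglongrightarrow> L" by simp
  moreover have "(F.N (z n))\<^sup>2 \<le> \<E> (w n) (z n)" for n
    using clip_\<E>_le[OF w, of n] F.N_sq[OF z, of n] by (simp add: z_def)
  ultimately show "\<exists>z e. (\<forall>n. z n \<in> D) \<and> (\<forall>n x. 0 \<le> z n x \<and> z n x \<le> 1) \<and>
      (AE x in m. (\<lambda>n. z n x) \<longlonglongrightarrow> v x) \<and>
      e \<longlonglongrightarrow> ext_form m \<E> D U1 v - ext_form m \<E> D U2 v \<and> (\<forall>n. (F.N (z n))\<^sup>2 \<le> e n)"
    using z z01 zv unfolding L_def by (intro exI[of _ z] exI[of _ "\<lambda>n. \<E> (w n) (z n)"]) blast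
qed

text \<open>The integral bound holds on \<open>D\<close>, so it is applied to the approximants. They
  lie in [0, 1] and \<open>g\<close> is integrable, so the left side converges by domination; on the
  right the energies are replaced by their convergent majorant \<open>e\<close>.\<close>

lemma ext_clip_bound:
  assumes U: "U1 \<in> ext_space m \<E> D" "U2 \<in> ext_space m \<E> D"
    and g: "integrable m g" "\<And>x. x \<in> space m \<Longrightarrow> 0 \<le> g x"
    and C: "\<And>v. v \<in> D \<Longrightarrow> (\<integral>x. g x * v x \<partial>m) \<le> C * F.N v"
    and vt: "vt \<in> borel_measurable m" "AE x in m. vt x = clip (U1 x - U2 x)"
  shows "(\<integral>x. g x * vt x \<partial>m)
    \<le> \<bar>C\<bar> * sqrt (ext_form m \<E> D U1 (\<lambda>x. clip (U1 x - U2 x)) - ext_form m \<E> D U2 (\<lambda>x. clip (U1 x - U2 x)))"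
    (is "_ \<le> \<bar>C\<bar> * sqrt ?L")
proof -
  obtain z e where z: "\<And>n. z n \<in> D" "\<And>n x. 0 \<le> z n x \<and> z n x \<le> 1"
    "AE x in m. (\<lambda>n. z n x) \<longlonglongrightarrow> clip (U1 x - U2 x)" and e: "e \<longlonglongrightarrow> ?L" "\<And>n. (F.N (z n))\<^sup>2 \<le> e n"
    using ext_clip(2)[OF U] by blast
  have "(\<lambda>n. \<integral>x. g x * z n x \<partial>m) \<longlonglongrightarrow> (\<integral>x. g x * vt x \<partial>m)"
  proof (rule integral_dominated_convergence[where w = g])
    show "AE x in m. (\<lambda>n. g x * z n x) \<longlonglongrightarrow> g x * vt x"
      using z(3) vt(2)
    proof eventually_elim
      case (elim x)
      then show ?case by (intro tendsto_mult_left) simp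
    qed
    show "AE x in m. norm (g x * z n x) \<le> g x" for n
    proof (rule AE_I2)
      fix x assume "x \<in> space m"
      then show "norm (g x * z n x) \<le> g x"
        using z(2)[of n x] g(2)[of x] by (simp add: abs_mult mult_left_le)
    qed
    show "(\<lambda>x. g x * z n x) \<in> borel_measurable m" for n using g D_meas[OF z(1)] by measurable
  qed (use g vt in auto)
  moreover have "(\<lambda>n. \<bar>C\<bar> * sqrt (e n)) \<longlonglongrightarrow> \<bar>C\<bar> * sqrt ?L" by (intro tendsto_intros e)
  moreover have "(\<integral>x. g x * z n x \<partial>m) \<le> \<bar>C\<bar> * sqrt (e n)" for n
  proof -
    have "C * F.N (z n) \<le> \<bar>C\<bar> * F.N (z n)" using F.N_nonneg[OF z(1)] by (intro mult_right_mono) auto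
    also have "\<dots> \<le> \<bar>C\<bar> * sqrt (e n)" by (intro mult_left_mono real_le_rsqrt e) auto
    finally show ?thesis using C[OF z(1), of n] by linarith
  qed
  ultimately show ?thesis by (intro LIMSEQ_le[of _ _ "\<lambda>n. \<bar>C\<bar> * sqrt (e n)"]) auto
qed

end

section \<open>Nests\<close>

lemma radon_space:
  assumes "radon_full m" shows "sets m = sets borel" "space m = UNIV"
  using assms sets_eq_imp_space_eq[of m borel] by (auto simp: radon_full_def)

text \<open>By local compactness every point has an open neighbourhood inside a compact set, hence
  of finite measure; second countability leaves countably many.\<close>

lemma radon_sigma_finite:
  fixes m :: "'a::{metric_space,second_countable_topology} measure"
  assumes lc: "locally_compact_space (euclidean :: 'a topology)" and m: "radon_full m"
  shows "sigma_finite_measure m"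
proof -
  define \<U> where "\<U> = {U::'a set. open U \<and> emeasure m U < \<infinity>}"
  have cover: "\<exists>U\<in>\<U>. x \<in> U" for x
  proof -
    have "\<exists>U K. open U \<and> compact K \<and> x \<in> U \<and> U \<subseteq> K"
      using lc unfolding locally_compact_space_def by (simp add: compactin_euclidean_iff)
    then obtain U K where UK: "open U" "compact K" "x \<in> U" "U \<subseteq> K" by (elim exE conjE)
    have "K \<in> sets m" unfolding radon_space(1)[OF m] using UK(2) by (intro borel_closed compact_imp_closed)
    then have "emeasure m U \<le> emeasure m K" by (rule emeasure_mono[OF UK(4)])
    also have "\<dots> < \<infinity>" using m UK(2) unfolding radon_full_def by blast
    finally have "U \<in> \<U>" using UK(1) by (simp add: \<U>_def)
    then show ?thesis using UK(3) by blast
  qed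
  obtain \<V> where \<V>: "\<V> \<subseteq> \<U>" "countable \<V>" "\<Union>\<V> = \<Union>\<U>"
    using Lindelof[of \<U>] unfolding \<U>_def by blast
  have "\<Union>\<V> = space m" unfolding \<V>(3) radon_space(2)[OF m] using cover by blast
  moreover have "\<V> \<subseteq> sets m" "\<forall>U\<in>\<V>. emeasure m U \<noteq> \<infinity>"
    using \<V>(1) unfolding radon_space(1)[OF m] \<U>_def by auto
  ultimately show ?thesis using \<V>(2) by unfold_locales blast
qed

context regular_strong_dirichlet begin

lemma DF_mono: "F \<subseteq> G \<Longrightarrow> u \<in> DF m D F \<Longrightarrow> u \<in> DF m D G"
  by (auto simp: DF_def elim: eventually_mono)

lemma nestD_HN:
  assumes "nest m \<E> D Fs" "u \<in> D" "e > 0"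
  shows "\<exists>k. \<exists>w\<in>DF m D (Fs k). H.N (\<lambda>x. u x - w x) < e"
proof -
  have "e\<^sup>2 > 0" using assms by simp
  then obtain k w where w: "w \<in> DF m D (Fs k)" "E1 m \<E> (\<lambda>x. u x - w x) (\<lambda>x. u x - w x) < e\<^sup>2"
    using assms(1,2) unfolding nest_def by blast
  then have "H.N (\<lambda>x. u x - w x) < e"
    unfolding H.N_def using assms(3) by (intro real_less_lsqrt) auto
  then show ?thesis using w(1) by blast
qed

lemma nestI_HN:
  assumes "incseq Fs" "\<And>k. closed (Fs k)"
    and "\<And>u e. u \<in> D \<Longrightarrow> e > 0 \<Longrightarrow> \<exists>k. \<exists>w\<in>DF m D (Fs k). H.N (\<lambda>x. u x - w x) < e"
  shows "nest m \<E> D Fs"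
  unfolding nest_def
proof (intro conjI ballI allI impI)
  fix u and e :: real assume "u \<in> D" "e > 0"
  then obtain k w where w: "w \<in> DF m D (Fs k)" "H.N (\<lambda>x. u x - w x) < sqrt e"
    using assms(3)[of u "sqrt e"] by auto
  then show "\<exists>k. \<exists>w\<in>DF m D (Fs k). E1 m \<E> (\<lambda>x. u x - w x) (\<lambda>x. u x - w x) < e"
    by (auto simp: H.N_def)
qed (use assms in auto)

text \<open>Given approximants \<open>w\<close> and \<open>w'\<close> of \<open>u\<close> along the two nests, \<open>w\<^sup>+ \<and> w'\<^sup>+ - w\<^sup>- \<and> w'\<^sup>-\<close> vanishes
  off the intersection; it converges to \<open>u\<close> only weakly, so midpoint combinations are needed.\<close>

lemma nest_Int:
  assumes F: "nest m \<E> D F" and G: "nest m \<E> D G"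
  shows "nest m \<E> D (\<lambda>k. F k \<inter> G k)"
proof (rule nestI_HN)
  have inc: "incseq F" "incseq G" using F G by (auto simp: nest_def)
  then show I: "incseq (\<lambda>k. F k \<inter> G k)" unfolding incseq_def by blast
  show "closed (F k \<inter> G k)" for k using F G by (auto simp: nest_def)
  fix u and e :: real assume u: "u \<in> D" and e: "e > 0"
  have "\<exists>k. \<exists>w\<in>DF m D (F k). H.N (\<lambda>x. u x - w x) < 1 / real (Suc n)" for n
    by (rule nestD_HN[OF F u]) simp
  then obtain k w where w: "\<And>n. w n \<in> DF m D (F (k n))" "\<And>n. H.N (\<lambda>x. u x - w n x) < 1 / real (Suc n)"
    by metis
  have "\<exists>k. \<exists>w\<in>DF m D (G k). H.N (\<lambda>x. u x - w x) < 1 / real (Suc n)" for n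
    by (rule nestD_HN[OF G u]) simp
  then obtain k' w' where w': "\<And>n. w' n \<in> DF m D (G (k' n))" "\<And>n. H.N (\<lambda>x. u x - w' n x) < 1 / real (Suc n)"
    by metis
  have wD: "w n \<in> D" "w' n \<in> D" for n using w(1)[of n] w'(1)[of n] by (auto simp: DF_def)
  define p where "p n = (\<lambda>x. min (max (w n x) 0) (max (w' n x) 0))" for n
  define q where "q n = (\<lambda>x. min (max (- w n x) 0) (max (- w' n x) 0))" for n
  define s where "s n = (\<lambda>x. p n x - q n x)" for n
  have pq: "p n \<in> D" "q n \<in> D" for n
    unfolding p_def q_def by (intro min_mem pos_part F.uminus_mem wD)+
  have sD: "s n \<in> D" for n unfolding s_def by (intro F.diff_mem pq)
  have w_le: "H.N (w n) \<le> H.N u + 1" "H.N (w' n) \<le> H.N u + 1" for n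
  proof -
    have "1 / real (Suc n) \<le> 1" by simp
    moreover have "H.N v \<le> H.N u + H.N (\<lambda>x. u x - v x)" if "v \<in> D" for v
      using H.N_triangle_sub[OF that u] H.N_minus_commute[OF that u] by simp
    ultimately show "H.N (w n) \<le> H.N u + 1" "H.N (w' n) \<le> H.N u + 1"
      using wD[of n] w(2)[of n] w'(2)[of n] by (meson add_left_mono less_imp_le order_trans)+
  qed
  have pos_le: "H.N (\<lambda>x. max (v x) 0) \<le> H.N u + 1" "H.N (\<lambda>x. max (- v x) 0) \<le> H.N u + 1"
    if "v \<in> D" "H.N v \<le> H.N u + 1" for v
    using pos_part_HN[OF that(1)] pos_part_HN[OF F.uminus_mem[OF that(1)]] H.N_scale[OF that(1), of "-1"] that(2)
    by simp_all
  have pM: "H.N (p n) \<le> 3 * (H.N u + 1)" for n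
    using min_mem(2)[OF pos_part(1)[OF wD(1)] pos_part(1)[OF wD(2)], of n n]
      pos_le(1)[OF wD(1) w_le(1), of n] pos_le(1)[OF wD(2) w_le(2), of n]
    by (simp add: p_def)
  have qM: "H.N (q n) \<le> 3 * (H.N u + 1)" for n
    using min_mem(2)[OF pos_part(1)[OF F.uminus_mem[OF wD(1)]] pos_part(1)[OF F.uminus_mem[OF wD(2)]], of n n]
      pos_le(2)[OF wD(1) w_le(1), of n] pos_le(2)[OF wD(2) w_le(2), of n]
    by (simp add: q_def)
  have sM: "H.N (s n) \<le> 6 * (H.N u + 1)" for n
    using order_trans[OF H.N_triangle_diff[OF pq, of n n] add_mono[OF pM qM]] by (simp add: s_def)
  have sL: "(\<lambda>n. L.N (\<lambda>x. s n x - u x)) \<longlonglongrightarrow> 0"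
  proof (rule tendsto_sandwich[OF _ _ tendsto_const])
    \<comment> \<open>Positive and negative part each err by at most \<open>a + b\<close>, and
      \<open>a\<close> and \<open>b\<close> have norm at most 1 / (n + 1); hence the 4.\<close>
    show "\<forall>\<^sub>F n in sequentially. L.N (\<lambda>x. s n x - u x) \<le> 4 * (1 / real (Suc n))"
    proof (intro always_eventually allI)
      fix n
      define a where "a = (\<lambda>x. \<bar>u x - w n x\<bar>)"
      define b where "b = (\<lambda>x. \<bar>u x - w' n x\<bar>)"
      have D: "(\<lambda>x. u x - w n x) \<in> D" "(\<lambda>x. u x - w' n x) \<in> D" by (intro F.diff_mem u wD)+
      have meas: "a \<in> borel_measurable m" "b \<in> borel_measurable m"
        using D_meas[OF D(1)] D_meas[OF D(2)] unfolding a_def b_def by measurable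
      have ab: "a \<in> L2 m" "b \<in> L2 m"
        by (rule L2_bound[OF D_L2[OF D(1)] meas(1)], simp add: a_def)
           (rule L2_bound[OF D_L2[OF D(2)] meas(2)], simp add: b_def)
      have "L.N a \<le> L.N (\<lambda>x. u x - w n x)" by (rule LN_mono[OF D_L2[OF D(1)] meas(1)]) (simp add: a_def)
      then have a1: "L.N a \<le> 1 / real (Suc n)" using LN_le_HN[OF D(1)] w(2)[of n] by linarith
      have "L.N b \<le> L.N (\<lambda>x. u x - w' n x)" by (rule LN_mono[OF D_L2[OF D(2)] meas(2)]) (simp add: b_def)
      then have b1: "L.N b \<le> 1 / real (Suc n)" using LN_le_HN[OF D(2)] w'(2)[of n] by linarith
      have "L.N (\<lambda>x. s n x - u x) \<le> L.N (\<lambda>x. 2 * (a x + b x))"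
      proof (rule LN_mono)
        show "(\<lambda>x. s n x - u x) \<in> borel_measurable m" by (intro D_meas F.diff_mem sD u)
        show "AE x in m. \<bar>s n x - u x\<bar> \<le> \<bar>2 * (a x + b x)\<bar>"
        proof (rule AE_I2)
          fix x
          have lip: "\<bar>min (max r 0) (max r' 0) - max t 0\<bar> \<le> \<bar>t - r\<bar> + \<bar>t - r'\<bar>" for r r' t :: real
            unfolding min_def max_def by auto
          have "\<bar>p n x - max (u x) 0\<bar> \<le> a x + b x" unfolding p_def a_def b_def by (rule lip)
          moreover have "\<bar>q n x - max (- u x) 0\<bar> \<le> a x + b x"
            using lip[of "- w n x" "- w' n x" "- u x"] unfolding q_def a_def b_def
            by (simp add: abs_minus_commute)
          moreover have "s n x - u x = (p n x - max (u x) 0) - (q n x - max (- u x) 0)"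
            by (simp add: s_def max_def)
          ultimately have "\<bar>s n x - u x\<bar> \<le> (a x + b x) + (a x + b x)"
            using abs_triangle_ineq4[of "p n x - max (u x) 0" "q n x - max (- u x) 0"] by linarith
          then show "\<bar>s n x - u x\<bar> \<le> \<bar>2 * (a x + b x)\<bar>" by simp
        qed
      qed (intro L.mem ab)
      also have "\<dots> = 2 * L.N (\<lambda>x. a x + b x)" using L.N_scale[OF L.add_mem[OF ab], of 2] by simp
      also have "\<dots> \<le> 2 * (1 / real (Suc n) + 1 / real (Suc n))"
        using L.N_triangle[OF ab] a1 b1 by (intro mult_left_mono) auto
      finally show "L.N (\<lambda>x. s n x - u x) \<le> 4 * (1 / real (Suc n))" by simp
    qed
    show "(\<lambda>n. 4 * (1 / real (Suc n))) \<longlonglongrightarrow> 0"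
      using LIMSEQ_Suc[OF lim_const_over_n[of 4]] by simp
    show "\<forall>\<^sub>F n in sequentially. 0 \<le> L.N (\<lambda>x. s n x - u x)"
      by (intro always_eventually allI L.N_nonneg L.diff_mem D_L2 sD u)
  qed
  have sDF: "s n \<in> DF m D (F (max (k n) (k' n)) \<inter> G (max (k n) (k' n)))" for n
  proof -
    let ?l = "max (k n) (k' n)"
    have "w n \<in> DF m D (F ?l)" by (rule DF_mono[OF incseqD[OF inc(1)] w(1)]) simp
    moreover have "w' n \<in> DF m D (G ?l)" by (rule DF_mono[OF incseqD[OF inc(2)] w'(1)]) simp
    ultimately have "AE x in m. x \<notin> F ?l \<longrightarrow> w n x = 0" "AE x in m. x \<notin> G ?l \<longrightarrow> w' n x = 0"
      by (auto simp: DF_def)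
    then have "AE x in m. x \<notin> F ?l \<inter> G ?l \<longrightarrow> s n x = 0"
      by eventually_elim (auto simp: s_def p_def q_def)
    then show ?thesis using sD by (simp add: DF_def)
  qed
  obtain c where c: "\<And>n. c n \<in> midhull (s ` {n..})" "(\<lambda>n. H.N (\<lambda>x. c n x - u x)) \<longlonglongrightarrow> 0"
    using weak_limit[of s, OF sD sM D_L2[OF u] sL] by auto
  \<comment> \<open>A midpoint combination involves finitely many \<open>s n\<close>, so one level
    of the increasing intersections serves all of them.\<close>
  have hull: "\<exists>l. v \<in> DF m D (F l \<inter> G l)" if "v \<in> midhull (s ` {n..})" for v n
    using that
  proof (induction rule: midhull.induct)
    case (base v)
    then show ?case using sDF by blast
  next
    case (mid v v')
    then obtain l l' where l: "v \<in> DF m D (F l \<inter> G l)" "v' \<in> DF m D (F l' \<inter> G l')" by blast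
    have v: "v \<in> DF m D (F (max l l') \<inter> G (max l l'))" "v' \<in> DF m D (F (max l l') \<inter> G (max l l'))"
      by (rule DF_mono[OF incseqD[OF I] l(1)], simp) (rule DF_mono[OF incseqD[OF I] l(2)], simp)
    then have "AE x in m. x \<notin> F (max l l') \<inter> G (max l l') \<longrightarrow> v x = 0"
      "AE x in m. x \<notin> F (max l l') \<inter> G (max l l') \<longrightarrow> v' x = 0" by (auto simp: DF_def)
    then have "AE x in m. x \<notin> F (max l l') \<inter> G (max l l') \<longrightarrow> (v x + v' x) / 2 = 0"
      by eventually_elim auto
    then have "(\<lambda>x. (v x + v' x) / 2) \<in> DF m D (F (max l l') \<inter> G (max l l'))"
      using v F.mid_mem[of v v'] by (simp add: DF_def)
    then show ?case by blast
  qed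
  have "\<forall>\<^sub>F n in sequentially. H.N (\<lambda>x. c n x - u x) < e" using c(2) e by (rule order_tendstoD)
  then obtain n where n: "H.N (\<lambda>x. c n x - u x) < e" unfolding eventually_sequentially by blast
  obtain l where l: "c n \<in> DF m D (F l \<inter> G l)" using hull[OF c(1)] by blast
  then have "c n \<in> D" by (simp add: DF_def)
  then have "H.N (\<lambda>x. u x - c n x) < e" using n H.N_minus_commute[OF _ u] by simp
  with l show "\<exists>k. \<exists>w\<in>DF m D (F k \<inter> G k). H.N (\<lambda>x. u x - w x) < e" by blast
qed

text \<open>A strictly positive L2 function is approximated by \<open>D\<close>, and then by
  functions vanishing off some \<open>F k\<close>. Its restriction to the complement of the union
  therefore has norm 0, and positivity makes that complement null.\<close>

lemma nest_AE_Union: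
  assumes sf: "sigma_finite_measure m" and F: "nest m \<E> D F"
  shows "AE x in m. \<exists>k. x \<in> F k"
proof -
  obtain h :: "'a \<Rightarrow> real" where h: "h \<in> borel_measurable m" "\<And>x. 0 < h x" "\<And>x. h x \<le> 1" "integrable m h"
    using sigma_finite_measure.obtain_positive_integrable_function[OF sf] by metis
  have hL: "h \<in> L2 m"
  proof -
    have "integrable m (\<lambda>x. (h x)\<^sup>2)"
    proof (rule Bochner_Integration.integrable_bound[OF h(4)], use h(1) in measurable, intro AE_I2)
      fix x show "norm ((h x)\<^sup>2) \<le> norm (h x)"
        using h(2)[of x] h(3)[of x] by (simp add: power2_eq_square mult_left_le)
    qed
    then show ?thesis using h by (simp add: L2_def)
  qed
  define A where "A = (\<Union>k. F k)"
  have A: "A \<in> sets m" using F radon_space[OF radon] unfolding A_def nest_def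
    by (auto intro!: sets.countable_UN)
  define f where "f x = indicat_real (- A) x * h x" for x
  have "- A \<in> sets m" using A radon_space[OF radon] sets.compl_sets[OF A] by (simp add: Compl_eq_Diff_UNIV)
  then have fm: "f \<in> borel_measurable m" unfolding f_def[abs_def] using h(1) by measurable
  have fL: "f \<in> L2 m" by (rule L2_bound[OF hL fm]) (auto simp: f_def indicator_def)
  have "L.N f \<le> 0"
  proof (rule field_le_epsilon)
    fix e :: real assume e: "e > 0"
    then have "(e / 2)\<^sup>2 > 0" by simp
    then obtain u where u: "u \<in> D" "(\<integral>x. (h x - u x)\<^sup>2 \<partial>m) < (e / 2)\<^sup>2"
      using form hL unfolding form_on_L2_def by blast
    have hu: "L.N (\<lambda>x. h x - u x) < e / 2"
      using u(2) e unfolding L.N_def by (intro real_less_lsqrt) (auto simp: power2_eq_square)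
    have "e / 2 > 0" using e by simp
    from nestD_HN[OF F u(1) this] obtain k w where w: "w \<in> DF m D (F k)" "H.N (\<lambda>x. u x - w x) < e / 2"
      by blast
    have wD: "w \<in> D" using w by (simp add: DF_def)
    have "AE x in m. x \<notin> F k \<longrightarrow> w x = 0" using w by (simp add: DF_def)
    then have "AE x in m. \<bar>f x\<bar> \<le> \<bar>h x - w x\<bar>"
      by eventually_elim (auto simp: f_def A_def indicator_def)
    then have "L.N f \<le> L.N (\<lambda>x. h x - w x)" by (intro LN_mono L.diff_mem hL D_L2 wD fm)
    also have "\<dots> \<le> L.N (\<lambda>x. h x - u x) + L.N (\<lambda>x. u x - w x)"
      by (intro L.N_triangle_3 hL D_L2 u wD)
    also have "L.N (\<lambda>x. u x - w x) \<le> H.N (\<lambda>x. u x - w x)" by (intro LN_le_HN F.diff_mem u wD)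
    finally show "L.N f \<le> 0 + e" using hu w(2) by simp
  qed
  then have "L.N f = 0" using L.N_nonneg[OF fL] by simp
  from LN_zero_AE[OF fL this] show ?thesis
  proof eventually_elim
    case (elim x)
    then show ?case using h(2)[of x] by (auto simp: f_def A_def indicator_def split: if_splits)
  qed
qed

text \<open>Replacing each set of a nest by the support of the restricted measure gives a regular nest,
  on which almost everywhere inequalities between continuous functions hold everywhere.\<close>

lemma nest_support:
  assumes F: "nest m \<E> D F"
  defines "S \<equiv> \<lambda>k. {x. \<forall>U. open U \<and> x \<in> U \<longrightarrow> emeasure m (U \<inter> F k) > 0}"
  shows "nest m \<E> D S" "S k \<subseteq> F k"
proof -
  have inc: "incseq F" and cl: "\<And>k. closed (F k)" using F by (auto simp: nest_def)
  have meas: "U \<inter> F k \<in> sets m" if "open U" for U k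
    using that cl radon_space[OF radon] by auto
  show sub: "S k \<subseteq> F k" for k
  proof
    fix x assume x: "x \<in> S k"
    show "x \<in> F k"
    proof (rule ccontr)
      assume "x \<notin> F k"
      then have "x \<in> - F k" by simp
      moreover have "open (- F k)" using cl by (rule open_Compl)
      ultimately have "emeasure m (- F k \<inter> F k) > 0" using x unfolding S_def by blast
      then show False by simp
    qed
  qed
  show "nest m \<E> D S"
  proof (rule nestI_HN)
    show "incseq S"
    proof (rule monoI, rule subsetI)
      fix k l x assume kl: "k \<le> l" and x: "x \<in> S k"
      have "emeasure m (U \<inter> F l) > 0" if "open U" "x \<in> U" for U
      proof -
        have "0 < emeasure m (U \<inter> F k)" using x that by (simp add: S_def)
        also have "\<dots> \<le> emeasure m (U \<inter> F l)"
          using incseqD[OF inc kl] that by (intro emeasure_mono meas) auto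
        finally show ?thesis .
      qed
      then show "x \<in> S l" by (simp add: S_def)
    qed
    show "closed (S k)" for k
    proof -
      have "- S k = \<Union>{U. open U \<and> \<not> emeasure m (U \<inter> F k) > 0}" by (auto simp: S_def)
      then have "open (- S k)" by (simp only:) (rule open_Union, blast)
      then show ?thesis by (simp add: closed_def)
    qed
    fix u and e :: real assume "u \<in> D" "e > 0"
    then obtain k w where w: "w \<in> DF m D (F k)" "H.N (\<lambda>x. u x - w x) < e"
      using nestD_HN[OF F] by blast
    \<comment> \<open>The complement of \<open>S k\<close> is a union of open sets that are null
      inside \<open>F k\<close>; countably many suffice, so \<open>w\<close>, which vanishes off
      \<open>F k\<close>, vanishes off \<open>S k\<close> as well.\<close>
    define \<U> where "\<U> = {U. open U \<and> emeasure m (U \<inter> F k) = 0}"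
    obtain \<V> where \<V>: "\<V> \<subseteq> \<U>" "countable \<V>" "\<Union>\<V> = \<Union>\<U>"
      using Lindelof[of \<U>] by (auto simp: \<U>_def)
    have "AE x in m. \<forall>V\<in>\<V>. x \<notin> V \<inter> F k"
    proof (rule AE_ball_countable'[OF _ \<V>(2)])
      fix V assume "V \<in> \<V>"
      then have "open V" "emeasure m (V \<inter> F k) = 0" using \<V>(1) by (auto simp: \<U>_def)
      then show "AE x in m. x \<notin> V \<inter> F k" by (intro AE_not_in null_setsI meas) auto
    qed
    moreover have "AE x in m. x \<notin> F k \<longrightarrow> w x = 0" using w by (simp add: DF_def)
    ultimately have "AE x in m. x \<notin> S k \<longrightarrow> w x = 0"
    proof eventually_elim
      case (elim x)
      show ?case
      proof
        assume "x \<notin> S k"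
        then have "x \<in> \<Union>\<V>" unfolding \<V>(3) by (auto simp: S_def \<U>_def)
        then show "w x = 0" using elim by blast
      qed
    qed
    then have "w \<in> DF m D (S k)" using w(1) by (simp add: DF_def)
    with w(2) show "\<exists>k. \<exists>w\<in>DF m D (S k). H.N (\<lambda>x. u x - w x) < e" by blast
  qed
qed

text \<open>A violation at a point of the support spreads by continuity to a relatively open subset
  of \<open>F k\<close>, which has positive measure there.\<close>

lemma AE_imp_qe:
  fixes u v :: "'a \<Rightarrow> real"
  assumes F: "nest m \<E> D F" and cont: "\<And>k. continuous_on (F k) u" "\<And>k. continuous_on (F k) v"
    and le: "AE x in m. u x \<le> v x"
  shows "qe m \<E> D (\<lambda>x. u x \<le> v x)"
  unfolding qe_def exceptional_def
proof (intro exI conjI subsetI INT_I ComplI)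
  define S where "S = (\<lambda>k. {x. \<forall>U. open U \<and> x \<in> U \<longrightarrow> emeasure m (U \<inter> F k) > 0})"
  show "nest m \<E> D S" unfolding S_def by (rule nest_support(1)[OF F])
  fix x k assume x: "x \<in> {x. \<not> u x \<le> v x}" and xS: "x \<in> S k"
  have "continuous_on (F k) (\<lambda>x. u x - v x)" by (intro continuous_intros cont)
  then obtain U where U: "open U" "U \<inter> F k = (\<lambda>x. u x - v x) -` {0<..} \<inter> F k"
    unfolding continuous_on_open_invariant by (metis open_greaterThan)
  have "x \<in> F k" using nest_support(2)[OF F] xS unfolding S_def by blast
  then have "x \<in> U" using U x by auto
  then have "emeasure m (U \<inter> F k) > 0" using xS U(1) unfolding S_def by blast
  moreover have "AE x in m. x \<notin> U \<inter> F k"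
    using le by eventually_elim (use U in auto)
  ultimately show False
    using emeasure_eq_0_AE[of "\<lambda>x. x \<in> U \<inter> F k" m]
    unfolding radon_space(2)[OF radon] by (simp only: UNIV_I simp_thms Collect_mem_eq less_irrefl)
qed

end

text \<open>Quasi-continuity says nothing off the union of the nest, whereas test functions in
  \<open>renorm_sol\<close> must be Borel everywhere; the value 0 is imposed there.\<close>

lemma borel_measurable_nest:
  fixes h :: "'a::topological_space \<Rightarrow> real"
  assumes "incseq F" "\<And>k. closed (F k)" "\<And>k. continuous_on (F k) h"
  shows "(\<lambda>x. if x \<in> (\<Union>k. F k) then h x else 0) \<in> borel_measurable borel"
proof (rule borel_measurable_LIMSEQ_real)
  show "(\<lambda>x. indicat_real (F k) x *\<^sub>R h x) \<in> borel_measurable borel" for k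
    by (intro borel_measurable_continuous_on_indicator assms) (simp add: assms)
  fix x :: 'a
  show "(\<lambda>k. indicat_real (F k) x *\<^sub>R h x) \<longlonglongrightarrow> (if x \<in> (\<Union>k. F k) then h x else 0)"
  proof (cases "x \<in> (\<Union>k. F k)")
    case True
    then obtain k0 where "x \<in> F k0" by blast
    then have "x \<in> F k" if "k \<ge> k0" for k using incseqD[OF assms(1) that] by blast
    then have "\<forall>\<^sub>F k in sequentially. indicat_real (F k) x *\<^sub>R h x = h x"
      unfolding eventually_sequentially by (intro exI[of _ k0]) simp
    then show ?thesis using True by (simp add: tendsto_eventually)
  qed simp
qed

section \<open>Integrals with respect to signed measures\<close>

text \<open>The layer cake sums express \<open>sint \<mu> f\<close> as a limit of averages of values \<open>sval \<mu> B\<close>, so that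
  inequalities between set functions pass to integrals without a Hahn decomposition.\<close>

definition layers :: "nat \<Rightarrow> ('a \<Rightarrow> real) \<Rightarrow> nat \<Rightarrow> 'a set" where
  "layers n f i = {x. real i \<le> real n * f x}"

text \<open>Counting starts at 1 because layer 0 is the whole space; the number of layers containing
  x is then exactly the floor.\<close>

lemma sum_layers:
  assumes "0 \<le> f x" "f x \<le> 1"
  shows "(\<Sum>i\<in>{1..n}. indicat_real (layers n f i) x) = real (nat \<lfloor>real n * f x\<rfloor>)"
proof -
  have "real n * f x \<le> real n" using assms by (simp add: mult_left_le)
  then have "{i \<in> {1..n}. x \<in> layers n f i} = {1..nat \<lfloor>real n * f x\<rfloor>}"
    using assms by (auto simp: layers_def le_nat_floor le_floor_iff) (linarith | simp add: floor_le_iff le_nat_iff)+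
  then have "card {i \<in> {1..n}. x \<in> layers n f i} = nat \<lfloor>real n * f x\<rfloor>" by simp
  moreover have "(\<Sum>i\<in>{1..n}. indicat_real (layers n f i) x) = real (card {i \<in> {1..n}. x \<in> layers n f i})"
    by (simp add: indicator_def sum.If_cases Int_def)
  ultimately show ?thesis by simp
qed

lemma integral_layers:
  fixes M :: "'a::topological_space measure"
  assumes M: "finite_measure M" "sets M = sets borel" and f: "f \<in> borel_measurable borel"
    and f01: "\<And>x. 0 \<le> f x" "\<And>x. f x \<le> 1"
  shows "(\<lambda>n. (\<Sum>i\<in>{1..n}. measure M (layers n f i)) / real n) \<longlonglongrightarrow> (\<integral>x. f x \<partial>M)"
proof -
  interpret finite_measure M by fact
  have fM: "f \<in> borel_measurable M" using f M(2) by (simp cong: measurable_cong_sets)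
  have sp: "space M = UNIV" using sets_eq_imp_space_eq[OF M(2)] by simp
  have "layers n f i = (\<lambda>x. real n * f x) -` {real i..} \<inter> space M" for n i by (auto simp: layers_def sp)
  moreover have "(\<lambda>x. real n * f x) \<in> borel_measurable M" for n using fM by measurable
  ultimately have S: "layers n f i \<in> sets M" for n i by (metis measurable_sets atLeast_borel)
  define F where "F n x = (\<Sum>i\<in>{1..n}. indicat_real (layers n f i) x) / real n" for n x
  have "(\<integral>x. F n x \<partial>M) = (\<Sum>i\<in>{1..n}. measure M (layers n f i)) / real n" for n
    using S by (simp add: F_def Bochner_Integration.integral_sum integrable_real_indicator emeasure_finite less_top[symmetric])
  moreover have "(\<lambda>n. \<integral>x. F n x \<partial>M) \<longlonglongrightarrow> (\<integral>x. f x \<partial>M)"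
  proof (rule integral_dominated_convergence[where w = "\<lambda>_. 1"])
    have bd: "f x - 1 / real n \<le> F n x" "F n x \<le> f x" if n: "n \<ge> 1" for n x
    proof -
      let ?t = "real n * f x"
      have t: "0 \<le> ?t" using f01 by simp
      have F: "F n x = real_of_int \<lfloor>?t\<rfloor> / real n" using t by (simp only: F_def sum_layers[of f, OF f01] of_nat_nat zero_le_floor)
      have "(?t - 1) / real n \<le> F n x" unfolding F by (intro divide_right_mono) linarith+
      then show "f x - 1 / real n \<le> F n x" using n by (simp add: diff_divide_distrib)
      have "F n x \<le> ?t / real n" unfolding F by (intro divide_right_mono) linarith+
      then show "F n x \<le> f x" using n by simp
    qed
    show "AE x in M. (\<lambda>n. F n x) \<longlonglongrightarrow> f x"
    proof (rule AE_I2, rule tendsto_sandwich)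
      fix x
      show "\<forall>\<^sub>F n in sequentially. f x - 1 / real n \<le> F n x" "\<forall>\<^sub>F n in sequentially. F n x \<le> f x"
        unfolding eventually_sequentially using bd by blast+
      have "(\<lambda>n. f x - 1 / real n) \<longlonglongrightarrow> f x - 0" by (intro tendsto_intros lim_const_over_n)
      then show "(\<lambda>n. f x - 1 / real n) \<longlonglongrightarrow> f x" by simp
    qed simp
    show "AE x in M. norm (F n x) \<le> 1" for n
    proof (rule AE_I2)
      fix x
      have "F n x \<ge> 0" by (auto simp: F_def intro!: divide_nonneg_nonneg sum_nonneg)
      \<comment> \<open>For n = 0 the quotient is 0 by the convention for division by zero, so that
        case is separate.\<close>
      moreover have "F n x \<le> 1"
      proof (cases "n = 0")
        case False
        then show ?thesis by (intro order_trans[OF bd(2) f01(2)]) simp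
      qed (simp add: F_def)
      ultimately show "norm (F n x) \<le> 1" by simp
    qed
    show "F n \<in> borel_measurable M" for n unfolding F_def[abs_def] using S by measurable
  qed (use fM in auto)
  ultimately show ?thesis by simp
qed

lemma layers_borel:
  "f \<in> borel_measurable borel \<Longrightarrow> layers n f i \<in> sets borel"
proof -
  assume f: "f \<in> borel_measurable borel"
  then have "(\<lambda>x. real n * f x) \<in> borel_measurable borel" by measurable
  from measurable_sets[OF this atLeast_borel[of "real i"]] show ?thesis
    by (simp add: layers_def vimage_def)
qed

lemma sint_layers:
  assumes M: "M0b m \<E> D \<mu>" and f: "f \<in> borel_measurable borel" "\<And>x. 0 \<le> f x" "\<And>x. f x \<le> 1"
  shows "(\<lambda>n. (\<Sum>i\<in>{1..n}. sval \<mu> (layers n f i)) / real n) \<longlonglongrightarrow> sint \<mu> f"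
proof -
  have "(\<lambda>n. (\<Sum>i\<in>{1..n}. measure (fst \<mu>) (layers n f i)) / real n
      - (\<Sum>i\<in>{1..n}. measure (snd \<mu>) (layers n f i)) / real n) \<longlonglongrightarrow> sint \<mu> f"
    unfolding sint_def using M by (intro tendsto_diff integral_layers f) (auto simp: M0b_def smooth_def)
  then show ?thesis by (simp add: sval_def sum_subtractf diff_divide_distrib)
qed

lemma sint_mono:
  assumes "M0b m \<E> D \<mu>" "M0b m \<E> D \<nu>" "sle \<mu> \<nu>"
    and f: "f \<in> borel_measurable borel" "\<And>x. 0 \<le> f x" "\<And>x. f x \<le> 1"
  shows "sint \<mu> f \<le> sint \<nu> f"
proof (rule LIMSEQ_le[OF sint_layers[OF assms(1) f] sint_layers[OF assms(2) f]], intro exI allI impI)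
  fix n
  show "(\<Sum>i\<in>{1..n}. sval \<mu> (layers n f i)) / real n \<le> (\<Sum>i\<in>{1..n}. sval \<nu> (layers n f i)) / real n"
    using assms(3) layers_borel[OF f(1)] by (intro divide_right_mono sum_mono) (auto simp: sle_def)
qed

lemma sval_le_tv_norm:
  assumes M: "M0b m \<E> D \<mu>" and B: "B \<in> sets borel"
  shows "\<bar>sval \<mu> B\<bar> \<le> tv_norm \<mu>"
proof -
  interpret P: finite_measure "fst \<mu>" using M by (simp add: M0b_def)
  interpret N: finite_measure "snd \<mu>" using M by (simp add: M0b_def)
  define c where "c = measure (fst \<mu>) (space (fst \<mu>)) + measure (snd \<mu>) (space (snd \<mu>))"
  have c: "\<bar>sval \<mu> B\<bar> \<le> c" for B
    using P.bounded_measure[of B] N.bounded_measure[of B] measure_nonneg[of "fst \<mu>" B] measure_nonneg[of "snd \<mu>" B]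
    unfolding sval_def c_def by linarith
  have "\<bar>sval \<mu> B\<bar> + \<bar>sval \<mu> (UNIV - B)\<bar> \<le> tv_norm \<mu>"
    unfolding tv_norm_def
  proof (rule cSUP_upper[OF B])
    show "bdd_above ((\<lambda>B. \<bar>sval \<mu> B\<bar> + \<bar>sval \<mu> (UNIV - B)\<bar>) ` sets borel)"
      by (rule bdd_aboveI2[of _ _ "c + c"]) (intro add_mono c)
  qed
  then show ?thesis by linarith
qed

text \<open>Each layer contributes at most the total variation, and the n layers are averaged. The
  constant 1 rests on \<open>f\<close> taking values in [0, 1].\<close>

lemma sint_le_tv_norm:
  assumes M: "M0b m \<E> D \<mu>" and f: "f \<in> borel_measurable borel" "\<And>x. 0 \<le> f x" "\<And>x. f x \<le> 1"
  shows "\<bar>sint \<mu> f\<bar> \<le> tv_norm \<mu>"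
proof (rule LIMSEQ_le_const2[OF tendsto_rabs[OF sint_layers[OF M f]]], intro exI[of _ 1] allI impI)
  fix n :: nat assume n: "1 \<le> n"
  have "\<bar>\<Sum>i\<in>{1..n}. sval \<mu> (layers n f i)\<bar> \<le> (\<Sum>i\<in>{1..n}. \<bar>sval \<mu> (layers n f i)\<bar>)" by (rule sum_abs)
  also have "\<dots> \<le> (\<Sum>i\<in>{1..n}. tv_norm \<mu>)" by (intro sum_mono sval_le_tv_norm[OF M] layers_borel f)
  also have "\<dots> = real n * tv_norm \<mu>" by simp
  finally show "\<bar>(\<Sum>i\<in>{1..n}. sval \<mu> (layers n f i)) / real n\<bar> \<le> tv_norm \<mu>"
    using n by (simp add: field_simps)
qed

section \<open>Comparison of renormalized solutions\<close>

lemma Tk_mono: "k \<ge> 0 \<Longrightarrow> s \<le> t \<Longrightarrow> Tk k s \<le> Tk k t" by (auto simp: Tk_def)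

theorem theorem3p6:
  fixes m :: "'a::{metric_space, second_countable_topology} measure"
    and \<E> :: "('a \<Rightarrow> real) \<Rightarrow> ('a \<Rightarrow> real) \<Rightarrow> real"
    and D :: "('a \<Rightarrow> real) set"
    and f1 f2 :: "'a \<Rightarrow> real \<Rightarrow> real"
    and \<mu>1 \<mu>2 :: "'a smeasure"
    and u1 u2 :: "'a \<Rightarrow> real"
  assumes "locally_compact_space (euclidean :: 'a topology)"
    and "radon_full m"
    and "dirichlet_form m \<E> D" and "regular_form m \<E> D" and "transient m \<E> D"
    and "strong_sector \<E> D"
    and "(\<lambda>(x, y). f1 x y) \<in> borel_measurable borel"
    and "(\<lambda>(x, y). f2 x y) \<in> borel_measurable borel"
    and "M0b m \<E> D \<mu>1" and "M0b m \<E> D \<mu>2"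
    and "renorm_sol m \<E> D f1 \<mu>1 u1" and "renorm_sol m \<E> D f2 \<mu>2 u2"
    and "sle \<mu>1 \<mu>2"
    and "((AE x in m. f1 x (u1 x) \<le> f2 x (u1 x)) \<and>
            (\<forall>x y1 y2. (f2 x y1 - f2 x y2) * (y1 - y2) \<le> 0))
       \<or> ((AE x in m. f1 x (u2 x) \<le> f2 x (u2 x)) \<and>
            (\<forall>x y1 y2. (f1 x y1 - f1 x y2) * (y1 - y2) \<le> 0))"
  shows "qe m \<E> D (\<lambda>x. u1 x \<le> u2 x)"
proof -
  interpret regular_strong_dirichlet m \<E> D
    by unfold_locales (fact assms)+
  have sf: "sigma_finite_measure m" by (rule radon_sigma_finite[OF assms(1,2)])
  note sp = radon_space[OF radon]
  obtain g C where gC: "g \<in> borel_measurable m \<and> (\<forall>x\<in>space m. 0 < g x) \<and> integrable m g \<and>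
    (\<forall>v\<in>D. integrable m (\<lambda>x. g x * v x) \<and> (\<integral>x. g x * v x \<partial>m) \<le> C * F.N v)"
    using transient_bound[OF sf assms(5)] by (elim exE)
  then have g: "g \<in> borel_measurable m" "\<And>x. 0 < g x" "integrable m g"
    and C: "\<And>v. v \<in> D \<Longrightarrow> (\<integral>x. g x * v x \<partial>m) \<le> C * F.N v"
    using sp(2) by simp_all
  have qc: "quasi_continuous m \<E> D u1" "quasi_continuous m \<E> D u2"
    using assms(11,12) by (simp_all only: renorm_sol_def)
  obtain F1 where F1: "nest m \<E> D F1" "\<forall>k. continuous_on (F1 k) u1"
    using qc(1) unfolding quasi_continuous_def by (elim exE conjE)
  obtain F2 where F2: "nest m \<E> D F2" "\<forall>k. continuous_on (F2 k) u2"
    using qc(2) unfolding quasi_continuous_def by (elim exE conjE)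
  define F where "F = (\<lambda>k. F1 k \<inter> F2 k)"
  have F: "nest m \<E> D F" unfolding F_def by (rule nest_Int[OF F1(1) F2(1)])
  have F_cont: "continuous_on (F k) u1" "continuous_on (F k) u2" for k
    using continuous_on_subset[OF F1(2)[rule_format], of "F k" k]
      continuous_on_subset[OF F2(2)[rule_format], of "F k" k] by (simp_all add: F_def)
  define A where "A = (\<Union>k. F k)"
  have A: "AE x in m. x \<in> A" using nest_AE_Union[OF sf F] by (simp add: A_def)
  \<comment> \<open>The equation is available for levels from 1 on, hence \<open>Suc n\<close>.
    \<open>V n\<close> is the test function in the extended space, and \<open>W n\<close> its Borel
    quasi-continuous version.\<close>
  define V where "V n x = clip (Tk (real (Suc n)) (u1 x) - Tk (real (Suc n)) (u2 x))" for n x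
  define W where "W n x = (if x \<in> A then V n x else 0)" for n x
  have W01: "0 \<le> W n x" "W n x \<le> 1" for n x by (simp_all add: W_def V_def)
  have V_cont: "continuous_on (F k) (V n)" for n k
    unfolding V_def Tk_def by (intro clip_continuous continuous_intros F_cont)
  have W_borel: "W n \<in> borel_measurable borel" for n
    unfolding W_def[abs_def] A_def
    by (rule borel_measurable_nest) (use F V_cont in \<open>auto simp: nest_def\<close>)
  have Wm: "W n \<in> borel_measurable m" for n
    using W_borel sp(1) by (simp cong: measurable_cong_sets)
  have "continuous_on (F k) (W n)" for n k
    using V_cont[of k n] by (rule continuous_on_eq) (auto simp: W_def A_def)
  then have W_qc: "quasi_continuous m \<E> D (W n)" for n
    using F unfolding quasi_continuous_def by blast
  have WV: "AE x in m. W n x = V n x" for n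
    using A by eventually_elim (simp add: W_def)
  define U1 where "U1 n = (\<lambda>x. Tk (real (Suc n)) (u1 x))" for n
  define U2 where "U2 n = (\<lambda>x. Tk (real (Suc n)) (u2 x))" for n
  have U: "U1 n \<in> ext_space m \<E> D" "U2 n \<in> ext_space m \<E> D" for n
    using assms(11,12) unfolding renorm_sol_def U1_def U2_def by (elim conjE, simp del: of_nat_Suc)+
  have V_eq: "V n = (\<lambda>x. clip (U1 n x - U2 n x))" for n by (rule ext) (simp add: V_def U1_def U2_def)
  have V_ext: "V n \<in> ext_space m \<E> D" for n unfolding V_eq by (rule ext_clip(1)[OF U])
  have V_bd: "\<exists>C. AE x in m. \<bar>V n x\<bar> \<le> C" for n by (intro exI[of _ 1] AE_I2) (simp add: V_def)
  obtain \<nu>1 where \<nu>1: "\<forall>k. M0b m \<E> D (\<nu>1 k)" "(\<lambda>k. tv_norm (\<nu>1 k)) \<longlonglongrightarrow> 0"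
      "\<forall>k::nat. k \<ge> 1 \<longrightarrow> (\<forall>v\<in>ext_space m \<E> D. (\<exists>C. AE x in m. \<bar>v x\<bar> \<le> C) \<longrightarrow>
        (\<forall>vt. vt \<in> borel_measurable borel \<and> quasi_continuous m \<E> D vt \<and> (AE x in m. vt x = v x) \<longrightarrow>
          ext_form m \<E> D (\<lambda>x. Tk (real k) (u1 x)) v
            = (\<integral>x. vt x * f1 x (u1 x) \<partial>completion m) + sint \<mu>1 vt + sint (\<nu>1 k) vt))"
    using assms(11) unfolding renorm_sol_def by (elim conjE exE)
  note \<nu>1 = \<nu>1(1)[rule_format] \<nu>1(2) \<nu>1(3)[rule_format]
  obtain \<nu>2 where \<nu>2: "\<forall>k. M0b m \<E> D (\<nu>2 k)" "(\<lambda>k. tv_norm (\<nu>2 k)) \<longlonglongrightarrow> 0"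
      "\<forall>k::nat. k \<ge> 1 \<longrightarrow> (\<forall>v\<in>ext_space m \<E> D. (\<exists>C. AE x in m. \<bar>v x\<bar> \<le> C) \<longrightarrow>
        (\<forall>vt. vt \<in> borel_measurable borel \<and> quasi_continuous m \<E> D vt \<and> (AE x in m. vt x = v x) \<longrightarrow>
          ext_form m \<E> D (\<lambda>x. Tk (real k) (u2 x)) v
            = (\<integral>x. vt x * f2 x (u2 x) \<partial>completion m) + sint \<mu>2 vt + sint (\<nu>2 k) vt))"
    using assms(12) unfolding renorm_sol_def by (elim conjE exE)
  note \<nu>2 = \<nu>2(1)[rule_format] \<nu>2(2) \<nu>2(3)[rule_format]
  have f_int: "integrable (completion m) (\<lambda>x. f1 x (u1 x))" "integrable (completion m) (\<lambda>x. f2 x (u2 x))"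
    using assms(11,12) by (simp_all add: renorm_sol_def)
  \<comment> \<open>The nonlinear terms live on the completion, because a quasi-continuous solution
    is Borel only up to a null set.\<close>
  have Wf_int: "integrable (completion m) (\<lambda>x. W n x * f x)" if f: "integrable (completion m) f" for f n
  proof (rule Bochner_Integration.integrable_bound[OF f])
    show "(\<lambda>x. W n x * f x) \<in> borel_measurable (completion m)"
      using measurable_completion[OF Wm, of n] f by measurable
    show "AE x in completion m. norm (W n x * f x) \<le> norm (f x)"
      using W01[where n=n] by (intro AE_I2) (simp add: abs_mult mult_left_le_one_le)
  qed
  have u_less: "u1 x > u2 x" if "W n x \<noteq> 0" for n x
  proof (rule ccontr)
    assume "\<not> u1 x > u2 x"
    then have "Tk (real (Suc n)) (u1 x) \<le> Tk (real (Suc n)) (u2 x)" by (intro Tk_mono) auto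
    then show False using that by (auto simp: W_def V_def clip_def split: if_splits)
  qed
  have "AE x in m. W n x * f1 x (u1 x) \<le> W n x * f2 x (u2 x)" for n
  proof -
    \<comment> \<open>In the first case the chain is
      \<open>f1 x (u1 x) \<le> f2 x (u1 x) \<le> f2 x (u2 x)\<close>, in the second
      \<open>f1 x (u1 x) \<le> f1 x (u2 x) \<le> f2 x (u2 x)\<close>.\<close>
    have "AE x in m. u1 x > u2 x \<longrightarrow> f1 x (u1 x) \<le> f2 x (u2 x)"
      using assms(14)
    proof (elim disjE conjE)
      assume le: "AE x in m. f1 x (u1 x) \<le> f2 x (u1 x)"
        and anti: "\<forall>x y1 y2. (f2 x y1 - f2 x y2) * (y1 - y2) \<le> 0"
      show ?thesis
        using le
      proof eventually_elim
        case (elim x)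
        then show ?case using anti[rule_format, of x "u1 x" "u2 x"] by (auto simp: mult_le_0_iff)
      qed
    next
      assume le: "AE x in m. f1 x (u2 x) \<le> f2 x (u2 x)"
        and anti: "\<forall>x y1 y2. (f1 x y1 - f1 x y2) * (y1 - y2) \<le> 0"
      show ?thesis
        using le
      proof eventually_elim
        case (elim x)
        then show ?case using anti[rule_format, of x "u1 x" "u2 x"] by (auto simp: mult_le_0_iff)
      qed
    qed
    then show ?thesis
    proof eventually_elim
      case (elim x)
      then show ?case using u_less[of n x] W01(1)[of n x] by (cases "W n x = 0") (auto intro: mult_left_mono)
    qed
  qed
  then have f_le: "(\<integral>x. W n x * f1 x (u1 x) \<partial>completion m) \<le> (\<integral>x. W n x * f2 x (u2 x) \<partial>completion m)" for n
    by (intro integral_mono_AE Wf_int f_int AE_completion)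
  define \<delta> where "\<delta> n = tv_norm (\<nu>1 (Suc n)) + tv_norm (\<nu>2 (Suc n))" for n
  have ext_le: "ext_form m \<E> D (U1 n) (V n) - ext_form m \<E> D (U2 n) (V n) \<le> \<delta> n" for n
  proof -
    have "ext_form m \<E> D (U1 n) (V n) = (\<integral>x. W n x * f1 x (u1 x) \<partial>completion m) + sint \<mu>1 (W n) + sint (\<nu>1 (Suc n)) (W n)"
      unfolding U1_def by (rule \<nu>1(3)[OF _ V_ext V_bd]) (simp_all add: W_borel W_qc WV del: of_nat_Suc)
    moreover have "ext_form m \<E> D (U2 n) (V n) = (\<integral>x. W n x * f2 x (u2 x) \<partial>completion m) + sint \<mu>2 (W n) + sint (\<nu>2 (Suc n)) (W n)"
      unfolding U2_def by (rule \<nu>2(3)[OF _ V_ext V_bd]) (simp_all add: W_borel W_qc WV del: of_nat_Suc)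
    moreover have "sint \<mu>1 (W n) \<le> sint \<mu>2 (W n)" by (rule sint_mono[OF assms(9,10,13) W_borel W01])
    moreover have "\<bar>sint (\<nu>1 (Suc n)) (W n)\<bar> \<le> tv_norm (\<nu>1 (Suc n))"
      by (rule sint_le_tv_norm[OF \<nu>1(1) W_borel W01])
    moreover have "\<bar>sint (\<nu>2 (Suc n)) (W n)\<bar> \<le> tv_norm (\<nu>2 (Suc n))"
      by (rule sint_le_tv_norm[OF \<nu>2(1) W_borel W01])
    ultimately show ?thesis using f_le[of n] unfolding \<delta>_def by linarith
  qed
  have bound: "(\<integral>x. g x * W n x \<partial>m) \<le> \<bar>C\<bar> * sqrt (\<delta> n)" for n
  proof -
    have "(\<integral>x. g x * W n x \<partial>m) \<le> \<bar>C\<bar> * sqrt (ext_form m \<E> D (U1 n) (V n) - ext_form m \<E> D (U2 n) (V n))"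
      unfolding V_eq
    proof (rule ext_clip_bound[where C = C])
      show "0 \<le> g x" for x using g(2) by (rule less_imp_le)
      show "AE x in m. W n x = clip (U1 n x - U2 n x)" using WV[of n] by (simp add: V_eq)
    qed (fact U g C Wm)+
    also have "\<dots> \<le> \<bar>C\<bar> * sqrt (\<delta> n)" by (intro mult_left_mono real_sqrt_le_mono ext_le) simp
    finally show ?thesis .
  qed
  have "(\<lambda>n. \<delta> n) \<longlonglongrightarrow> 0 + 0" unfolding \<delta>_def by (intro tendsto_add LIMSEQ_Suc \<nu>1 \<nu>2)
  then have "(\<lambda>n. \<bar>C\<bar> * sqrt (\<delta> n)) \<longlonglongrightarrow> \<bar>C\<bar> * sqrt (0 + 0)" by (intro tendsto_intros)
  then have rhs: "(\<lambda>n. \<bar>C\<bar> * sqrt (\<delta> n)) \<longlonglongrightarrow> 0" by simp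
  \<comment> \<open>The pointwise limit of \<open>W n\<close>: at each point both truncations
    eventually become inactive, so the sequence is eventually constant.\<close>
  define Z where "Z x = (if x \<in> A then clip (u1 x - u2 x) else 0)" for x
  have Z01: "0 \<le> Z x" "Z x \<le> 1" for x by (simp_all add: Z_def)
  have WZ: "(\<lambda>n. W n x) \<longlonglongrightarrow> Z x" for x
  proof (rule tendsto_eventually)
    obtain n0 where "\<bar>u1 x\<bar> + \<bar>u2 x\<bar> \<le> real n0" using real_arch_simple by blast
    then have "Tk (real (Suc n)) (u1 x) = u1 x \<and> Tk (real (Suc n)) (u2 x) = u2 x" if "n \<ge> n0" for n
      using that by (auto simp: Tk_def)
    then show "\<forall>\<^sub>F n in sequentially. W n x = Z x"
      unfolding eventually_sequentially W_def V_def Z_def by (intro exI[of _ n0]) auto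
  qed
  have Zm: "Z \<in> borel_measurable m" by (rule borel_measurable_LIMSEQ_real[OF WZ Wm])
  have "(\<lambda>n. \<integral>x. g x * W n x \<partial>m) \<longlonglongrightarrow> (\<integral>x. g x * Z x \<partial>m)"
  proof (rule integral_dominated_convergence[where w = g])
    show "AE x in m. norm (g x * W n x) \<le> g x" for n
      using W01[where n=n] g(2) by (intro AE_I2) (simp add: abs_mult abs_of_pos mult_left_le)
    show "AE x in m. (\<lambda>n. g x * W n x) \<longlonglongrightarrow> g x * Z x"
      by (intro AE_I2 tendsto_mult_left WZ)
  qed (use g Wm Zm in measurable)
  then have "(\<integral>x. g x * Z x \<partial>m) \<le> 0"
    using rhs bound by (intro LIMSEQ_le[of _ _ "\<lambda>n. \<bar>C\<bar> * sqrt (\<delta> n)"]) auto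
  moreover have gZ_pos: "0 \<le> g x * Z x" for x using g(2)[of x] Z01[of x] by simp
  ultimately have "(\<integral>x. g x * Z x \<partial>m) = 0" by (simp add: antisym integral_nonneg_AE)
  moreover have "integrable m (\<lambda>x. g x * Z x)"
    by (rule Bochner_Integration.integrable_bound[OF g(3)])
       (use g Zm Z01 in \<open>auto intro!: AE_I2 simp: abs_mult mult_left_le\<close>)
  ultimately have "AE x in m. g x * Z x = 0"
    using integral_nonneg_eq_0_iff_AE[of m "\<lambda>x. g x * Z x"] gZ_pos by simp
  with A have "AE x in m. u1 x \<le> u2 x"
  proof eventually_elim
    case (elim x)
    then have "clip (u1 x - u2 x) = 0" using g(2)[of x] by (auto simp: Z_def)
    then show ?case by (auto simp: clip_def min_def max_def split: if_splits)
  qed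
  then show ?thesis by (rule AE_imp_qe[OF F F_cont])
qed

end
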